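(* Let $(\Omega,\mathcal{F},(\mathcal{F}_t)_{t\ge 0},P)$ be a filtered probability space carrying a one-dimensional $(\mathcal{F}_t)_{t\ge 0}$-Brownian motion $(B_t)_{t\ge 0}$, and let $(H_t)_{t\ge 0}$ be a predictable process with values in a normed space $(\mathcal{S},\|\cdot\|)$. Let $x\in\mathbb{R}$, let $\sigma:\mathbb{R}\to\mathbb{R}$, and let $\kappa,b:\mathcal{A}\to\mathbb{R}$ be measurable maps, where $$\mathcal{A}:=\{(s,(x_u)_{u\le s},h):\ s\ge 0,\ (x_u)_{u\ge 0}\in C(\mathbb{R}_+,\mathbb{R}),\ h\in\mathcal{S}\}.$$ Assume that for every $T>0$ there is a constant $C_T$ such that the following hold. (i) For some $\eta>1/2$ (not depending on $T$), for all $0\le s\le t\le T$, $$\mathbb{E}[\|H_t\|^2]\le C_T\quad\text{and}\quad \mathbb{E}[\|H_t-H_s\|^2]\le C_T(t-s)^\eta .$$ (ii) For all $0\le t\le T$, all $(x_u)_{u\ge 0}\in C(\mathbb{R}_+,\mathbb{R})$ and all $h\in\mathcal{S}$, $$|\sigma(x_t)\kappa(t,(x_u)_{u\le t},h)|+|b(t,(x_u)_{u\le t},h)|\le C_T\Bigl(1+\sup_{[0,t]}|x_u|+\|h\|\Bigr).$$ (iii) For some $\theta_1\in(1/4,1]$, $\theta_2\in(1/2,1]$, $\theta_3\in(\tfrac{1}{2\eta},1]$ (not depending on $T$), for all $0\le s\le t\le T$, all $(x_u)_{u\ge 0}\in C(\mathbb{R}_+,\mathbb{R})$ and all $h,h'\in\mathcal{S}$,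 $$|\sigma(x_t)\kappa(t,(x_u)_{u\le t},h)-\sigma(x_s)\kappa(s,(x_u)_{u\le s},h')|\le C_T\Bigl((t-s)^{\theta_1}+\sup_{u\in[s,t]}|x_u-x_s|^{\theta_2}+\|h-h'\|^{\theta_3}\Bigr).$$ Assume also that $\sigma$ is Hölder continuous with index $\alpha\in(1/2,1]$, and that $\kappa$ is bounded below by some constant $\kappa_0>0$ (i.e. $\kappa\ge\kappa_0$ on $\mathcal{A}$). Let $(X_t)_{t\ge 0}$ be a continuous $(\mathcal{F}_t)_{t\ge 0}$-adapted real-valued solution to $$X_t=x+\int_0^t\sigma(X_s)\,\kappa(s,(X_u)_{u\le s},H_s)\,\mathrm{d}B_s+\int_0^t b(s,(X_u)_{u\le s},H_s)\,\mathrm{d}s,\qquad t\ge 0 .$$ Then, for every $t>0$, the law of $X_t$ has a density on $\{y\in\mathbb{R}:\sigma(y)\neq 0\}$.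
   Context: Hölder continuous with index $\alpha$ means that there is a constant $C$ with $|\sigma(y)-\sigma(z)|\le C|y-z|^\alpha$ for all $y,z\in\mathbb{R}$. A probability measure $\mu$ on $\mathbb{R}$ "has a density on" a Borel set $D\subset\mathbb{R}$ if the restriction of $\mu$ to $D$ is absolutely continuous with respect to Lebesgue measure, i.e. $\mu(A\cap D)=0$ for every Borel set $A$ of Lebesgue measure $0$. Existence of the solution is not part of the claim. *)

theory Defs
  imports "HOL-Probability.Probability"
begin

section \<open>Filtrations, predictable processes, Brownian motion\<close>

text \<open>Time is \<open>{0..}\<close>: processes and filtrations are indexed by \<^typ>\<open>real\<close>, and nothing is required
  of them at negative indices. The filtration is neither assumed complete nor right-continuous.\<close>

locale filtered_prob_space = prob_space M for M :: "'a measure" +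
  fixes F :: "real \<Rightarrow> 'a measure"
  assumes subalgebra_F: "0 \<le> t \<Longrightarrow> subalgebra M (F t)"
    and mono_F: "0 \<le> s \<Longrightarrow> s \<le> t \<Longrightarrow> sets (F s) \<subseteq> sets (F t)"

definition adapted :: "(real \<Rightarrow> 'a measure) \<Rightarrow> (real \<Rightarrow> 'a \<Rightarrow> real) \<Rightarrow> bool" where
  "adapted F X \<longleftrightarrow> (\<forall>t\<ge>0. X t \<in> borel_measurable (F t))"

definition predictable_algebra :: "'a measure \<Rightarrow> (real \<Rightarrow> 'a measure) \<Rightarrow> (real \<times> 'a) measure" where
  "predictable_algebra M F = sigma ({0..} \<times> space M)
     ({{0} \<times> A | A. A \<in> sets (F 0)} \<union>
      {{s<..t} \<times> A | s t A. 0 \<le> s \<and> s \<le> t \<and> A \<in> sets (F s)})"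

definition predictable ::
    "'a measure \<Rightarrow> (real \<Rightarrow> 'a measure) \<Rightarrow> (real \<Rightarrow> 'a \<Rightarrow> 'b::topological_space) \<Rightarrow> bool" where
  "predictable M F X \<longleftrightarrow> (\<lambda>(t, \<omega>). X t \<omega>) \<in> borel_measurable (predictable_algebra M F)"

locale brownian_motion = filtered_prob_space +
  fixes B :: "real \<Rightarrow> 'a \<Rightarrow> real"
  assumes adapted_B: "adapted F B"
    and B_0: "AE \<omega> in M. B 0 \<omega> = 0"
    and continuous_B: "AE \<omega> in M. continuous_on {0..} (\<lambda>t. B t \<omega>)"
    and indep_increments: "0 \<le> s \<Longrightarrow> s < t \<Longrightarrow>
      indep_set (sets (F s)) (sets (vimage_algebra (space M) (\<lambda>\<omega>. B t \<omega> - B s \<omega>) borel))"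
    and normal_increments: "0 \<le> s \<Longrightarrow> s < t \<Longrightarrow>
      distributed M lborel (\<lambda>\<omega>. B t \<omega> - B s \<omega>) (\<lambda>y. ennreal (normal_density 0 (sqrt (t - s)) y))"

section \<open>The Ito integral\<close>

text \<open>Simple process \<open>\<Sum>i<n. \<xi>\<^sub>i 1\<^bsub>(\<tau>\<^sub>i, \<tau>\<^sub>i\<^sub>+\<^sub>1]\<^esub>\<close> with bounded \<open>\<F>\<^bsub>\<tau>\<^sub>i\<^esub>\<close>-measurable \<open>\<xi>\<^sub>i\<close>.\<close>

definition simple_integrand ::
    "'a measure \<Rightarrow> (real \<Rightarrow> 'a measure) \<Rightarrow> nat \<Rightarrow> (nat \<Rightarrow> real) \<Rightarrow> (nat \<Rightarrow> 'a \<Rightarrow> real) \<Rightarrow> bool" where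
  "simple_integrand M F n \<tau> \<xi> \<longleftrightarrow> 0 \<le> \<tau> 0 \<and> (\<forall>i<n. \<tau> i \<le> \<tau> (Suc i)) \<and>
     (\<forall>i<n. \<xi> i \<in> borel_measurable (F (\<tau> i)) \<and> (\<exists>c. \<forall>\<omega>\<in>space M. \<bar>\<xi> i \<omega>\<bar> \<le> c))"

definition simple_process ::
    "nat \<Rightarrow> (nat \<Rightarrow> real) \<Rightarrow> (nat \<Rightarrow> 'a \<Rightarrow> real) \<Rightarrow> real \<Rightarrow> 'a \<Rightarrow> real" where
  "simple_process n \<tau> \<xi> s \<omega> = (\<Sum>i<n. \<xi> i \<omega> * indicator {\<tau> i<..\<tau> (Suc i)} s)"

definition simple_ito_integral ::
    "(real \<Rightarrow> 'a \<Rightarrow> real) \<Rightarrow> nat \<Rightarrow> (nat \<Rightarrow> real) \<Rightarrow> (nat \<Rightarrow> 'a \<Rightarrow> real) \<Rightarrow> real \<Rightarrow> 'a \<Rightarrow> real" where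
  "simple_ito_integral B n \<tau> \<xi> t \<omega> =
     (\<Sum>i<n. \<xi> i \<omega> * (B (min (\<tau> (Suc i)) t) \<omega> - B (min (\<tau> i) t) \<omega>))"

text \<open>\<open>is_ito_integral M F B \<phi> I\<close>: the predictable process \<open>\<phi>\<close> satisfies \<open>\<integral>\<^sub>0\<^sup>T \<phi>\<^sub>s\<^sup>2 ds < \<infinity>\<close> a.s. for all \<open>T\<close>,
  and \<open>I\<close> is (a version, with a.s. continuous paths, of) the process \<open>(\<integral>\<^sub>0\<^sup>t \<phi>\<^sub>s dB\<^sub>s)\<close> for \<open>t \<ge> 0\<close>. The integral is
  the limit in probability of the integrals of simple processes \<open>\<phi>\<^sup>k\<close> for which
  \<open>\<integral>\<^sub>0\<^sup>T (\<phi>\<^sup>k\<^sub>s - \<phi>\<^sub>s)\<^sup>2 ds \<rightarrow> 0\<close> in probability for all \<open>T\<close>. Such \<open>\<phi>\<^sup>k\<close> exist for every \<open>\<phi>\<close> as above, and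
  the limit does not depend on their choice, so that \<open>I\<close> is unique up to indistinguishability.\<close>

definition is_ito_integral ::
    "'a measure \<Rightarrow> (real \<Rightarrow> 'a measure) \<Rightarrow> (real \<Rightarrow> 'a \<Rightarrow> real) \<Rightarrow>
     (real \<Rightarrow> 'a \<Rightarrow> real) \<Rightarrow> (real \<Rightarrow> 'a \<Rightarrow> real) \<Rightarrow> bool" where
  "is_ito_integral M F B \<phi> I \<longleftrightarrow>
     predictable M F \<phi> \<and>
     (\<forall>T\<ge>0. AE \<omega> in M. (\<integral>\<^sup>+s\<in>{0..T}. ennreal ((\<phi> s \<omega>)\<^sup>2) \<partial>lborel) < \<infinity>) \<and>
     (\<forall>t\<ge>0. I t \<in> borel_measurable M) \<and>
     (AE \<omega> in M. continuous_on {0..} (\<lambda>t. I t \<omega>)) \<and>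
     (\<exists>n \<tau> \<xi>.
        (\<forall>k::nat. simple_integrand M F (n k) (\<tau> k) (\<xi> k)) \<and>
        (\<forall>T\<ge>0. \<forall>\<epsilon>>0. (\<lambda>k. measure M {\<omega>\<in>space M.
            ennreal \<epsilon> < (\<integral>\<^sup>+s\<in>{0..T}. ennreal ((simple_process (n k) (\<tau> k) (\<xi> k) s \<omega> - \<phi> s \<omega>)\<^sup>2) \<partial>lborel)})
          \<longlonglongrightarrow> 0) \<and>
        (\<forall>t\<ge>0. \<forall>\<epsilon>>0. (\<lambda>k. measure M {\<omega>\<in>space M.
            \<epsilon> < \<bar>simple_ito_integral B (n k) (\<tau> k) (\<xi> k) t \<omega> - I t \<omega>\<bar>})
          \<longlonglongrightarrow> 0))"

section \<open>Path-dependent coefficients and the equation\<close>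

text \<open>The set \<open>\<A>\<close>; the path segment \<open>(x\<^sub>u)\<close>, \<open>u \<le> s\<close>, is the restriction of \<open>x\<close> to \<open>{0..s}\<close>.\<close>

definition coeff_domain :: "(real \<times> (real \<Rightarrow> real) \<times> 's) set" where
  "coeff_domain = {(s, restrict x {0..s}, h) | s x h. 0 \<le> s \<and> continuous_on {0..} x}"

text \<open>The \<open>\<sigma>\<close>-algebra on \<open>\<A>\<close>: a segment is identified with the path stopped at \<open>s\<close>, in
  \<open>C(\<real>\<^sub>+, \<real>)\<close> with the \<open>\<sigma>\<close>-algebra of the coordinate maps, which is its Borel \<open>\<sigma>\<close>-algebra for locally
  uniform convergence. A function on \<open>\<A>\<close> is measurable iff its composition with
  \<open>(s, x, h) \<mapsto> (s, (x\<^sub>u), h)\<close> is measurable on the product of \<open>\<real>\<^sub>+\<close>, \<open>C(\<real>\<^sub>+, \<real>)\<close> and \<open>S\<close>.\<close>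

definition coeff_algebra :: "(real \<times> (real \<Rightarrow> real) \<times> 's::real_normed_vector) measure" where
  "coeff_algebra = vimage_algebra coeff_domain
     (\<lambda>(s, p, h). (s, \<lambda>u\<in>{0..}. p (min u s), h))
     (borel \<Otimes>\<^sub>M (\<Pi>\<^sub>M u\<in>{0..}. borel) \<Otimes>\<^sub>M borel)"

definition sde_solution ::
    "'a measure \<Rightarrow> (real \<Rightarrow> 'a measure) \<Rightarrow> (real \<Rightarrow> 'a \<Rightarrow> real) \<Rightarrow>
     (real \<Rightarrow> 'a \<Rightarrow> 's) \<Rightarrow> real \<Rightarrow> (real \<Rightarrow> real) \<Rightarrow>
     (real \<times> (real \<Rightarrow> real) \<times> 's \<Rightarrow> real) \<Rightarrow> (real \<times> (real \<Rightarrow> real) \<times> 's \<Rightarrow> real) \<Rightarrow>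
     (real \<Rightarrow> 'a \<Rightarrow> real) \<Rightarrow> bool" where
  "sde_solution M F B H x \<sigma> \<kappa> b X \<longleftrightarrow>
     adapted F X \<and>
     (\<forall>\<omega>\<in>space M. continuous_on {0..} (\<lambda>t. X t \<omega>)) \<and>
     (\<forall>t\<ge>0. AE \<omega> in M.
        set_integrable lborel {0..t} (\<lambda>s. b (s, restrict (\<lambda>u. X u \<omega>) {0..s}, H s \<omega>))) \<and>
     (\<exists>I. is_ito_integral M F B
            (\<lambda>s \<omega>. \<sigma> (X s \<omega>) * \<kappa> (s, restrict (\<lambda>u. X u \<omega>) {0..s}, H s \<omega>)) I \<and>
          (AE \<omega> in M. \<forall>t\<ge>0. X t \<omega> = x + I t \<omega> +
             (LINT s:{0..t}|lborel. b (s, restrict (\<lambda>u. X u \<omega>) {0..s}, H s \<omega>))))"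

definition holder_continuous :: "real \<Rightarrow> (real \<Rightarrow> real) \<Rightarrow> bool" where
  "holder_continuous \<alpha> f \<longleftrightarrow> (\<exists>C. \<forall>y z. \<bar>f y - f z\<bar> \<le> C * \<bar>y - z\<bar> powr \<alpha>)"

definition has_density_on :: "real measure \<Rightarrow> real set \<Rightarrow> bool" where
  "has_density_on \<mu> D \<longleftrightarrow> absolutely_continuous lborel (density \<mu> (indicator D))"

end

theory Submission
  imports Defs "HOL-Real_Asymp.Real_Asymp"
begin

text \<open>
  A finite measure on the line whose characteristic function is square integrable is absolutely
  continuous. Let \<open>f\<close> be a Lipschitz cutoff of \<open>\<bar>\<sigma>\<bar>\<close> that vanishes where \<open>\<bar>\<sigma>\<bar> \<le> d\<close>. To bound
  \<open>\<E> f(X\<^sub>T) exp(i \<xi> X\<^sub>T)\<close>, replace \<open>X\<^sub>T\<close> by \<open>Z = X\<^sub>r + a\<^sub>r (B\<^sub>T - B\<^sub>r)\<close>, where \<open>r = T - \<epsilon>\<close> and \<open>a\<^sub>r\<close> is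
  the diffusion coefficient at time \<open>r\<close>, and \<open>f(X\<^sub>T)\<close> by \<open>f(X\<^sub>r)\<close>. The latter costs \<open>\<epsilon>\<^bsup>\<alpha>/2\<^esup>\<close>, the former
  \<open>\<bar>\<xi>\<bar> \<epsilon>\<^bsup>1/2 + \<gamma>\<^esup>\<close> with \<open>\<gamma> > 1/4\<close>, because \<open>a\<close> varies in \<open>L\<^sup>2\<close> by at most \<open>\<epsilon>\<^sup>\<gamma>\<close>. Given the past up to
  \<open>r\<close>, \<open>Z\<close> is Gaussian with variance at least \<open>\<epsilon> (d \<kappa>\<^sub>0)\<^sup>2\<close> where \<open>f(X\<^sub>r) \<noteq> 0\<close>, so what remains is at most
  \<open>exp(- \<epsilon> (d \<kappa>\<^sub>0 \<xi>)\<^sup>2 / 2)\<close>. Choosing \<open>\<epsilon>\<close> slightly larger than \<open>\<xi>\<^sup>-\<^sup>2\<close> makes the sum square integrable.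
  Only \<open>L\<^sup>2\<close> maximal bounds for the Ito integral are needed; they pass to the limit from simple
  processes by Fatou's lemma.
\<close>

section \<open>Measures with square-integrable characteristic function\<close>

text \<open>The thresholds are those of an L2 criterion: decay of order |\<xi>|^(-q) is needed only
  for some q > 1/2. At \<epsilon> near |\<xi>|^(-2) the two error terms are near |\<xi>|^(-\<alpha>)
  and |\<xi>|^(-2\<gamma>), which asks for \<alpha> > 1/2 and \<gamma> > 1/4. The cutoff has to be
  moved from X_T to the past because only past quantities can be held fixed while the Brownian
  increment is integrated out. The obstacle is that no moment of X is given. The coefficients grow
  with the running supremum of the path, so the estimate is circular: the maximal inequality bounds
  the oscillation of X by the integral of a^2, and linear growth bounds that integral by the
  oscillation. On a short interval the circle closes by absorption, but a term can be absorbed only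
  if it is known to be finite. Hence everything is stopped when the integral of a^2 reaches a level
  K. The stopping is a condition \<open>V q < K\<close> at each single time q, so that neither
  stopping times nor stopped integrals have to be introduced; this is why the maximal inequalities
  carry such a condition on the left and \<open>min V K\<close> on the right.\<close>

lemma char_std_normal_integral:
  "(CLINT \<xi>|std_normal_distribution. iexp (\<xi> * z)) = complex_of_real (exp (- (z\<^sup>2 / 2)))"
  using fun_cong[OF char_std_normal_distribution, of z] by (simp add: char_def mult.commute)

text \<open>The squared modulus of \<open>char M\<close> is the integral of \<open>iexp\<close> of
  the difference of the two coordinates over the product measure. Fubini lets the Gaussian average
  act first, and a Gaussian is its own Fourier transform.\<close>

lemma integral_char_sq:
  fixes M :: "real measure" and s :: real
  assumes "finite_measure M" and sets_M: "sets M = sets borel"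
  shows "(\<integral>\<xi>. (cmod (char M (s * \<xi>)))\<^sup>2 \<partial>std_normal_distribution)
       = (\<integral>p. exp (- ((s * (fst p - snd p))\<^sup>2 / 2)) \<partial>(M \<Otimes>\<^sub>M M))"
proof -
  interpret finite_measure M by fact
  note sets_M[measurable_cong]
  interpret MM: pair_sigma_finite M M ..
  interpret N: prob_space std_normal_distribution by (rule prob_space_normal_density) simp
  interpret P: finite_measure "M \<Otimes>\<^sub>M M" by (rule finite_measure_pair_measure) unfold_locales
  interpret NP: pair_sigma_finite "M \<Otimes>\<^sub>M M" std_normal_distribution ..
  interpret NPf: finite_measure "(M \<Otimes>\<^sub>M M) \<Otimes>\<^sub>M std_normal_distribution"
    by (rule finite_measure_pair_measure) unfold_locales
  let ?g = "\<lambda>p \<xi>::real. iexp (\<xi> * (s * (fst p - snd p)))"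
  have int: "integrable ((M \<Otimes>\<^sub>M M) \<Otimes>\<^sub>M std_normal_distribution) (case_prod ?g)"
    by (rule NPf.integrable_const_bound[where B=1]) auto
  have int2: "integrable (M \<Otimes>\<^sub>M M) (\<lambda>p. ?g p \<xi>)" for \<xi>
    by (rule P.integrable_const_bound[where B=1]) auto
  have eq: "complex_of_real ((cmod (char M (s * \<xi>)))\<^sup>2) = (\<integral>p. ?g p \<xi> \<partial>(M \<Otimes>\<^sub>M M))" for \<xi>
  proof -
    have "complex_of_real ((cmod (char M (s * \<xi>)))\<^sup>2) = char M (s * \<xi>) * cnj (char M (s * \<xi>))"
      by (rule complex_norm_square)
    also have "cnj (char M (s * \<xi>)) = (CLINT y|M. iexp (- (s * \<xi> * y)))"
    proof -
      have "(CLINT y|M. iexp (- (s * \<xi> * y))) = (CLINT y|M. cnj (iexp (s * \<xi> * y)))"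
        by (simp add: exp_cnj del: integral_cnj)
      also have "\<dots> = cnj (CLINT y|M. iexp (s * \<xi> * y))" by (rule Bochner_Integration.integral_cnj)
      finally show ?thesis unfolding char_def by (rule sym)
    qed
    also have "char M (s * \<xi>) * (CLINT y|M. iexp (- (s * \<xi> * y)))
      = (CLINT x|M. CLINT y|M. ?g (x, y) \<xi>)"
      unfolding char_def
      by (subst integral_mult_left_zero[symmetric], subst integral_mult_right_zero[symmetric])
         (simp add: exp_add[symmetric] algebra_simps)
    also have "\<dots> = (\<integral>p. ?g p \<xi> \<partial>(M \<Otimes>\<^sub>M M))"
      by (rule MM.integral_fst'[OF int2])
    finally show ?thesis .
  qed
  have "complex_of_real (\<integral>\<xi>. (cmod (char M (s * \<xi>)))\<^sup>2 \<partial>std_normal_distribution)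
     = (\<integral>\<xi>. complex_of_real ((cmod (char M (s * \<xi>)))\<^sup>2) \<partial>std_normal_distribution)"
    by (rule integral_complex_of_real[symmetric])
  also have "\<dots> = (\<integral>\<xi>. (\<integral>p. ?g p \<xi> \<partial>(M \<Otimes>\<^sub>M M)) \<partial>std_normal_distribution)"
    by (subst eq) simp
  also have "\<dots> = (\<integral>p. (\<integral>\<xi>. ?g p \<xi> \<partial>std_normal_distribution) \<partial>(M \<Otimes>\<^sub>M M))"
    by (rule NP.Fubini_integral[OF int])
  also have "\<dots> = (\<integral>p. complex_of_real (exp (- ((s * (fst p - snd p))\<^sup>2 / 2))) \<partial>(M \<Otimes>\<^sub>M M))"
    by (intro Bochner_Integration.integral_cong refl)
       (simp only: char_std_normal_integral)
  also have "\<dots> = complex_of_real (\<integral>p. exp (- ((s * (fst p - snd p))\<^sup>2 / 2)) \<partial>(M \<Otimes>\<^sub>M M))"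
    by (rule integral_complex_of_real)
  finally show ?thesis by (simp only: of_real_eq_iff)
qed

text \<open>By symmetry of the density, shifting \<open>y\<close> by \<open>x'\<close> gives a
  convolution of two centred Gaussians, whose variances add. The exponent is left in the form that
  \<open>integral_char_sq\<close> has for \<open>s = 1 / (sqrt 2 * h)\<close>.\<close>

lemma normal_density_conv_sqrt2:
  assumes "0 < h"
  shows "(\<integral>\<^sup>+y. ennreal (normal_density 0 h (y - x)) * ennreal (normal_density 0 h (y - x')) \<partial>lborel)
    = ennreal (1 / (2 * h * sqrt pi) * exp (- (((x - x') / (sqrt 2 * h))\<^sup>2 / 2)))"
proof -
  have "(\<integral>\<^sup>+y. ennreal (normal_density 0 h (y - x)) * ennreal (normal_density 0 h (y - x')) \<partial>lborel)
     = (\<integral>\<^sup>+y. ennreal (normal_density 0 h ((x - x') - y) * normal_density 0 h y) \<partial>lborel)"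
    by (subst nn_integral_real_affine[where c=1 and t="x'"])
       (auto simp: normal_density_def ennreal_mult[symmetric] power2_commute algebra_simps
         intro!: nn_integral_cong)
  also have "\<dots> = ennreal (normal_density 0 (sqrt (h\<^sup>2 + h\<^sup>2)) (x - x'))"
    using fun_cong[OF conv_normal_density_zero_mean[OF assms assms]] by simp
  also have "normal_density 0 (sqrt (h\<^sup>2 + h\<^sup>2)) (x - x')
    = 1 / (2 * h * sqrt pi) * exp (- (((x - x') / (sqrt 2 * h))\<^sup>2 / 2))"
    using assms by (simp add: normal_density_def power_divide power_mult_distrib real_sqrt_mult)
  finally show ?thesis .
qed

text \<open>For a function that is not integrable the Bochner integral is 0 by convention, so the
  inequality comes without an integrability check.\<close>

lemma ennreal_integral_le_nn_integral:
  fixes f :: "'a \<Rightarrow> real"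
  assumes "AE x in M. 0 \<le> f x"
  shows "ennreal (integral\<^sup>L M f) \<le> (\<integral>\<^sup>+x. ennreal (f x) \<partial>M)"
  by (cases "integrable M f") (simp_all add: nn_integral_eq_integral assms not_integrable_integral_eq)

text \<open>Plancherel's identity for the convolution with a Gaussian, with a bound uniform in the width \<open>h\<close>.\<close>

lemma smoothed_density_L2:
  fixes M :: "real measure"
  assumes "finite_measure M" and sets_M: "sets M = sets borel" and h: "0 < h"
  shows "(\<integral>\<^sup>+y. (\<integral>\<^sup>+x. ennreal (normal_density 0 h (y - x)) \<partial>M)\<^sup>2 \<partial>lborel)
     \<le> (\<integral>\<^sup>+\<xi>. ennreal ((cmod (char M \<xi>))\<^sup>2) \<partial>lborel)" (is "?L \<le> _")
proof -
  interpret finite_measure M by fact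
  note sets_M[measurable_cong]
  interpret MM: pair_sigma_finite M M ..
  interpret P: finite_measure "M \<Otimes>\<^sub>M M" by (rule finite_measure_pair_measure) unfold_locales
  interpret LM: pair_sigma_finite lborel M ..
  let ?n = "\<lambda>x y. ennreal (normal_density 0 h (y - x))"
  let ?s = "1 / (sqrt 2 * h)"
  let ?c = "1 / (2 * h * sqrt pi)"
  let ?e = "\<lambda>x y. exp (- (((x - y) / (sqrt 2 * h))\<^sup>2 / 2))"
  let ?g = "\<lambda>\<xi>. ennreal ((cmod (char M \<xi>))\<^sup>2)"
  have [measurable]: "char M \<in> borel_measurable borel"
    unfolding char_def[abs_def] by measurable
  have "(\<integral>\<^sup>+y. (\<integral>\<^sup>+x. ?n x y \<partial>M)\<^sup>2 \<partial>lborel)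
     = (\<integral>\<^sup>+y. (\<integral>\<^sup>+x. (\<integral>\<^sup>+x'. ?n x y * ?n x' y \<partial>M) \<partial>M) \<partial>lborel)"
    by (simp add: nn_integral_cmult nn_integral_multc power2_eq_square)
  also have "\<dots> = (\<integral>\<^sup>+x. (\<integral>\<^sup>+y. (\<integral>\<^sup>+x'. ?n x y * ?n x' y \<partial>M) \<partial>lborel) \<partial>M)"
    by (rule LM.Fubini'[symmetric]) simp
  also have "\<dots> = (\<integral>\<^sup>+x. (\<integral>\<^sup>+x'. (\<integral>\<^sup>+y. ?n x y * ?n x' y \<partial>lborel) \<partial>M) \<partial>M)"
    by (intro nn_integral_cong LM.Fubini'[symmetric]) simp
  also have "\<dots> = (\<integral>\<^sup>+x. (\<integral>\<^sup>+x'. ennreal (?c * ?e x x') \<partial>M) \<partial>M)"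
    by (simp only: normal_density_conv_sqrt2[OF h])
  also have "\<dots> = (\<integral>\<^sup>+p. ennreal (?c * ?e (fst p) (snd p)) \<partial>(M \<Otimes>\<^sub>M M))"
    by (subst nn_integral_fst[symmetric]) auto
  also have "\<dots> = ennreal (\<integral>p. ?c * ?e (fst p) (snd p) \<partial>(M \<Otimes>\<^sub>M M))"
    using h by (intro nn_integral_eq_integral P.integrable_const_bound[where B="?c"])
       (auto intro!: AE_I2 divide_right_mono)
  also have "(\<integral>p. ?c * ?e (fst p) (snd p) \<partial>(M \<Otimes>\<^sub>M M))
    = ?c * (\<integral>\<xi>. (cmod (char M (?s * \<xi>)))\<^sup>2 \<partial>std_normal_distribution)"
    by (subst integral_char_sq[OF assms(1,2)]) simp
  also have "ennreal \<dots> = ennreal ?c * ennreal (\<integral>\<xi>. (cmod (char M (?s * \<xi>)))\<^sup>2 \<partial>std_normal_distribution)"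
    using h by (intro ennreal_mult) (auto intro!: integral_nonneg_AE)
  finally have 1: "?L = ennreal ?c * ennreal (\<integral>\<xi>. (cmod (char M (?s * \<xi>)))\<^sup>2 \<partial>std_normal_distribution)" .
  have "ennreal (\<integral>\<xi>. (cmod (char M (?s * \<xi>)))\<^sup>2 \<partial>std_normal_distribution)
      \<le> (\<integral>\<^sup>+\<xi>. ?g (?s * \<xi>) \<partial>std_normal_distribution)"
    by (intro ennreal_integral_le_nn_integral) auto
  also have "(\<integral>\<^sup>+\<xi>. ?g (?s * \<xi>) \<partial>std_normal_distribution)
      = (\<integral>\<^sup>+\<xi>. ennreal (std_normal_density \<xi>) * ?g (?s * \<xi>) \<partial>lborel)"
    by (intro nn_integral_density) auto
  \<comment> \<open>Discarding the Gaussian weight turns the identity into an inequality; the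
    remaining integral depends on \<open>h\<close> only through a substitution.\<close>
  also have "\<dots> \<le> (\<integral>\<^sup>+\<xi>. 1 * ?g (?s * \<xi>) \<partial>lborel)"
  proof (intro nn_integral_mono mult_right_mono)
    fix \<xi> :: real
    have "1 \<le> sqrt (2 * pi)" using pi_gt3 by (intro real_le_rsqrt) auto
    then have "exp (- (\<xi>\<^sup>2 / 2)) \<le> sqrt (2 * pi)"
      by (intro order_trans[OF _ \<open>1 \<le> sqrt (2 * pi)\<close>]) simp
    then show "ennreal (std_normal_density \<xi>) \<le> 1"
      by (simp add: std_normal_density_def field_simps)
  qed simp
  finally have 2: "ennreal (\<integral>\<xi>. (cmod (char M (?s * \<xi>)))\<^sup>2 \<partial>std_normal_distribution)
     \<le> (\<integral>\<^sup>+\<xi>. ?g (?s * \<xi>) \<partial>lborel)" by simp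
  have "?L \<le> ennreal ?c * (\<integral>\<^sup>+\<xi>. ?g (?s * \<xi>) \<partial>lborel)"
    unfolding 1 by (intro mult_left_mono 2) simp
  \<comment> \<open>\<open>?s\<close> is the Jacobian of the substitution that follows, so comparing
    the constant with it makes \<open>h\<close> disappear.\<close>
  also have "ennreal ?c * (\<integral>\<^sup>+\<xi>. ?g (?s * \<xi>) \<partial>lborel)
      \<le> ennreal ?s * (\<integral>\<^sup>+\<xi>. ?g (?s * \<xi>) \<partial>lborel)"
  proof (intro mult_right_mono ennreal_leI)
    have "sqrt 2 \<le> sqrt pi * 2"
      using pi_gt3 real_sqrt_le_mono[of 2 pi] real_sqrt_ge_zero[of pi] by linarith
    then show "?c \<le> ?s" using h by (intro divide_left_mono) (auto simp: mult_ac)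
  qed simp
  also have "\<dots> = (\<integral>\<^sup>+\<xi>. ?g \<xi> \<partial>lborel)"
    using h by (subst (2) nn_integral_real_affine[where c="?s" and t=0]) auto
  finally show ?thesis .
qed

lemma ennreal_le_of_sq_le:
  fixes a c :: ennreal
  assumes "a\<^sup>2 \<le> c\<^sup>2" shows "a \<le> c"
proof (rule ccontr)
  assume "\<not> a \<le> c"
  then have "c < a" by simp
  then have "c * c < a * a"
    by (cases a; cases c) (auto simp: ennreal_mult[symmetric] ennreal_top_mult ennreal_less_iff
      intro!: mult_strict_mono' simp del: ennreal_mult)
  with assms show False by (simp add: power2_eq_square)
qed

text \<open>Cauchy-Schwarz on \<open>U\<close> bounds the mass that the smoothed measure gives to
  \<open>U\<close>, uniformly in the width \<open>h\<close>. As \<open>h\<close> tends to 0, Fatou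
  recovers the mass of \<open>U\<close> itself: the indicator of an open set is lower
  semicontinuous, so no convergence theorem for the smoothed measures is involved.\<close>

lemma emeasure_open_le_char:
  fixes M :: "real measure"
  assumes "finite_measure M" and sets_M: "sets M = sets borel" and U: "open U"
  shows "(emeasure M U)\<^sup>2 \<le> emeasure lborel U * (\<integral>\<^sup>+\<xi>. ennreal ((cmod (char M \<xi>))\<^sup>2) \<partial>lborel)"
    (is "_ \<le> ?B")
proof -
  interpret finite_measure M by fact
  note sets_M[measurable_cong]
  interpret LM: pair_sigma_finite lborel M ..
  interpret N: prob_space std_normal_distribution by (rule prob_space_normal_density) simp
  have [measurable]: "U \<in> sets borel" using U by simp
  let ?a = "\<lambda>h. \<integral>\<^sup>+y. indicator U y * (\<integral>\<^sup>+x. ennreal (normal_density 0 h (y - x)) \<partial>M) \<partial>lborel"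
  have a_le: "(?a h)\<^sup>2 \<le> ?B" if h: "0 < h" for h
  proof -
    have "(?a h)\<^sup>2 \<le> (\<integral>\<^sup>+y. (indicator U y)\<^sup>2 \<partial>lborel)
       * (\<integral>\<^sup>+y. (\<integral>\<^sup>+x. ennreal (normal_density 0 h (y - x)) \<partial>M)\<^sup>2 \<partial>lborel)"
      by (rule Cauchy_Schwarz_nn_integral) measurable
    also have "(\<integral>\<^sup>+y. (indicator U y)\<^sup>2 \<partial>lborel) = (\<integral>\<^sup>+y. indicator U y \<partial>lborel)"
      by (intro nn_integral_cong) (auto simp: indicator_def)
    also have "\<dots> = emeasure lborel U" by simp
    finally show ?thesis
      using smoothed_density_L2[OF assms(1,2) h] by (meson mult_left_mono order_trans zero_le)
  qed
  \<comment> \<open>Fubini and the substitution \<open>y = x + h * z\<close> move the smoothing from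
    \<open>M\<close> to the indicator and leave a fixed Gaussian in \<open>z\<close>, which is the
    form to which Fatou applies.\<close>
  have a_eq: "?a h = (\<integral>\<^sup>+x. (\<integral>\<^sup>+z. indicator U (x + h * z) \<partial>std_normal_distribution) \<partial>M)"
    if h: "0 < h" for h
  proof -
    have "?a h = (\<integral>\<^sup>+y. (\<integral>\<^sup>+x. indicator U y * ennreal (normal_density 0 h (y - x)) \<partial>M) \<partial>lborel)"
      by (simp add: nn_integral_cmult)
    also have "\<dots> = (\<integral>\<^sup>+x. (\<integral>\<^sup>+y. indicator U y * ennreal (normal_density 0 h (y - x)) \<partial>lborel) \<partial>M)"
      by (rule LM.Fubini'[symmetric]) simp
    also have "\<dots> = (\<integral>\<^sup>+x. (\<integral>\<^sup>+z. indicator U (x + h * z) \<partial>std_normal_distribution) \<partial>M)"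
    proof (intro nn_integral_cong)
      fix x
      have "h * normal_density 0 h (h * z) = std_normal_density z" for z
        using h by (simp add: normal_density_def real_sqrt_mult power_mult_distrib)
      then have e: "ennreal h * ennreal (normal_density 0 h (h * z)) = ennreal (std_normal_density z)" for z
        using h by (metis ennreal_mult' less_imp_le)
      have "(\<integral>\<^sup>+y. indicator U y * ennreal (normal_density 0 h (y - x)) \<partial>lborel)
         = (\<integral>\<^sup>+z. ennreal h * (indicator U (x + h * z) * ennreal (normal_density 0 h (h * z))) \<partial>lborel)"
        using h by (subst nn_integral_real_affine[where c=h and t=x]) (auto simp: nn_integral_cmult)
      also have "\<dots> = (\<integral>\<^sup>+z. ennreal (std_normal_density z) * indicator U (x + h * z) \<partial>lborel)"
        by (intro nn_integral_cong) (simp add: e[symmetric] mult_ac)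
      also have "\<dots> = (\<integral>\<^sup>+z. indicator U (x + h * z) \<partial>std_normal_distribution)"
        by (subst nn_integral_density) auto
      finally show "(\<integral>\<^sup>+y. indicator U y * ennreal (normal_density 0 h (y - x)) \<partial>lborel)
         = (\<integral>\<^sup>+z. indicator U (x + h * z) \<partial>std_normal_distribution)" .
    qed
    finally show ?thesis .
  qed
  let ?h = "\<lambda>n. inverse (real (Suc n))"
  have ind: "indicator U x \<le> liminf (\<lambda>n. indicator U (x + ?h n * z) :: ennreal)" for x z
  proof (cases "x \<in> U")
    case True
    have "(\<lambda>n. x + ?h n * z) \<longlonglongrightarrow> x + 0 * z"
      by (intro tendsto_intros LIMSEQ_inverse_real_of_nat)
    with True U have "eventually (\<lambda>n. x + ?h n * z \<in> U) sequentially"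
      by (intro topological_tendstoD) auto
    then have "eventually (\<lambda>n. 1 \<le> (indicator U (x + ?h n * z) :: ennreal)) sequentially"
      by eventually_elim simp
    then show ?thesis using True Liminf_bounded[of 1 "\<lambda>n. indicator U (x + ?h n * z) :: ennreal" sequentially] by simp
  qed simp
  have "emeasure M U = (\<integral>\<^sup>+x. indicator U x \<partial>M)" by simp
  also have "\<dots> = (\<integral>\<^sup>+x. (\<integral>\<^sup>+z. indicator U x \<partial>std_normal_distribution) \<partial>M)"
    by (simp add: N.emeasure_space_1[simplified])
  also have "\<dots> \<le> (\<integral>\<^sup>+x. (\<integral>\<^sup>+z. liminf (\<lambda>n. indicator U (x + ?h n * z)) \<partial>std_normal_distribution) \<partial>M)"
    by (intro nn_integral_mono ind)
  also have "\<dots> \<le> (\<integral>\<^sup>+x. liminf (\<lambda>n. \<integral>\<^sup>+z. indicator U (x + ?h n * z) \<partial>std_normal_distribution) \<partial>M)"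
    by (intro nn_integral_mono nn_integral_liminf) measurable
  also have "\<dots> \<le> liminf (\<lambda>n. \<integral>\<^sup>+x. \<integral>\<^sup>+z. indicator U (x + ?h n * z) \<partial>std_normal_distribution \<partial>M)"
    by (intro nn_integral_liminf) measurable
  also have "\<dots> = liminf (\<lambda>n. ?a (?h n))"
    by (subst a_eq) auto
  finally have main: "emeasure M U \<le> liminf (\<lambda>n. ?a (?h n))" .
  show ?thesis
  proof (cases "?B = \<top>")
    case False
    then obtain b where b: "?B = ennreal b" "0 \<le> b" by (cases ?B) auto
    then have B2: "?B = (ennreal (sqrt b))\<^sup>2" by (simp add: ennreal_power)
    have "?a (?h n) \<le> ennreal (sqrt b)" for n
    proof (rule ennreal_le_of_sq_le)
      show "(?a (?h n))\<^sup>2 \<le> (ennreal (sqrt b))\<^sup>2"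
        unfolding B2[symmetric] by (rule a_le) simp
    qed
    then have "liminf (\<lambda>n. ?a (?h n)) \<le> ennreal (sqrt b)"
      by (intro Liminf_le always_eventually allI sequentially_bot)
    with main have "emeasure M U \<le> ennreal (sqrt b)" by (rule order_trans)
    then show ?thesis unfolding B2 by (rule power_mono) simp
  qed (simp add: top.extremum)
qed

lemma eq_0_if_sq_le_all_mult: fixes m l :: real assumes sq: "\<And>e. 0 < e \<Longrightarrow> m\<^sup>2 \<le> e * l" and l: "0 \<le> l"
  shows "m = 0"
  proof (rule ccontr)
  assume "m \<noteq> 0"
  then have pos: "0 < m\<^sup>2" by simp
  have "m\<^sup>2 \<le> (m\<^sup>2 / (l + 1)) * l"
    using pos l by (intro sq) auto
  then have "m\<^sup>2 * (l + 1) \<le> m\<^sup>2 * l" using l by (simp add: pos_le_divide_eq)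
  then show False using pos l by (simp add: algebra_simps)
  qed

text \<open>By outer regularity a null set lies in open sets of arbitrarily small Lebesgue measure,
  and \<open>emeasure_open_le_char\<close> makes their \<open>M\<close>-mass arbitrarily small as
  well.\<close>

lemma null_sets_of_char_L2:
  fixes M :: "real measure"
  assumes "finite_measure M" and sets_M: "sets M = sets borel"
    and L2: "(\<integral>\<^sup>+\<xi>. ennreal ((cmod (char M \<xi>))\<^sup>2) \<partial>lborel) < \<infinity>"
    and A: "A \<in> null_sets lborel"
  shows "emeasure M A = 0"
proof -
  interpret finite_measure M by fact
  obtain l where l: "(\<integral>\<^sup>+\<xi>. ennreal ((cmod (char M \<xi>))\<^sup>2) \<partial>lborel) = ennreal l" "0 \<le> l"
    using L2 by (cases "\<integral>\<^sup>+\<xi>. ennreal ((cmod (char M \<xi>))\<^sup>2) \<partial>lborel") auto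
  have A_b: "A \<in> sets borel" using A by auto
  have "(emeasure M A)\<^sup>2 \<le> ennreal (e * l)" if e: "0 < e" for e
  proof -
    obtain U where U: "open U" "A \<subseteq> U" "emeasure lborel (U - A) < ennreal e"
      using outer_regular_lborel[OF A_b e] by blast
    have "emeasure lborel U = emeasure lborel (U - A)"
      using emeasure_Diff_null_set[of A lborel U] A U by auto
    then have U_le: "emeasure lborel U \<le> ennreal e" using U(3) by simp
    have "emeasure M A \<le> emeasure M U"
      using U(1,2) sets_M by (intro emeasure_mono) auto
    then have "(emeasure M A)\<^sup>2 \<le> (emeasure M U)\<^sup>2" by (rule power_mono) simp
    also have "\<dots> \<le> emeasure lborel U * ennreal l"
      using emeasure_open_le_char[OF assms(1,2) U(1)] unfolding l(1) .
    also have "\<dots> \<le> ennreal e * ennreal l"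
      by (rule mult_right_mono[OF U_le]) simp
    also have "\<dots> = ennreal (e * l)" using e l by (intro ennreal_mult[symmetric]) auto
    finally show ?thesis .
  qed
  moreover have "(emeasure M A)\<^sup>2 = ennreal ((measure M A)\<^sup>2)"
    using ennreal_power[OF measure_nonneg[of M A], of 2] unfolding emeasure_eq_measure .
  ultimately have "ennreal ((measure M A)\<^sup>2) \<le> ennreal (e * l)" if "0 < e" for e
    using that by simp
  then have "(measure M A)\<^sup>2 \<le> e * l" if "0 < e" for e
    using that l(2) by (simp del: ennreal_power)
  from eq_0_if_sq_le_all_mult[OF this l(2)] show ?thesis
    by (simp add: emeasure_eq_measure)
qed

section \<open>Fractional moments, and decay rates in the frequency\<close>

lemma powr_le_tangent:
  fixes y m p :: real
  assumes "0 \<le> y" "0 < m" "0 < p" "p \<le> 1"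
  shows "y powr p \<le> m powr p + m powr (p - 1) * y"
proof (cases "y \<le> m")
  case True
  then have "y powr p \<le> m powr p" using assms by (intro powr_mono2) auto
  moreover have "0 \<le> m powr (p - 1) * y" using assms by simp
  ultimately show ?thesis by linarith
next
  case False
  then have y: "0 < y" using assms by simp
  have "y powr p = y powr (p - 1) * y"
    using y powr_add[of y "p - 1" 1] by simp
  also have "\<dots> \<le> m powr (p - 1) * y"
    using False assms by (intro mult_right_mono powr_mono2') auto
  finally show ?thesis using powr_ge_zero[of m p] by linarith
qed

text \<open>Jensen's inequality for a concave power, up to the factor 2. The tangent line at
  \<open>m\<close> is replaced by the higher affine function of \<open>powr_le_tangent\<close>,
  which is checked by separating \<open>y \<le> m\<close> from \<open>y > m\<close>. Second moments
  are converted into smaller powers by this lemma.\<close>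

lemma (in prob_space) nn_integral_powr_le:
  fixes Y :: "'a \<Rightarrow> real"
  assumes [measurable]: "Y \<in> borel_measurable M" and Y: "\<And>\<omega>. \<omega> \<in> space M \<Longrightarrow> 0 \<le> Y \<omega>"
    and le: "(\<integral>\<^sup>+\<omega>. ennreal (Y \<omega>) \<partial>M) \<le> ennreal m" and m: "0 < m" and p: "0 < p" "p \<le> 1"
  shows "(\<integral>\<^sup>+\<omega>. ennreal (Y \<omega> powr p) \<partial>M) \<le> ennreal (2 * m powr p)"
proof -
  have "(\<integral>\<^sup>+\<omega>. ennreal (Y \<omega> powr p) \<partial>M)
     \<le> (\<integral>\<^sup>+\<omega>. ennreal (m powr p) + ennreal (m powr (p - 1)) * ennreal (Y \<omega>) \<partial>M)"
  proof (intro nn_integral_mono)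
    fix \<omega> assume "\<omega> \<in> space M"
    then have "ennreal (Y \<omega> powr p) \<le> ennreal (m powr p + m powr (p - 1) * Y \<omega>)"
      using Y m p by (intro ennreal_leI powr_le_tangent) auto
    also have "\<dots> = ennreal (m powr p) + ennreal (m powr (p - 1)) * ennreal (Y \<omega>)"
      using Y[OF \<open>\<omega> \<in> space M\<close>] by (simp add: ennreal_mult)
    finally show "ennreal (Y \<omega> powr p) \<le> ennreal (m powr p) + ennreal (m powr (p - 1)) * ennreal (Y \<omega>)" .
  qed
  also have "\<dots> = ennreal (m powr p) + ennreal (m powr (p - 1)) * (\<integral>\<^sup>+\<omega>. ennreal (Y \<omega>) \<partial>M)"
    by (simp add: nn_integral_add nn_integral_cmult emeasure_space_1)
  also have "\<dots> \<le> ennreal (m powr p) + ennreal (m powr (p - 1)) * ennreal m"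
    by (intro add_left_mono mult_left_mono le) simp
  also have "\<dots> = ennreal (m powr p + m powr (p - 1) * m)"
    using m by (simp add: ennreal_mult)
  also have "m powr p + m powr (p - 1) * m = 2 * m powr p"
    using m powr_add[of m "p - 1" 1] by simp
  finally show ?thesis .
qed

lemma nn_integral_powr_to_inf_finite:
  fixes a q :: real
  assumes "0 < a" "1 < q"
  shows "(\<integral>\<^sup>+x\<in>{a..}. ennreal (x powr (- q)) \<partial>lborel) < \<top>"
proof -
  have "((\<lambda>x. x powr (- q)) has_integral (- (a powr (- q + 1)) / (- q + 1))) {a..}"
    using assms by (intro has_integral_powr_to_inf) auto
  then have "(\<integral>\<^sup>+x. ennreal (indicator {a..} x * x powr (- q)) \<partial>lborel) = ennreal (- (a powr (- q + 1)) / (- q + 1))"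
    by (rule nn_integral_has_integral_lebesgue[rotated]) simp
  moreover have "(\<integral>\<^sup>+x\<in>{a..}. ennreal (x powr (- q)) \<partial>lborel) = (\<integral>\<^sup>+x. ennreal (indicator {a..} x * x powr (- q)) \<partial>lborel)"
    by (intro nn_integral_cong) (auto simp: indicator_def)
  ultimately show ?thesis by simp
qed

lemma nn_integral_abs_tail_finite:
  fixes a q :: real
  assumes "0 < a" "1 < q"
  shows "(\<integral>\<^sup>+x. ennreal (\<bar>x\<bar> powr (- q)) * indicator {x. a \<le> \<bar>x\<bar>} x \<partial>lborel) < \<top>"
proof -
  let ?f = "\<lambda>x. ennreal (x powr (- q)) * indicator {a..} x"
  have "(\<integral>\<^sup>+x. ennreal (\<bar>x\<bar> powr (- q)) * indicator {x. a \<le> \<bar>x\<bar>} x \<partial>lborel)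
     \<le> (\<integral>\<^sup>+x. ?f x + ?f (- x) \<partial>lborel)"
    by (intro nn_integral_mono) (auto simp: indicator_def abs_if)
  also have "\<dots> = (\<integral>\<^sup>+x. ?f x \<partial>lborel) + (\<integral>\<^sup>+x. ?f (- x) \<partial>lborel)"
    by (intro nn_integral_add) auto
  also have "(\<integral>\<^sup>+x. ?f (- x) \<partial>lborel) = (\<integral>\<^sup>+x. ?f x \<partial>lborel)"
    by (subst (2) nn_integral_real_affine[where c="-1" and t=0]) auto
  also have "(\<integral>\<^sup>+x. ?f x \<partial>lborel) + (\<integral>\<^sup>+x. ?f x \<partial>lborel) < \<top>"
    using nn_integral_powr_to_inf_finite[OF assms] by simp
  finally show ?thesis .
qed

text \<open>With \<open>\<epsilon> = \<bar>\<xi>\<bar>\<^sup>-\<^sup>2\<^sup>p\<close>, \<open>p < 1\<close> close to \<open>1\<close>, the bound decays faster than \<open>\<bar>\<xi>\<bar>\<^sup>-\<^sup>1\<^sup>/\<^sup>2\<close>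
  because \<open>\<alpha> > 1/2\<close> and \<open>\<gamma> > 1/4\<close>.\<close>

lemma square_integrable_of_bound:
  fixes g :: "real \<Rightarrow> real"
  assumes [measurable]: "g \<in> borel_measurable borel" and g: "\<And>\<xi>. 0 \<le> g \<xi>" "\<And>\<xi>. g \<xi> \<le> 1"
    and bound: "\<And>\<xi> e. 0 < e \<Longrightarrow> e \<le> e0 \<Longrightarrow>
      g \<xi> \<le> c1 * e powr (\<alpha> / 2) + \<bar>\<xi>\<bar> * (c2 * e powr (1/2 + \<gamma>)) + exp (- (k * \<xi>\<^sup>2 * e))"
    and e0: "0 < e0" and c: "0 \<le> c1" "0 \<le> c2" and k: "0 < k" and \<alpha>: "1/2 < \<alpha>" and \<gamma>: "1/4 < \<gamma>"
  shows "(\<integral>\<^sup>+\<xi>. ennreal ((g \<xi>)\<^sup>2) \<partial>lborel) < \<infinity>"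
proof -
  \<comment> \<open>The midpoint between 1 and the larger of two thresholds. With
    \<open>e = \<bar>\<xi>\<bar> powr (- 2 * p)\<close> the first two terms decay with exponents
    \<open>p * \<alpha>\<close> and \<open>p * (1 + 2 * \<gamma>) - 1\<close>, and the thresholds
    say that these exceed 1/2; \<open>p < 1\<close> keeps \<open>\<xi>\<^sup>2 * e\<close> growing,
    so the exponential decays faster than any power.\<close>
  define p where "p = (1 + max (1 / (2 * \<alpha>)) (3 / (2 * (1 + 2 * \<gamma>)))) / 2"
  have lt1: "1 / (2 * \<alpha>) < 1" "3 / (2 * (1 + 2 * \<gamma>)) < 1" using \<alpha> \<gamma> by (auto simp: divide_less_eq)
  have p: "p < 1" "1 / (2 * \<alpha>) < p" "3 / (2 * (1 + 2 * \<gamma>)) < p" using lt1 by (auto simp: p_def)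
  have "0 < 1 / (2 * \<alpha>)" using \<alpha> by simp
  with p have p0: "0 < p" by linarith
  have pa: "1/2 < p * \<alpha>" using p(2) \<alpha> by (simp add: divide_less_eq algebra_simps)
  have pg: "1/2 < p * (1 + 2 * \<gamma>) - 1" using p(3) \<gamma> by (simp add: divide_less_eq algebra_simps)
  \<comment> \<open>A common decay exponent for the three terms; the cap at 1 is there because the
    exponential term is compared with \<open>1 / \<bar>\<xi>\<bar>\<close>.\<close>
  define q where "q = min (min (p * \<alpha>) (p * (1 + 2 * \<gamma>) - 1)) 1"
  have q: "1/2 < q" "q \<le> p * \<alpha>" "q \<le> p * (1 + 2 * \<gamma>) - 1" "q \<le> 1" using pa pg by (auto simp: q_def)
  have "((\<lambda>x. x * exp (- (k * x powr (2 - 2 * p)))) \<longlongrightarrow> 0) at_top"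
    using k p(1) by real_asymp
  then have "eventually (\<lambda>x. x * exp (- (k * x powr (2 - 2 * p))) < 1) at_top"
    by (rule order_tendstoD) simp
  moreover have "((\<lambda>x. x powr (- 2 * p)) \<longlongrightarrow> 0) at_top" using p0 by real_asymp
  then have "eventually (\<lambda>x. x powr (- 2 * p) < e0) at_top" by (rule order_tendstoD) (rule e0)
  ultimately have "eventually (\<lambda>x. x * exp (- (k * x powr (2 - 2 * p))) < 1 \<and> x powr (- 2 * p) < e0) at_top"
    by (rule eventually_conj)
  then obtain x0 where x0: "\<And>x. x0 \<le> x \<Longrightarrow> x * exp (- (k * x powr (2 - 2 * p))) < 1 \<and> x powr (- 2 * p) < e0"
    by (auto simp: eventually_at_top_linorder)
  define a where "a = max 1 x0"
  have a: "1 \<le> a" by (simp add: a_def)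
  have g_le: "g \<xi> \<le> (c1 + c2 + 1) * \<bar>\<xi>\<bar> powr (- q)" if \<xi>: "a \<le> \<bar>\<xi>\<bar>" for \<xi>
  proof -
    let ?x = "\<bar>\<xi>\<bar>" and ?e = "\<bar>\<xi>\<bar> powr (- 2 * p)"
    have x: "1 \<le> ?x" "x0 \<le> ?x" using \<xi> by (auto simp: a_def)
    have mono: "?x powr r \<le> ?x powr (- q)" if "r \<le> - q" for r
      using x that by (intro powr_mono) auto
    have "g \<xi> \<le> c1 * ?e powr (\<alpha> / 2) + ?x * (c2 * ?e powr (1/2 + \<gamma>)) + exp (- (k * \<xi>\<^sup>2 * ?e))"
      using x x0[OF x(2)] by (intro bound) auto
    also have "?e powr (\<alpha> / 2) = ?x powr (- (p * \<alpha>))" by (simp add: powr_powr)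
    also have "?x * (c2 * ?e powr (1/2 + \<gamma>)) = c2 * ?x powr (1 - p * (1 + 2 * \<gamma>))"
    proof -
      have "?e powr (1/2 + \<gamma>) = ?x powr (- (p * (1 + 2 * \<gamma>)))" by (simp add: powr_powr algebra_simps)
      then show ?thesis using x powr_add[of ?x 1 "- (p * (1 + 2 * \<gamma>))"] by simp
    qed
    also have "\<xi>\<^sup>2 = ?x powr 2" using x by simp
    also have "k * ?x powr 2 * ?e = k * ?x powr (2 - 2 * p)"
      using x powr_add[of ?x 2 "- 2 * p"] by simp
    also have "c1 * ?x powr (- (p * \<alpha>)) + c2 * ?x powr (1 - p * (1 + 2 * \<gamma>)) + exp (- (k * ?x powr (2 - 2 * p)))
       \<le> c1 * ?x powr (- q) + c2 * ?x powr (- q) + 1 * ?x powr (- q)"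
    proof (intro add_mono mult_left_mono mono c)
      have "exp (- (k * ?x powr (2 - 2 * p))) \<le> 1 / ?x"
        using x0[OF x(2)] x by (simp add: field_simps)
      also have "\<dots> = ?x powr (- 1)" using x by (simp add: powr_minus_divide)
      also have "\<dots> \<le> ?x powr (- q)" by (rule mono) (use q in simp)
      finally show "exp (- (k * ?x powr (2 - 2 * p))) \<le> 1 * ?x powr (- q)" by simp
    qed (use q in auto)
    finally show ?thesis by (simp add: algebra_simps)
  qed
  let ?t = "\<lambda>\<xi>. ennreal (\<bar>\<xi>\<bar> powr (- (2 * q))) * indicator {\<xi>. a \<le> \<bar>\<xi>\<bar>} \<xi>"
  have tail: "(\<integral>\<^sup>+\<xi>. ?t \<xi> \<partial>lborel) < \<top>" using a q by (intro nn_integral_abs_tail_finite) auto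
  \<comment> \<open>Near the origin only \<open>g \<le> 1\<close> is used; in the tail the exponent
    \<open>2 * q\<close> exceeds 1.\<close>
  have "(\<integral>\<^sup>+\<xi>. ennreal ((g \<xi>)\<^sup>2) \<partial>lborel)
    \<le> (\<integral>\<^sup>+\<xi>. indicator {- a..a} \<xi> + ennreal ((c1 + c2 + 1)\<^sup>2) * ?t \<xi> \<partial>lborel)"
  proof (intro nn_integral_mono)
    fix \<xi> :: real
    show "ennreal ((g \<xi>)\<^sup>2) \<le> indicator {- a..a} \<xi> + ennreal ((c1 + c2 + 1)\<^sup>2) * ?t \<xi>"
    proof (cases "a \<le> \<bar>\<xi>\<bar>")
      case True
      have "(g \<xi>)\<^sup>2 \<le> ((c1 + c2 + 1) * \<bar>\<xi>\<bar> powr (- q))\<^sup>2" using g g_le[OF True] by (intro power_mono) auto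
      also have "\<dots> = (c1 + c2 + 1)\<^sup>2 * \<bar>\<xi>\<bar> powr (- (2 * q))"
        by (simp add: power_mult_distrib power2_eq_square[of "_ powr _"] powr_add[symmetric])
      finally have "ennreal ((g \<xi>)\<^sup>2) \<le> ennreal ((c1 + c2 + 1)\<^sup>2 * \<bar>\<xi>\<bar> powr (- (2 * q)))" by (rule ennreal_leI)
      also have "\<dots> = ennreal ((c1 + c2 + 1)\<^sup>2) * ?t \<xi>" using True by (simp add: ennreal_mult')
      finally show ?thesis by (rule order_trans) (simp add: add_increasing)
    next
      case False
      have "ennreal ((g \<xi>)\<^sup>2) \<le> 1" using g[of \<xi>] by (simp add: power_le_one ennreal_le_1)
      moreover have "indicator {- a..a} \<xi> = (1::ennreal)" using False by (auto simp: indicator_def)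
      ultimately show ?thesis by (simp add: add_increasing2)
    qed
  qed
  also have "\<dots> = (\<integral>\<^sup>+\<xi>. indicator {- a..a} \<xi> \<partial>lborel) + ennreal ((c1 + c2 + 1)\<^sup>2) * (\<integral>\<^sup>+\<xi>. ?t \<xi> \<partial>lborel)"
    by (subst nn_integral_add) (auto simp: nn_integral_cmult)
  also have "\<dots> < \<infinity>" using tail a by (simp add: ennreal_mult_less_top)
  finally show ?thesis .
qed

section \<open>Ito integrals of simple processes\<close>

text \<open>A recursion rather than a maximum over a set, because the pathwise inequality follows
  how the maximum changes in one step.\<close>

primrec running_max :: "(nat \<Rightarrow> real) \<Rightarrow> nat \<Rightarrow> real" where
  "running_max x 0 = x 0"
| "running_max x (Suc n) = max (running_max x n) (x (Suc n))"

lemma le_running_max: "i \<le> n \<Longrightarrow> x i \<le> running_max x n"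
  by (induction n) (auto simp: le_Suc_eq max_def)

lemma running_max_nonneg: "(\<And>i. 0 \<le> x i) \<Longrightarrow> 0 \<le> running_max x n"
  using le_running_max[of 0 n x] by (meson order_trans zero_le)

lemma running_max_sq_le_sum: "(\<And>i. 0 \<le> x i) \<Longrightarrow> (running_max x n)\<^sup>2 \<le> (\<Sum>i\<le>n. (x i)\<^sup>2)"
proof (induction n)
  case (Suc n)
  then show ?case by (auto simp: max_def intro: add_increasing add_increasing2 sum_nonneg)
qed simp

text \<open>The deterministic inequality behind Doob's L2 inequality. When the maximum moves it
  moves to the current value, so its square telescopes against \<open>x\<close>; what remains is a
  discrete stochastic integral of the running maximum, which is handled after taking
  expectations.\<close>

lemma pathwise_Doob:
  assumes nonneg: "\<And>i. 0 \<le> x i"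
  shows "(running_max x n)\<^sup>2 \<le> 4 * (x n)\<^sup>2 - 4 * (\<Sum>i<n. running_max x i * (x (Suc i) - x i))"
proof -
  have "(running_max x n)\<^sup>2 \<le> 2 * running_max x n * x n - 2 * (\<Sum>i<n. running_max x i * (x (Suc i) - x i))"
  proof (induction n)
    case (Suc n)
    let ?S = "running_max x n" and ?S' = "running_max x (Suc n)"
    have "?S'\<^sup>2 - ?S\<^sup>2 \<le> 2 * x (Suc n) * (?S' - ?S)"
    proof (cases "x (Suc n) \<le> ?S")
      case False
      then have "?S' = x (Suc n)" by simp
      moreover have "0 \<le> (x (Suc n) - ?S)\<^sup>2" by simp
      ultimately show ?thesis by (simp add: power2_eq_square algebra_simps)
    qed simp
    with Suc show ?case by (simp add: algebra_simps)
  qed (use nonneg[of 0] in \<open>simp add: power2_eq_square\<close>)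
  \<comment> \<open>This says that \<open>2 * S * x \<le> S\<^sup>2 / 2 + 2 * x\<^sup>2\<close>,
    with \<open>S\<close> the running maximum. Half of the left side is absorbed, hence the
    constants 4.\<close>
  moreover have "0 \<le> (running_max x n - 2 * x n)\<^sup>2" by simp
  ultimately show ?thesis by (simp add: power2_eq_square algebra_simps)
qed

context filtered_prob_space
begin

lemma space_F: "0 \<le> t \<Longrightarrow> space (F t) = space M"
  using subalgebra_F by (auto simp: subalgebra_def)

lemma measurable_F_mono:
  assumes "0 \<le> s" "s \<le> t" "f \<in> measurable (F s) N"
  shows "f \<in> measurable (F t) N"
  using assms mono_F[of s t] space_F[of s] space_F[of t] by (auto simp: measurable_def)

lemma measurable_F_imp: "0 \<le> s \<Longrightarrow> f \<in> measurable (F s) N \<Longrightarrow> f \<in> measurable M N"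
  using measurable_from_subalg[OF subalgebra_F] .

end

context brownian_motion
begin

lemma B_measurable: "0 \<le> s \<Longrightarrow> s \<le> t \<Longrightarrow> B s \<in> borel_measurable (F t)"
  using adapted_B measurable_F_mono[of s t "B s" borel] by (auto simp: adapted_def)

lemma B_rv [measurable]: "0 \<le> s \<Longrightarrow> B s \<in> borel_measurable M"
  using B_measurable[of s s] measurable_F_imp by auto

text \<open>\<open>indep_var\<close> has one value type for both variables. The map \<open>g\<close>
  carries the real increment into the type of \<open>Y\<close>, so that \<open>Y\<close> may also be
  a tuple of past quantities.\<close>

lemma indep_var_increment:
  assumes st: "0 \<le> s" "s < t" and Y: "Y \<in> measurable (F s) N" and g: "g \<in> measurable borel N"
  shows "indep_var N Y N (\<lambda>\<omega>. g (B t \<omega> - B s \<omega>))"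
  unfolding indep_var_eq
proof (intro conjI)
  let ?D = "\<lambda>\<omega>. B t \<omega> - B s \<omega>"
  show "random_variable N Y" using measurable_F_imp st Y by auto
  show "random_variable N (\<lambda>\<omega>. g (?D \<omega>))"
    using st by (intro measurable_compose[OF _ g]) simp
  have "sigma_sets (space M) {Y -` A \<inter> space M |A. A \<in> sets N} \<subseteq> sets (F s)"
    using measurable_sets[OF Y] unfolding space_F[OF st(1), symmetric]
    by (intro sets.sigma_sets_subset) auto
  moreover have "sigma_sets (space M) {(\<lambda>\<omega>. g (?D \<omega>)) -` A \<inter> space M |A. A \<in> sets N}
     \<subseteq> sets (vimage_algebra (space M) ?D borel)"
  proof -
    have "(\<lambda>\<omega>. g (?D \<omega>)) \<in> measurable (vimage_algebra (space M) ?D borel) N"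
      by (intro measurable_compose[OF _ g] measurable_vimage_algebra1) simp
    from measurable_sets[OF this]
    have "{(\<lambda>\<omega>. g (?D \<omega>)) -` A \<inter> space M |A. A \<in> sets N} \<subseteq> sets (vimage_algebra (space M) ?D borel)"
      by auto
    from sets.sigma_sets_subset[OF this] show ?thesis by simp
  qed
  ultimately show "indep_set (sigma_sets (space M) {Y -` A \<inter> space M |A. A \<in> sets N})
     (sigma_sets (space M) {(\<lambda>\<omega>. g (?D \<omega>)) -` A \<inter> space M |A. A \<in> sets N})"
    using indep_increments[OF st] unfolding indep_sets2_eq by (meson subset_eq)
qed

lemma increment_moments:
  assumes "0 \<le> s" "s < t"
  shows "integrable M (\<lambda>\<omega>. B t \<omega> - B s \<omega>)" "expectation (\<lambda>\<omega>. B t \<omega> - B s \<omega>) = 0"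
    and "integrable M (\<lambda>\<omega>. (B t \<omega> - B s \<omega>)\<^sup>2)" "expectation (\<lambda>\<omega>. (B t \<omega> - B s \<omega>)\<^sup>2) = t - s"
proof -
  note D = normal_increments[OF assms]
  have [simp]: "0 < sqrt (t - s)" using assms by simp
  have n: "\<And>x. x \<in> space lborel \<Longrightarrow> 0 \<le> normal_density 0 (sqrt (t - s)) x" by simp
  show "integrable M (\<lambda>\<omega>. B t \<omega> - B s \<omega>)"
    using distributed_integrable[OF D _ n, of "\<lambda>x. x"] integrable_normal_moment[of "sqrt (t - s)" 0 1] assms(2) by simp
  show e: "expectation (\<lambda>\<omega>. B t \<omega> - B s \<omega>) = 0"
    by (rule normal_distributed_expectation[OF _ D]) (use assms in simp)
  show "integrable M (\<lambda>\<omega>. (B t \<omega> - B s \<omega>)\<^sup>2)"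
    using distributed_integrable[OF D _ n, of "\<lambda>x. x\<^sup>2"] integrable_normal_moment[of "sqrt (t - s)" 0 2] assms(2) by simp
  show "expectation (\<lambda>\<omega>. (B t \<omega> - B s \<omega>)\<^sup>2) = t - s"
    using normal_distributed_variance[OF _ D] assms e by simp
qed

text \<open>Independence factors both expectations. These identities do the work of the martingale
  property and of the isometry, so that no conditional expectation is formed.\<close>

lemma increment_mult:
  fixes Y :: "'a \<Rightarrow> real"
  assumes "0 \<le> s" "s < t" "Y \<in> borel_measurable (F s)" "integrable M Y"
  shows "integrable M (\<lambda>\<omega>. Y \<omega> * (B t \<omega> - B s \<omega>))"
    and "expectation (\<lambda>\<omega>. Y \<omega> * (B t \<omega> - B s \<omega>)) = 0"
    and "integrable M (\<lambda>\<omega>. Y \<omega> * (B t \<omega> - B s \<omega>)\<^sup>2)"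
    and "expectation (\<lambda>\<omega>. Y \<omega> * (B t \<omega> - B s \<omega>)\<^sup>2) = expectation Y * (t - s)"
proof -
  note m = increment_moments[OF assms(1,2)]
  have i: "indep_var borel Y borel (\<lambda>\<omega>. B t \<omega> - B s \<omega>)"
    using assms(3) by (intro indep_var_increment[OF assms(1,2), of Y borel "\<lambda>x. x"]) auto
  have i2: "indep_var borel Y borel (\<lambda>\<omega>. (B t \<omega> - B s \<omega>)\<^sup>2)"
    using indep_var_compose[OF i, of "\<lambda>x. x" borel "\<lambda>x. x\<^sup>2" borel] by (simp add: comp_def)
  show "integrable M (\<lambda>\<omega>. Y \<omega> * (B t \<omega> - B s \<omega>))"
    "expectation (\<lambda>\<omega>. Y \<omega> * (B t \<omega> - B s \<omega>)) = 0"
    using indep_var_integrable[OF i assms(4) m(1)] indep_var_lebesgue_integral[OF i assms(4) m(1)] m(2)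
    by auto
  show "integrable M (\<lambda>\<omega>. Y \<omega> * (B t \<omega> - B s \<omega>)\<^sup>2)"
    "expectation (\<lambda>\<omega>. Y \<omega> * (B t \<omega> - B s \<omega>)\<^sup>2) = expectation Y * (t - s)"
    using indep_var_integrable[OF i2 assms(4) m(3)] indep_var_lebesgue_integral[OF i2 assms(4) m(3)] m(4)
    by auto
qed

section \<open>Discrete stochastic integrals along a finite grid\<close>

definition grid_mart :: "(nat \<Rightarrow> real) \<Rightarrow> (nat \<Rightarrow> 'a \<Rightarrow> real) \<Rightarrow> nat \<Rightarrow> 'a \<Rightarrow> real" where
  "grid_mart p \<zeta> j \<omega> = (\<Sum>i<j. \<zeta> i \<omega> * (B (p (Suc i)) \<omega> - B (p i) \<omega>))"

text \<open>The predictable quadratic variation of \<open>grid_mart\<close>. Its value at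
  \<open>j\<close> involves only coefficients of index below \<open>j\<close>, so it is known one
  grid point earlier.\<close>

definition grid_var :: "(nat \<Rightarrow> real) \<Rightarrow> (nat \<Rightarrow> 'a \<Rightarrow> real) \<Rightarrow> nat \<Rightarrow> 'a \<Rightarrow> real" where
  "grid_var p \<zeta> j \<omega> = (\<Sum>i<j. (\<zeta> i \<omega>)\<^sup>2 * (p (Suc i) - p i))"

lemma grid_le:
  fixes p :: "nat \<Rightarrow> real"
  assumes "\<And>i. i < m \<Longrightarrow> p i < p (Suc i)" "i \<le> j" "j \<le> m"
  shows "p i \<le> p j"
  using assms(2,3)
proof (induction j)
  case (Suc j)
  then show ?case using assms(1)[of j] by (cases "i = Suc j") auto
qed simp

lemma grid_nonneg:
  fixes p :: "nat \<Rightarrow> real"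
  assumes "0 \<le> p 0" "\<And>i. i < m \<Longrightarrow> p i < p (Suc i)" "j \<le> m"
  shows "0 \<le> p j"
  by (rule order_trans[OF assms(1) grid_le[of m p 0 j, OF assms(2)]]) (use assms(3) in auto)

lemma grid_mart_measurable:
  assumes p0: "0 \<le> p 0" and p: "\<And>i. i < m \<Longrightarrow> p i < p (Suc i)"
    and \<zeta>: "\<And>i. i < m \<Longrightarrow> \<zeta> i \<in> borel_measurable (F (p i))" and "j \<le> k" "k \<le> m"
  shows "grid_mart p \<zeta> j \<in> borel_measurable (F (p k))"
  unfolding grid_mart_def
proof (intro borel_measurable_sum borel_measurable_times borel_measurable_diff)
  fix i assume "i \<in> {..<j}"
  then have i: "i < j" by simp
  have le: "i < m" "i \<le> k" "Suc i \<le> k" "i \<le> m" "Suc i \<le> m" using i assms(4,5) by auto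
  have pos: "0 \<le> p i" "0 \<le> p (Suc i)" using grid_nonneg[OF p0 p] le by blast+
  have mono: "p i \<le> p k" "p (Suc i) \<le> p k"
    using le assms(5) by (intro grid_le[of m p, OF p]; simp)+
  show "\<zeta> i \<in> borel_measurable (F (p k))"
    by (rule measurable_F_mono[OF pos(1) mono(1) \<zeta>[OF le(1)]])
  show "B (p (Suc i)) \<in> borel_measurable (F (p k))" "B (p i) \<in> borel_measurable (F (p k))"
    by (rule B_measurable[OF pos(2) mono(2)] B_measurable[OF pos(1) mono(1)])+
qed

text \<open>Here \<open>j\<close> may be \<open>Suc k\<close>, while for \<open>grid_mart\<close> it
  is at most \<open>k\<close>. This lookahead allows a stopping rule at \<open>p k\<close> that
  tests the variation including the step about to be made.\<close>

lemma grid_var_measurable: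
  assumes p0: "0 \<le> p 0" and p: "\<And>i. i < m \<Longrightarrow> p i < p (Suc i)"
    and \<zeta>: "\<And>i. i < m \<Longrightarrow> \<zeta> i \<in> borel_measurable (F (p i))" and "j \<le> Suc k" "j \<le> m" "k \<le> m"
  shows "grid_var p \<zeta> j \<in> borel_measurable (F (p k))"
  unfolding grid_var_def
proof (intro borel_measurable_sum borel_measurable_times borel_measurable_const borel_measurable_power)
  fix i assume "i \<in> {..<j}"
  then have i: "i < j" by simp
  have le: "i < m" "i \<le> k" "i \<le> m" using i assms(4,5) by auto
  have "0 \<le> p i" using grid_nonneg[OF p0 p] le by blast
  moreover have "p i \<le> p k"
    using le assms(6) by (intro grid_le[of m p, OF p]; simp)
  ultimately show "\<zeta> i \<in> borel_measurable (F (p k))"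
    by (rule measurable_F_mono[OF _ _ \<zeta>[OF le(1)]])
qed

text \<open>Take expectations in \<open>pathwise_Doob\<close> for the absolute values of
  \<open>grid_mart\<close>: the sum is bounded below by a martingale transform of mean 0, and the
  terminal square has the expectation of \<open>grid_var\<close>. Bounded coefficients make all
  products integrable.\<close>

lemma grid_maximal_bounded:
  assumes p0: "0 \<le> p 0" and p: "\<And>i. i < m \<Longrightarrow> p i < p (Suc i)"
    and \<zeta>: "\<And>i. i < m \<Longrightarrow> \<zeta> i \<in> borel_measurable (F (p i))"
    and bd: "\<And>i. i < m \<Longrightarrow> \<exists>c. \<forall>\<omega>\<in>space M. \<bar>\<zeta> i \<omega>\<bar> \<le> c"
  shows "integrable M (\<lambda>\<omega>. (running_max (\<lambda>j. \<bar>grid_mart p \<zeta> j \<omega>\<bar>) m)\<^sup>2)" (is ?I)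
    and "integrable M (grid_var p \<zeta> m)" (is ?J)
    and "expectation (\<lambda>\<omega>. (running_max (\<lambda>j. \<bar>grid_mart p \<zeta> j \<omega>\<bar>) m)\<^sup>2)
       \<le> 4 * expectation (grid_var p \<zeta> m)" (is ?K)
proof -
  let ?M = "grid_mart p \<zeta>" and ?V = "grid_var p \<zeta>"
  let ?S = "\<lambda>j \<omega>. running_max (\<lambda>j. \<bar>?M j \<omega>\<bar>) j"
  let ?D = "\<lambda>j \<omega>. B (p (Suc j)) \<omega> - B (p j) \<omega>"
  have pos: "0 \<le> p j" if "j \<le> m" for j
    by (rule grid_nonneg[OF p0 p that])
  have Mm: "?M i \<in> borel_measurable (F (p j))" if "i \<le> j" "j \<le> m" for i j
    by (rule grid_mart_measurable[OF p0 p \<zeta> that])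
  have Sm: "?S i \<in> borel_measurable (F (p j))" if "i \<le> j" "j \<le> m" for i j
    using that(1)
  proof (induction i)
    case 0 then show ?case using Mm[of 0 j] that(2) by auto
  next
    case (Suc i) then show ?case using Mm[of "Suc i" j] that(2) by auto
  qed
  have bdmult: "integrable M (\<lambda>\<omega>. \<zeta> j \<omega> * f \<omega>)" if jm: "j < m" and fi: "integrable M f" for j and f :: "'a \<Rightarrow> real"
  proof -
    obtain c where c: "\<And>\<omega>. \<omega> \<in> space M \<Longrightarrow> \<bar>\<zeta> j \<omega>\<bar> \<le> c" using bd[OF jm] by blast
    have [measurable]: "\<zeta> j \<in> borel_measurable M"
      using measurable_F_imp[OF pos \<zeta>] jm by auto
    show ?thesis
      by (rule Bochner_Integration.integrable_bound[of M "\<lambda>\<omega>. c * f \<omega>"])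
         (use fi c in \<open>auto intro!: AE_I2 mult_right_mono simp: abs_mult intro: order_trans[OF _ abs_ge_self]\<close>)
  qed
  have \<zeta>2: "integrable M (\<lambda>\<omega>. (\<zeta> j \<omega>)\<^sup>2)" if "j < m" for j
    using bdmult[OF that bdmult[OF that, of "\<lambda>_. 1"]] by (simp add: power2_eq_square)
  \<comment> \<open>The isometry, by induction on the grid: in the square of the next value the
    cross term has mean 0, because \<open>\<zeta> j * ?M j\<close> belongs to the past of
    \<open>p j\<close>.\<close>
  have M2: "integrable M (\<lambda>\<omega>. (?M j \<omega>)\<^sup>2) \<and> expectation (\<lambda>\<omega>. (?M j \<omega>)\<^sup>2) = expectation (?V j) \<and> integrable M (?V j)"
    if "j \<le> m" for j
    using that
  proof (induction j)
    case 0 show ?case by (simp add: grid_mart_def[abs_def] grid_var_def[abs_def])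
  next
    case (Suc j)
    then have j: "j < m" "j \<le> m" by auto
    have Mj[measurable]: "?M j \<in> borel_measurable M" by (rule measurable_F_imp[OF pos[OF j(2)] Mm[OF order_refl j(2)]])
    have IM: "integrable M (?M j)"
      by (rule square_integrable_imp_integrable) (use Suc in auto)
    have "integrable M (\<lambda>\<omega>. \<zeta> j \<omega> * ?M j \<omega>)" by (rule bdmult[OF j(1) IM])
    moreover have "(\<lambda>\<omega>. \<zeta> j \<omega> * ?M j \<omega>) \<in> borel_measurable (F (p j))"
      using Mm[of j j] \<zeta>[of j] j by auto
    ultimately have 1: "integrable M (\<lambda>\<omega>. (\<zeta> j \<omega> * ?M j \<omega>) * ?D j \<omega>)"
        "expectation (\<lambda>\<omega>. (\<zeta> j \<omega> * ?M j \<omega>) * ?D j \<omega>) = 0"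
      using increment_mult(1,2)[OF pos[OF j(2)] p[OF j(1)]] by simp_all
    have "(\<lambda>\<omega>. (\<zeta> j \<omega>)\<^sup>2) \<in> borel_measurable (F (p j))" using \<zeta>[of j] j by auto
    then have 2: "integrable M (\<lambda>\<omega>. (\<zeta> j \<omega>)\<^sup>2 * (?D j \<omega>)\<^sup>2)"
        "expectation (\<lambda>\<omega>. (\<zeta> j \<omega>)\<^sup>2 * (?D j \<omega>)\<^sup>2) = expectation (\<lambda>\<omega>. (\<zeta> j \<omega>)\<^sup>2) * (p (Suc j) - p j)"
      using increment_mult(3,4)[OF pos[OF j(2)] p[OF j(1)]] \<zeta>2[OF j(1)] by simp_all
    have eq: "(?M (Suc j) \<omega>)\<^sup>2 = (?M j \<omega>)\<^sup>2 + 2 * ((\<zeta> j \<omega> * ?M j \<omega>) * ?D j \<omega>) + (\<zeta> j \<omega>)\<^sup>2 * (?D j \<omega>)\<^sup>2" for \<omega>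
      by (simp add: grid_mart_def power2_eq_square algebra_simps)
    have eqV: "?V (Suc j) \<omega> = ?V j \<omega> + (\<zeta> j \<omega>)\<^sup>2 * (p (Suc j) - p j)" for \<omega>
      by (simp add: grid_var_def)
    have IH: "integrable M (\<lambda>\<omega>. (?M j \<omega>)\<^sup>2)" "expectation (\<lambda>\<omega>. (?M j \<omega>)\<^sup>2) = expectation (?V j)"
      "integrable M (?V j)" using Suc.IH j by auto
    show ?case unfolding eq eqV[abs_def]
      by (intro conjI) (use IH 1 2 \<zeta>2[OF j(1)] in simp_all)
  qed
  then show ?J by simp
  have Mint: "integrable M (\<lambda>\<omega>. (?M j \<omega>)\<^sup>2)" if "j \<le> m" for j using M2[OF that] by simp
  have S2: "integrable M (\<lambda>\<omega>. (?S j \<omega>)\<^sup>2)" if "j \<le> m" for j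
  proof (rule Bochner_Integration.integrable_bound[of M "\<lambda>\<omega>. \<Sum>i\<le>j. (?M i \<omega>)\<^sup>2"])
    show "integrable M (\<lambda>\<omega>. \<Sum>i\<le>j. (?M i \<omega>)\<^sup>2)"
      using Mint that by (intro Bochner_Integration.integrable_sum) auto
    have [measurable]: "?S j \<in> borel_measurable M" by (rule measurable_F_imp[OF pos[OF that] Sm[OF order_refl that]])
    show "(\<lambda>\<omega>. (?S j \<omega>)\<^sup>2) \<in> borel_measurable M" by measurable
    show "AE \<omega> in M. norm ((?S j \<omega>)\<^sup>2) \<le> norm (\<Sum>i\<le>j. (?M i \<omega>)\<^sup>2)"
      using running_max_sq_le_sum[of "\<lambda>j. \<bar>?M j _\<bar>" j]
      by (auto intro!: AE_I2 simp: sum_nonneg)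
  qed
  then show ?I by simp
  \<comment> \<open>By \<open>sgn u * (v - u) \<le> \<bar>v\<bar> - \<bar>u\<bar>\<close> this lies
    below the Doob summand, and it has mean 0 because every factor but the increment belongs to the
    past.\<close>
  let ?T = "\<lambda>j \<omega>. (\<zeta> j \<omega> * (?S j \<omega> * sgn (?M j \<omega>))) * ?D j \<omega>"
  have T: "integrable M (?T j) \<and> expectation (?T j) = 0" if j: "j < m" for j
  proof -
    have [measurable]: "?S j \<in> borel_measurable M" "?M j \<in> borel_measurable M"
      using j by (intro measurable_F_imp[OF pos[of j]] Mm Sm; simp)+
    have "integrable M (?S j)"
      by (rule square_integrable_imp_integrable) (use S2 j in auto)
    then have "integrable M (\<lambda>\<omega>. ?S j \<omega> * sgn (?M j \<omega>))"
      by (rule Bochner_Integration.integrable_bound) (auto simp: abs_mult sgn_if)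
    then have "integrable M (\<lambda>\<omega>. \<zeta> j \<omega> * (?S j \<omega> * sgn (?M j \<omega>)))" by (rule bdmult[OF j])
    moreover have "(\<lambda>\<omega>. \<zeta> j \<omega> * (?S j \<omega> * sgn (?M j \<omega>))) \<in> borel_measurable (F (p j))"
    proof -
      have [measurable]: "?M j \<in> borel_measurable (F (p j))" "?S j \<in> borel_measurable (F (p j))"
          "\<zeta> j \<in> borel_measurable (F (p j))"
        using j by (auto intro: Mm Sm \<zeta> simp del: running_max.simps)
      show ?thesis by measurable
    qed
    ultimately show ?thesis using increment_mult(1,2)[OF pos[of j] p[OF j]] j by (intro conjI) simp_all
  qed
  have path: "(?S m \<omega>)\<^sup>2 \<le> 4 * (?M m \<omega>)\<^sup>2 - 4 * (\<Sum>j<m. ?T j \<omega>)" for \<omega>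
  proof -
    have "?T j \<omega> \<le> ?S j \<omega> * (\<bar>?M (Suc j) \<omega>\<bar> - \<bar>?M j \<omega>\<bar>)" for j
    proof -
      have d: "?M (Suc j) \<omega> - ?M j \<omega> = \<zeta> j \<omega> * ?D j \<omega>"
        by (simp add: grid_mart_def)
      have "?T j \<omega> = ?S j \<omega> * (sgn (?M j \<omega>) * (?M (Suc j) \<omega> - ?M j \<omega>))"
        unfolding d by (simp only: mult_ac)
      also have "\<dots> \<le> ?S j \<omega> * (\<bar>?M (Suc j) \<omega>\<bar> - \<bar>?M j \<omega>\<bar>)"
        by (intro mult_left_mono running_max_nonneg abs_ge_zero)
            (auto simp: sgn_if)
      finally show ?thesis .
    qed
    then have "(\<Sum>j<m. ?T j \<omega>) \<le> (\<Sum>j<m. ?S j \<omega> * (\<bar>?M (Suc j) \<omega>\<bar> - \<bar>?M j \<omega>\<bar>))"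
      by (rule sum_mono)
    moreover have "(?S m \<omega>)\<^sup>2 \<le> 4 * \<bar>?M m \<omega>\<bar>\<^sup>2 - 4 * (\<Sum>j<m. ?S j \<omega> * (\<bar>?M (Suc j) \<omega>\<bar> - \<bar>?M j \<omega>\<bar>))"
      by (rule pathwise_Doob) simp
    ultimately show ?thesis unfolding power2_abs by linarith
  qed
  have "expectation (\<lambda>\<omega>. (?S m \<omega>)\<^sup>2) \<le> expectation (\<lambda>\<omega>. 4 * (?M m \<omega>)\<^sup>2 - 4 * (\<Sum>j<m. ?T j \<omega>))"
    using T
    by (intro integral_mono path Bochner_Integration.integrable_diff integrable_mult_right
        Bochner_Integration.integrable_sum S2 Mint) simp_all
  also have "\<dots> = 4 * expectation (?V m)"
  proof -
    have "expectation (\<lambda>\<omega>. \<Sum>j<m. ?T j \<omega>) = (\<Sum>j<m. expectation (?T j))"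
      using T by (intro Bochner_Integration.integral_sum) simp
    also have "\<dots> = 0" using T by simp
    finally have 0: "expectation (\<lambda>\<omega>. \<Sum>j<m. ?T j \<omega>) = 0" .
    have "expectation (\<lambda>\<omega>. 4 * (?M m \<omega>)\<^sup>2 - 4 * (\<Sum>j<m. ?T j \<omega>))
       = expectation (\<lambda>\<omega>. 4 * (?M m \<omega>)\<^sup>2) - expectation (\<lambda>\<omega>. 4 * (\<Sum>j<m. ?T j \<omega>))"
      using T by (intro Bochner_Integration.integral_diff integrable_mult_right
        Bochner_Integration.integrable_sum Mint) simp_all
    also have "\<dots> = 4 * expectation (?V m) - 4 * 0"
      unfolding integral_mult_right_zero 0 using M2[of m] by simp
    finally show ?thesis by simp
  qed
  finally show ?K .
qed

text \<open>Stopping before the quadratic variation exceeds \<open>K\<close> makes the coefficients bounded.\<close>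

lemma grid_maximal:
  assumes p0: "0 \<le> p 0" and p: "\<And>i. i < m \<Longrightarrow> p i < p (Suc i)"
    and \<zeta>: "\<And>i. i < m \<Longrightarrow> \<zeta> i \<in> borel_measurable (F (p i))"
    and K: "0 \<le> K"
  shows "(\<integral>\<^sup>+\<omega>. (SUP j\<in>{..m}. if grid_var p \<zeta> j \<omega> \<le> K then ennreal ((grid_mart p \<zeta> j \<omega>)\<^sup>2) else 0) \<partial>M)
     \<le> 4 * (\<integral>\<^sup>+\<omega>. ennreal (min (grid_var p \<zeta> m \<omega>) K) \<partial>M)"
proof -
  let ?V = "grid_var p \<zeta>"
  \<comment> \<open>The coefficient is switched off when the coming step would lift the variation
    above \<open>K\<close>. The test looks one step ahead, so the stopped variation never overshoots
    \<open>K\<close>, and it is still decided at time \<open>p i\<close>.\<close>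
  define \<xi> where "\<xi> i \<omega> = (if ?V (Suc i) \<omega> \<le> K then \<zeta> i \<omega> else 0)" for i \<omega>
  have V_nonneg: "0 \<le> grid_var p \<zeta> j \<omega>" if "j \<le> m" for j \<omega> and \<zeta> :: "nat \<Rightarrow> 'a \<Rightarrow> real"
    unfolding grid_var_def using p that by (intro sum_nonneg mult_nonneg_nonneg) (auto intro: less_imp_le)
  have V_Suc: "?V j \<omega> \<le> ?V (Suc j) \<omega>" if "j < m" for j \<omega>
    using p[OF that] by (simp add: grid_var_def)
  have \<xi>_m: "\<xi> i \<in> borel_measurable (F (p i))" if "i < m" for i
  proof -
    have [measurable]: "?V (Suc i) \<in> borel_measurable (F (p i))" "\<zeta> i \<in> borel_measurable (F (p i))"
      using that by (auto intro!: grid_var_measurable[OF p0 p \<zeta>, of m] \<zeta>)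
    show ?thesis unfolding \<xi>_def[abs_def] by measurable
  qed
  have \<xi>_bd: "\<exists>c. \<forall>\<omega>\<in>space M. \<bar>\<xi> i \<omega>\<bar> \<le> c" if "i < m" for i
  proof (intro exI ballI)
    fix \<omega>
    have d: "0 < p (Suc i) - p i" using p[OF that] by simp
    \<comment> \<open>While a coefficient is switched on, its own contribution to the variation is
      at most \<open>K\<close>, which bounds it by a constant depending only on the mesh.\<close>
    show "\<bar>\<xi> i \<omega>\<bar> \<le> sqrt (K / (p (Suc i) - p i))"
    proof (cases "?V (Suc i) \<omega> \<le> K")
      case True
      have "(\<zeta> i \<omega>)\<^sup>2 * (p (Suc i) - p i) \<le> ?V (Suc i) \<omega>"
        using V_nonneg[of i \<zeta> \<omega>] that by (simp add: grid_var_def)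
      with True d have "(\<zeta> i \<omega>)\<^sup>2 \<le> K / (p (Suc i) - p i)" by (simp add: pos_le_divide_eq)
      then show ?thesis using True by (simp add: \<xi>_def real_le_rsqrt)
    qed (use K d in \<open>simp add: \<xi>_def\<close>)
  qed
  \<comment> \<open>As long as the variation is at most \<open>K\<close> nothing has been changed;
    in all cases the stopped variation is at most the minimum of the original one and
    \<open>K\<close>.\<close>
  have stop: "(?V j \<omega> \<le> K \<longrightarrow> grid_var p \<xi> j \<omega> = ?V j \<omega> \<and> grid_mart p \<xi> j \<omega> = grid_mart p \<zeta> j \<omega>)
      \<and> grid_var p \<xi> j \<omega> \<le> ?V j \<omega> \<and> grid_var p \<xi> j \<omega> \<le> K" if "j \<le> m" for j \<omega>
    using that
  proof (induction j)
    case (Suc j)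
    then have j: "j < m" and IH: "?V j \<omega> \<le> K \<Longrightarrow> grid_var p \<xi> j \<omega> = ?V j \<omega>"
        "?V j \<omega> \<le> K \<Longrightarrow> grid_mart p \<xi> j \<omega> = grid_mart p \<zeta> j \<omega>"
        "grid_var p \<xi> j \<omega> \<le> ?V j \<omega>" "grid_var p \<xi> j \<omega> \<le> K" by auto
    have var_Suc: "grid_var p \<xi> (Suc j) \<omega> = grid_var p \<xi> j \<omega> + (\<xi> j \<omega>)\<^sup>2 * (p (Suc j) - p j)"
        "?V (Suc j) \<omega> = ?V j \<omega> + (\<zeta> j \<omega>)\<^sup>2 * (p (Suc j) - p j)"
      by (simp_all add: grid_var_def)
    have mart_Suc: "grid_mart p \<xi> (Suc j) \<omega> = grid_mart p \<xi> j \<omega> + \<xi> j \<omega> * (B (p (Suc j)) \<omega> - B (p j) \<omega>)"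
        "grid_mart p \<zeta> (Suc j) \<omega> = grid_mart p \<zeta> j \<omega> + \<zeta> j \<omega> * (B (p (Suc j)) \<omega> - B (p j) \<omega>)"
      by (simp_all add: grid_mart_def)
    show ?case
    proof (cases "?V (Suc j) \<omega> \<le> K")
      case True
      then have "?V j \<omega> \<le> K" using V_Suc[OF j] by (rule order_trans[rotated])
      moreover have "\<xi> j \<omega> = \<zeta> j \<omega>" using True by (simp add: \<xi>_def)
      ultimately show ?thesis using True IH(1,2) unfolding var_Suc mart_Suc by simp
    next
      case False
      then have "\<xi> j \<omega> = 0" by (simp add: \<xi>_def)
      then show ?thesis using False IH(3,4) V_Suc[OF j, of \<omega>] var_Suc(1) by auto
    qed
  qed (use K in \<open>simp add: grid_var_def grid_mart_def\<close>)
  note bd = grid_maximal_bounded[OF p0 p \<xi>_m \<xi>_bd]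
  have "(\<integral>\<^sup>+\<omega>. (SUP j\<in>{..m}. if ?V j \<omega> \<le> K then ennreal ((grid_mart p \<zeta> j \<omega>)\<^sup>2) else 0) \<partial>M)
     \<le> (\<integral>\<^sup>+\<omega>. ennreal ((running_max (\<lambda>j. \<bar>grid_mart p \<xi> j \<omega>\<bar>) m)\<^sup>2) \<partial>M)"
  proof (intro nn_integral_mono SUP_least)
    fix \<omega> j assume j: "j \<in> {..m}"
    have "\<bar>grid_mart p \<xi> j \<omega>\<bar>\<^sup>2 \<le> (running_max (\<lambda>j. \<bar>grid_mart p \<xi> j \<omega>\<bar>) m)\<^sup>2"
      using j le_running_max[of j m "\<lambda>j. \<bar>grid_mart p \<xi> j \<omega>\<bar>"] by (intro power_mono) auto
    then show "(if ?V j \<omega> \<le> K then ennreal ((grid_mart p \<zeta> j \<omega>)\<^sup>2) else 0)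
       \<le> ennreal ((running_max (\<lambda>j. \<bar>grid_mart p \<xi> j \<omega>\<bar>) m)\<^sup>2)"
      using stop[of j \<omega>] j by (auto intro!: ennreal_leI)
  qed
  also have "\<dots> = ennreal (expectation (\<lambda>\<omega>. (running_max (\<lambda>j. \<bar>grid_mart p \<xi> j \<omega>\<bar>) m)\<^sup>2))"
    using bd(1) by (intro nn_integral_eq_integral) auto
  also have "\<dots> \<le> ennreal (4 * expectation (grid_var p \<xi> m))"
    by (rule ennreal_leI[OF bd(3)])
  also have "\<dots> = 4 * ennreal (expectation (grid_var p \<xi> m))"
    by (simp add: ennreal_mult')
  also have "ennreal (expectation (grid_var p \<xi> m)) = (\<integral>\<^sup>+\<omega>. ennreal (grid_var p \<xi> m \<omega>) \<partial>M)"
    using bd(2) V_nonneg by (intro nn_integral_eq_integral[symmetric]) auto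
  also have "4 * \<dots> \<le> 4 * (\<integral>\<^sup>+\<omega>. ennreal (min (?V m \<omega>) K) \<partial>M)"
    using stop[of m] by (intro mult_left_mono nn_integral_mono ennreal_leI) auto
  finally show ?thesis .
qed

end

section \<open>Simple processes refined to a common grid\<close>

lemma finite_grid:
  fixes P :: "real set"
  assumes "finite P" "P \<subseteq> {r..T}" "r \<in> P" "T \<in> P"
  shows "\<exists>p m. p 0 = r \<and> p m = T \<and> (\<forall>i<m. p i < p (Suc i)) \<and> P = p ` {..m::nat}"
proof -
  have "set (sorted_list_of_set P) = P" "sorted_wrt (<) (sorted_list_of_set P)"
    using assms(1) by auto
  then obtain l where l: "set l = P" "sorted_wrt (<) l" by blast
  let ?p = "\<lambda>i. l ! i"
  have ne: "l \<noteq> []" using l(1) assms(3) by auto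
  define m where "m = length l - 1"
  have len: "length l = Suc m" using ne by (cases l) (simp_all add: m_def)
  have less: "?p i < ?p (Suc i)" if "i < m" for i
    using that len by (intro sorted_wrt_nth_less[OF l(2)]) auto
  have im: "P = ?p ` {..m}"
  proof -
    have "P = {?p i | i. i < Suc m}" using l(1) unfolding set_conv_nth len by simp
    then show ?thesis by (auto simp: less_Suc_eq_le)
  qed
  have mono: "?p i \<le> ?p j" if "i \<le> j" "j \<le> m" for i j
    using l(2) that len by (cases "i = j") (auto intro!: less_imp_le sorted_wrt_nth_less[OF l(2)])
  obtain a where a: "a \<le> m" "?p a = r" using assms(3) im by auto
  obtain b where b: "b \<le> m" "?p b = T" using assms(4) im by auto
  have "?p 0 \<in> P" "?p m \<in> P" using im by auto
  then have "?p 0 = r" "?p m = T"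
    using mono[of 0 a] mono[of b m] a b assms(2) by auto
  with less im show ?thesis by (intro exI[of _ ?p] exI[of _ m]) blast
qed

text \<open>No breakpoint lies strictly between \<open>a\<close> and \<open>b\<close>, and the
  intervals are open on the left, so each of them contains all of \<open>{a<..b}\<close> or none of
  it. The value is therefore read off at the right end.\<close>

lemma simple_process_const:
  assumes "\<And>k. k \<le> n \<Longrightarrow> \<tau> k \<le> a \<or> b \<le> \<tau> k" "a < s" "s \<le> b"
  shows "simple_process n \<tau> \<xi> s \<omega> = simple_process n \<tau> \<xi> b \<omega>"
  unfolding simple_process_def
proof (intro sum.cong refl)
  fix k assume "k \<in> {..<n}"
  then have "\<tau> k \<le> a \<or> b \<le> \<tau> k" "\<tau> (Suc k) \<le> a \<or> b \<le> \<tau> (Suc k)" using assms(1) by auto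
  then show "\<xi> k \<omega> * indicator {\<tau> k<..\<tau> (Suc k)} s = \<xi> k \<omega> * indicator {\<tau> k<..\<tau> (Suc k)} b"
    using assms(2,3) by (auto simp: indicator_def)
qed

lemma simple_ito_integral_increment:
  assumes "\<And>k. k \<le> n \<Longrightarrow> \<tau> k \<le> a \<or> b \<le> \<tau> k" "a < b" and mono: "\<And>k. k < n \<Longrightarrow> \<tau> k \<le> \<tau> (Suc k)"
  shows "simple_ito_integral B n \<tau> \<xi> b \<omega> - simple_ito_integral B n \<tau> \<xi> a \<omega>
     = simple_process n \<tau> \<xi> b \<omega> * (B b \<omega> - B a \<omega>)"
  unfolding simple_process_def simple_ito_integral_def sum_distrib_right sum_subtractf[symmetric]
proof (intro sum.cong refl)
  fix k assume "k \<in> {..<n}"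
  then have "\<tau> k \<le> a \<or> b \<le> \<tau> k" "\<tau> (Suc k) \<le> a \<or> b \<le> \<tau> (Suc k)" "\<tau> k \<le> \<tau> (Suc k)"
    using assms(1) mono by auto
  then consider "b \<le> \<tau> k" "b \<le> \<tau> (Suc k)" | "\<tau> k \<le> a" "\<tau> (Suc k) \<le> a" | "\<tau> k \<le> a" "b \<le> \<tau> (Suc k)"
    by linarith
  then show "\<xi> k \<omega> * (B (min (\<tau> (Suc k)) b) \<omega> - B (min (\<tau> k) b) \<omega>) -
      \<xi> k \<omega> * (B (min (\<tau> (Suc k)) a) \<omega> - B (min (\<tau> k) a) \<omega>)
      = \<xi> k \<omega> * indicator {\<tau> k<..\<tau> (Suc k)} b * (B b \<omega> - B a \<omega>)"
    using assms(2) by cases (simp_all add: min_def algebra_simps indicator_def)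
qed

context brownian_motion
begin

text \<open>On the grid formed by \<open>r\<close>, \<open>T\<close>, \<open>Q\<close> and the
  breakpoints in between, the integrand minus \<open>c\<close> is constant on each cell. The
  compensated integral is then a \<open>grid_mart\<close>, \<open>V\<close> is its
  \<open>grid_var\<close>, and \<open>grid_maximal\<close> applies. The subtracted \<open>c\<close>
  will be either 0 or the coefficient frozen at time \<open>r\<close>.\<close>

lemma simple_maximal:
  assumes si: "simple_integrand M F n \<tau> \<xi>" and r: "0 \<le> r" "r < T"
    and c: "c \<in> borel_measurable (F r)" and Q: "finite Q" "Q \<subseteq> {r..T}" and K: "0 \<le> K"
  defines "V \<equiv> \<lambda>u \<omega>. \<integral>\<^sup>+s\<in>{r..u}. ennreal ((simple_process n \<tau> \<xi> s \<omega> - c \<omega>)\<^sup>2) \<partial>lborel"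
    and "I \<equiv> simple_ito_integral B n \<tau> \<xi>"
  shows "(\<integral>\<^sup>+\<omega>. (SUP q\<in>Q. if V q \<omega> \<le> ennreal K
            then ennreal ((I q \<omega> - I r \<omega> - c \<omega> * (B q \<omega> - B r \<omega>))\<^sup>2) else 0) \<partial>M)
     \<le> 4 * (\<integral>\<^sup>+\<omega>. min (V T \<omega>) (ennreal K) \<partial>M)"
proof -
  let ?\<phi> = "simple_process n \<tau> \<xi>"
  define P where "P = {r, T} \<union> Q \<union> (\<tau> ` {..n} \<inter> {r..T})"
  have "finite P" "P \<subseteq> {r..T}" "r \<in> P" "T \<in> P" using Q r by (auto simp: P_def)
  then obtain p m where p0: "p 0 = r" and pm: "p m = T" and p: "\<And>i. i < m \<Longrightarrow> p i < p (Suc i)"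
    and P: "P = p ` {..m::nat}" using finite_grid[of P r T] by blast
  have p0': "0 \<le> p 0" using p0 r by simp
  have mono\<tau>: "\<tau> k \<le> \<tau> (Suc k)" if "k < n" for k
    using si that by (simp add: simple_integrand_def)
  have mono: "p i \<le> p j" if "i \<le> j" "j \<le> m" for i j
    by (rule grid_le[of m p i j, OF p that])
  have gap: "\<tau> k \<le> p i \<or> p (Suc i) \<le> \<tau> k" if "i < m" "k \<le> n" for i k
  proof (cases "\<tau> k \<in> {r..T}")
    case True
    then have "\<tau> k \<in> P" using that by (auto simp: P_def)
    then obtain j where "j \<le> m" "\<tau> k = p j" using P by auto
    then show ?thesis using mono[of j i] mono[of "Suc i" j] that by (cases "j \<le> i") auto
  next
    case False
    then show ?thesis using mono[of 0 i] mono[of "Suc i" m] that p0 pm by auto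
  qed
  \<comment> \<open>The cell is open on the left, so its coefficient is the value at the right end
    \<open>p (Suc i)\<close>.\<close>
  define \<zeta> where "\<zeta> i \<omega> = ?\<phi> (p (Suc i)) \<omega> - c \<omega>" for i \<omega>
  have \<zeta>_m: "\<zeta> i \<in> borel_measurable (F (p i))" if i: "i < m" for i
  proof -
    have ri: "r \<le> p i" using mono[of 0 i] i p0 by simp
    have "(\<lambda>\<omega>. \<xi> k \<omega> * indicator {\<tau> k<..\<tau> (Suc k)} (p (Suc i))) \<in> borel_measurable (F (p i))"
      if k: "k < n" for k
    \<comment> \<open>Although the value is taken at the right end, it is known at
      \<open>p i\<close>: a breakpoint before \<open>p (Suc i)\<close> is at most \<open>p i\<close>
      by \<open>gap\<close>, and a later one contributes 0.\<close>
    proof (cases "\<tau> k < p (Suc i)")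
      case True
      then have le: "\<tau> k \<le> p i" using gap[OF i, of k] k by auto
      have \<xi>k: "\<xi> k \<in> borel_measurable (F (\<tau> k))" using si k by (simp add: simple_integrand_def)
      have "0 \<le> \<tau> j" if "j \<le> n" for j
        using that by (induction j) (use si mono\<tau> in \<open>auto simp: simple_integrand_def intro: order_trans\<close>)
      then have "0 \<le> \<tau> k" using k by simp
      then have "\<xi> k \<in> borel_measurable (F (p i))" by (rule measurable_F_mono[OF _ le \<xi>k])
      then show ?thesis by simp
    qed simp
    moreover have "c \<in> borel_measurable (F (p i))" by (rule measurable_F_mono[OF r(1) ri c])
    ultimately show ?thesis unfolding \<zeta>_def[abs_def] simple_process_def
      by (intro borel_measurable_diff borel_measurable_sum) auto
  qed
  have mart: "grid_mart p \<zeta> j \<omega> = I (p j) \<omega> - I r \<omega> - c \<omega> * (B (p j) \<omega> - B r \<omega>)" if "j \<le> m" for j \<omega>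
    using that
  proof (induction j)
    case (Suc j)
    then have j: "j < m" by simp
    have inc: "I (p (Suc j)) \<omega> - I (p j) \<omega> = ?\<phi> (p (Suc j)) \<omega> * (B (p (Suc j)) \<omega> - B (p j) \<omega>)"
      unfolding I_def by (intro simple_ito_integral_increment gap[OF j] p[OF j] mono\<tau>)
    have "grid_mart p \<zeta> (Suc j) \<omega> = grid_mart p \<zeta> j \<omega> + \<zeta> j \<omega> * (B (p (Suc j)) \<omega> - B (p j) \<omega>)"
      by (simp add: grid_mart_def)
    also have "\<zeta> j \<omega> * (B (p (Suc j)) \<omega> - B (p j) \<omega>)
       = I (p (Suc j)) \<omega> - I (p j) \<omega> - c \<omega> * (B (p (Suc j)) \<omega> - B (p j) \<omega>)"
      unfolding inc \<zeta>_def by (simp only: left_diff_distrib)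
    finally show ?case using Suc by (simp add: algebra_simps)
  qed (simp add: grid_mart_def p0)
  have var_nonneg: "0 \<le> grid_var p \<zeta> j \<omega>" if "j \<le> m" for j \<omega>
    unfolding grid_var_def using p that by (intro sum_nonneg mult_nonneg_nonneg) (auto intro: less_imp_le)
  have var: "V (p j) \<omega> = ennreal (grid_var p \<zeta> j \<omega>)" if "j \<le> m" for j \<omega>
    using that
  proof (induction j)
    case 0
    have "V r \<omega> = (\<integral>\<^sup>+s\<in>{r}. ennreal ((?\<phi> s \<omega> - c \<omega>)\<^sup>2) \<partial>lborel)" unfolding V_def by simp
    also have "\<dots> = (\<integral>\<^sup>+s\<in>{r}. ennreal ((?\<phi> r \<omega> - c \<omega>)\<^sup>2) \<partial>lborel)"
      by (intro nn_integral_cong) (auto simp: indicator_def)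
    also have "\<dots> = 0" by (simp add: nn_integral_cmult)
    finally show ?case by (simp add: p0 grid_var_def)
  next
    case (Suc j)
    then have j: "j < m" and rj: "r \<le> p j" using mono[of 0 j] p0 by auto
    have "V (p (Suc j)) \<omega> = (\<integral>\<^sup>+s. ennreal ((?\<phi> s \<omega> - c \<omega>)\<^sup>2) * indicator {r..p j} s
        + ennreal ((\<zeta> j \<omega>)\<^sup>2) * indicator {p j<..p (Suc j)} s \<partial>lborel)"
      unfolding V_def
    proof (intro nn_integral_cong)
      fix s
      show "ennreal ((?\<phi> s \<omega> - c \<omega>)\<^sup>2) * indicator {r..p (Suc j)} s = ennreal ((?\<phi> s \<omega> - c \<omega>)\<^sup>2) * indicator {r..p j} s
        + ennreal ((\<zeta> j \<omega>)\<^sup>2) * indicator {p j<..p (Suc j)} s"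
      proof (cases "s \<in> {p j<..p (Suc j)}")
        case True
        then have "?\<phi> s \<omega> = ?\<phi> (p (Suc j)) \<omega>"
          using gap[OF j] by (intro simple_process_const[of n \<tau> "p j"]) auto
        then show ?thesis using True rj by (simp add: \<zeta>_def)
      next
        case False
        then show ?thesis using p[OF j] by (auto simp: indicator_def)
      qed
    qed
    also have "\<dots> = V (p j) \<omega> + ennreal ((\<zeta> j \<omega>)\<^sup>2) * ennreal (p (Suc j) - p j)"
      unfolding V_def
    proof (subst nn_integral_add)
      show "(\<lambda>s. ennreal ((?\<phi> s \<omega> - c \<omega>)\<^sup>2) * indicator {r..p j} s) \<in> borel_measurable lborel"
        unfolding simple_process_def by measurable
    qed (use p[OF j] in \<open>simp_all add: nn_integral_cmult\<close>)
    also have "\<dots> = ennreal (grid_var p \<zeta> j \<omega> + (\<zeta> j \<omega>)\<^sup>2 * (p (Suc j) - p j))"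
      using Suc p[OF j] var_nonneg[of j \<omega>] by (simp add: ennreal_mult)
    finally show ?case by (simp add: grid_var_def)
  qed
  have "(\<integral>\<^sup>+\<omega>. (SUP q\<in>Q. if V q \<omega> \<le> ennreal K
            then ennreal ((I q \<omega> - I r \<omega> - c \<omega> * (B q \<omega> - B r \<omega>))\<^sup>2) else 0) \<partial>M)
      \<le> (\<integral>\<^sup>+\<omega>. (SUP j\<in>{..m}. if grid_var p \<zeta> j \<omega> \<le> K then ennreal ((grid_mart p \<zeta> j \<omega>)\<^sup>2) else 0) \<partial>M)"
  proof (intro nn_integral_mono SUP_least)
    fix \<omega> q assume "q \<in> Q"
    then have "q \<in> P" by (simp add: P_def)
    then obtain j where j: "j \<le> m" "q = p j" using P by auto
    show "(if V q \<omega> \<le> ennreal K then ennreal ((I q \<omega> - I r \<omega> - c \<omega> * (B q \<omega> - B r \<omega>))\<^sup>2) else 0)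
      \<le> (SUP j\<in>{..m}. if grid_var p \<zeta> j \<omega> \<le> K then ennreal ((grid_mart p \<zeta> j \<omega>)\<^sup>2) else 0)"
      by (rule SUP_upper2[of j]) (use j K in \<open>simp_all add: var mart ennreal_le_iff\<close>)
  qed
  also have "\<dots> \<le> 4 * (\<integral>\<^sup>+\<omega>. ennreal (min (grid_var p \<zeta> m \<omega>) K) \<partial>M)"
    by (rule grid_maximal[OF p0' p \<zeta>_m K])
  also have "(\<lambda>\<omega>. ennreal (min (grid_var p \<zeta> m \<omega>) K)) = (\<lambda>\<omega>. min (V T \<omega>) (ennreal K))"
    using var[of m] pm K by (auto simp: fun_eq_iff min_def ennreal_le_iff)
  finally show ?thesis .
qed

end

section \<open>The maximal inequality for the Ito integral\<close>

context filtered_prob_space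
begin

lemma sets_F_subset: "0 \<le> s \<Longrightarrow> A \<in> sets (F s) \<Longrightarrow> A \<subseteq> space M"
  using sets.sets_into_space[of A "F s"] by (simp add: space_F)

lemma predictable_generator:
  "{{0} \<times> A |A. A \<in> sets (F 0)} \<union> {{s<..t} \<times> A |s t A. 0 \<le> s \<and> s \<le> t \<and> A \<in> sets (F s)}
     \<subseteq> Pow ({0..} \<times> space M)"
proof
  fix Y assume "Y \<in> {{0} \<times> A |A. A \<in> sets (F 0)} \<union>
     {{s<..t} \<times> A |s t A. 0 \<le> s \<and> s \<le> t \<and> A \<in> sets (F s)}"
  then consider A where "Y = {0} \<times> A" "A \<in> sets (F 0)"
    | s t A where "Y = {s<..t} \<times> A" "0 \<le> s" "s \<le> t" "A \<in> sets (F s)" by blast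
  then show "Y \<in> Pow ({0..} \<times> space M)"
  proof cases
    case (1 A)
    then show ?thesis using sets_F_subset[of 0 A] by auto
  next
    case (2 s t A)
    then show ?thesis using sets_F_subset[of s A] by auto
  qed
qed

text \<open>On a generator the section at \<open>r\<close> is empty or a set of \<open>F s\<close>
  with \<open>s \<le> r\<close>. Consequently the coefficient at time \<open>r\<close> belongs to
  the past of \<open>r\<close>, and it can be frozen there.\<close>

lemma predictable_section:
  assumes f: "f \<in> borel_measurable (predictable_algebra M F)" and r: "0 \<le> r"
  shows "(\<lambda>\<omega>. f (r, \<omega>)) \<in> borel_measurable (F r)"
proof -
  have "(\<lambda>\<omega>. (r, \<omega>)) \<in> measurable (F r) (predictable_algebra M F)"
    unfolding predictable_algebra_def
  proof (rule measurable_measure_of)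
    show "{{0} \<times> A |A. A \<in> sets (F 0)} \<union> {{s<..t} \<times> A |s t A. 0 \<le> s \<and> s \<le> t \<and> A \<in> sets (F s)}
      \<subseteq> Pow ({0..} \<times> space M)"
      by (rule predictable_generator)
    show "(\<lambda>\<omega>. (r, \<omega>)) \<in> space (F r) \<rightarrow> {0..} \<times> space M" using r space_F by auto
    fix Y assume "Y \<in> {{0} \<times> A |A. A \<in> sets (F 0)} \<union>
       {{s<..t} \<times> A |s t A. 0 \<le> s \<and> s \<le> t \<and> A \<in> sets (F s)}"
    then consider A where "Y = {0} \<times> A" "A \<in> sets (F 0)"
      | s t A where "Y = {s<..t} \<times> A" "0 \<le> s" "s \<le> t" "A \<in> sets (F s)" by blast
    then show "(\<lambda>\<omega>. (r, \<omega>)) -` Y \<inter> space (F r) \<in> sets (F r)"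
    proof cases
      case (1 A)
      show ?thesis
      proof (cases "r = 0")
        case True
        then have "(\<lambda>\<omega>. (r, \<omega>)) -` Y \<inter> space (F r) = A \<inter> space (F r)" using 1 by auto
        then show ?thesis using 1 True by simp
      next
        case False
        then have "(\<lambda>\<omega>. (r, \<omega>)) -` Y \<inter> space (F r) = {}" using 1 by auto
        then show ?thesis by simp
      qed
    next
      case (2 s t A)
      show ?thesis
      proof (cases "r \<in> {s<..t}")
        case True
        then have "A \<in> sets (F r)" using mono_F[of s r] 2 by auto
        moreover have "(\<lambda>\<omega>. (r, \<omega>)) -` Y \<inter> space (F r) = A \<inter> space (F r)" using 2 True by auto
        ultimately show ?thesis by simp
      next
        case False
        then have "(\<lambda>\<omega>. (r, \<omega>)) -` Y \<inter> space (F r) = {}" using 2 by auto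
        then show ?thesis by simp
      qed
    qed
  qed
  from measurable_compose[OF this f] show ?thesis .
qed

text \<open>The predictable algebra lives on nonnegative times and nothing is known at negative
  ones. Extension by 0 gives a function on the full product, to which Fubini over
  \<open>lborel\<close> applies.\<close>

lemma predictable_joint:
  fixes f :: "real \<times> 'a \<Rightarrow> real"
  assumes f: "f \<in> borel_measurable (predictable_algebra M F)"
  shows "(\<lambda>(s, \<omega>). indicator {0..} s * f (s, \<omega>)) \<in> borel_measurable (borel \<Otimes>\<^sub>M M)"
proof -
  let ?\<Omega> = "{0..} \<times> space M :: (real \<times> 'a) set"
  have \<Omega>: "?\<Omega> \<in> sets (borel \<Otimes>\<^sub>M M)" by simp
  have sF: "A \<in> sets M" if "A \<in> sets (F s)" "0 \<le> s" for s A
    using subalgebra_F[of s] that by (auto simp: subalgebra_def)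
  have "(\<lambda>x. x) \<in> measurable (restrict_space (borel \<Otimes>\<^sub>M M) ?\<Omega>) (predictable_algebra M F)"
    unfolding predictable_algebra_def
  proof (rule measurable_measure_of)
    show "{{0} \<times> A |A. A \<in> sets (F 0)} \<union> {{s<..t} \<times> A |s t A. 0 \<le> s \<and> s \<le> t \<and> A \<in> sets (F s)}
      \<subseteq> Pow ({0..} \<times> space M)"
      by (rule predictable_generator)
    show "(\<lambda>x. x) \<in> space (restrict_space (borel \<Otimes>\<^sub>M M) ?\<Omega>) \<rightarrow> {0..} \<times> space M"
      by (auto simp: space_restrict_space)
    fix Y assume "Y \<in> {{0} \<times> A |A. A \<in> sets (F 0)} \<union>
       {{s<..t} \<times> A |s t A. 0 \<le> s \<and> s \<le> t \<and> A \<in> sets (F s)}"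
    then consider A where "Y = {0} \<times> A" "A \<in> sets (F 0)"
      | s t A where "Y = {s<..t} \<times> A" "0 \<le> s" "s \<le> t" "A \<in> sets (F s)" by blast
    then have "Y \<in> sets (borel \<Otimes>\<^sub>M M)" using sF by cases auto
    then show "(\<lambda>x. x) -` Y \<inter> space (restrict_space (borel \<Otimes>\<^sub>M M) ?\<Omega>) \<in> sets (restrict_space (borel \<Otimes>\<^sub>M M) ?\<Omega>)"
      using \<Omega> by (auto simp: space_restrict_space sets_restrict_space_iff)
  qed
  from measurable_compose[OF this f]
  have "(\<lambda>x. indicator ?\<Omega> x *\<^sub>R f x) \<in> borel_measurable (borel \<Otimes>\<^sub>M M)"
    using \<Omega> by (subst borel_measurable_restrict_space_iff[symmetric]) auto
  then show ?thesis
    by (rule measurable_cong[THEN iffD1, rotated]) (auto simp: space_pair_measure indicator_def)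
qed

text \<open>Truncation at 1 turns convergence in probability into convergence in L1.\<close>

lemma nn_integral_min_tendsto_0:
  fixes Y :: "nat \<Rightarrow> 'a \<Rightarrow> ennreal"
  assumes [measurable]: "\<And>k. Y k \<in> borel_measurable M"
    and Y: "\<And>\<epsilon>. 0 < \<epsilon> \<Longrightarrow> (\<lambda>k. measure M {\<omega>\<in>space M. ennreal \<epsilon> < Y k \<omega>}) \<longlonglongrightarrow> 0"
  shows "(\<lambda>k. \<integral>\<^sup>+\<omega>. min 1 (Y k \<omega>) \<partial>M) \<longlonglongrightarrow> 0"
proof (rule tendsto_zero_ennreal)
  fix e :: real assume e: "0 < e"
  have "eventually (\<lambda>k. measure M {\<omega>\<in>space M. ennreal (e/2) < Y k \<omega>} < e/2) sequentially"
    using order_tendstoD(2)[OF Y[of "e/2"], of "e/2"] e by simp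
  then show "eventually (\<lambda>k. (\<integral>\<^sup>+\<omega>. min 1 (Y k \<omega>) \<partial>M) < ennreal e) sequentially"
  proof eventually_elim
    case (elim k)
    have "(\<integral>\<^sup>+\<omega>. min 1 (Y k \<omega>) \<partial>M)
      \<le> (\<integral>\<^sup>+\<omega>. ennreal (e/2) + indicator {\<omega>\<in>space M. ennreal (e/2) < Y k \<omega>} \<omega> \<partial>M)"
    proof (intro nn_integral_mono)
      fix \<omega> assume "\<omega> \<in> space M"
      then show "min 1 (Y k \<omega>) \<le> ennreal (e/2) + indicator {\<omega>\<in>space M. ennreal (e/2) < Y k \<omega>} \<omega>"
        by (cases "ennreal (e/2) < Y k \<omega>") (auto intro: min.coboundedI1 min.coboundedI2 add_increasing)
    qed
    also have "\<dots> = ennreal (e/2) + emeasure M {\<omega>\<in>space M. ennreal (e/2) < Y k \<omega>}"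
      by (subst nn_integral_add) (auto simp: emeasure_space_1)
    also have "\<dots> = ennreal (e/2 + measure M {\<omega>\<in>space M. ennreal (e/2) < Y k \<omega>})"
      using e by (simp add: emeasure_eq_measure)
    also have "\<dots> < ennreal e" using elim e by (intro ennreal_lessI) auto
    finally show ?case .
  qed
qed

text \<open>The truncated variables are summed over the finite set \<open>J\<close>, and the sum
  tends to 0 in L1; a subsequence on which it tends to 0 almost surely serves all indices at
  once.\<close>

lemma AE_subseq_tendsto_0:
  fixes Y :: "nat \<Rightarrow> 'i \<Rightarrow> 'a \<Rightarrow> ennreal"
  assumes J: "finite J" and [measurable]: "\<And>k i. i \<in> J \<Longrightarrow> Y k i \<in> borel_measurable M"
    and Y: "\<And>i \<epsilon>. i \<in> J \<Longrightarrow> 0 < \<epsilon> \<Longrightarrow> (\<lambda>k. measure M {\<omega>\<in>space M. ennreal \<epsilon> < Y k i \<omega>}) \<longlonglongrightarrow> 0"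
  shows "\<exists>\<rho>. strict_mono \<rho> \<and> (AE \<omega> in M. \<forall>i\<in>J. (\<lambda>k. Y (\<rho> k) i \<omega>) \<longlonglongrightarrow> 0)"
proof -
  let ?u = "\<lambda>k \<omega>. \<Sum>i\<in>J. enn2real (min 1 (Y k i \<omega>))"
  have int: "integrable M (\<lambda>\<omega>. enn2real (min 1 (Y k i \<omega>)))" if "i \<in> J" for k i
  proof (rule integrable_const_bound[where B=1])
    show "AE \<omega> in M. norm (enn2real (min 1 (Y k i \<omega>))) \<le> 1"
      using enn2real_mono[of "min 1 (Y k i _)" 1] by auto
  qed (use that in measurable)
  have "(\<lambda>k. \<integral>\<omega>. enn2real (min 1 (Y k i \<omega>)) \<partial>M) \<longlonglongrightarrow> 0" if "i \<in> J" for i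
  proof -
    have "(\<lambda>k. \<integral>\<^sup>+\<omega>. min 1 (Y k i \<omega>) \<partial>M) \<longlonglongrightarrow> ennreal 0"
      using nn_integral_min_tendsto_0[of "\<lambda>k. Y k i"] assms(2)[OF that] Y[OF that] by simp
    then have "(\<lambda>k. enn2real (\<integral>\<^sup>+\<omega>. min 1 (Y k i \<omega>) \<partial>M)) \<longlonglongrightarrow> 0"
      by (rule tendsto_enn2real) simp
    moreover have "enn2real (\<integral>\<^sup>+\<omega>. min 1 (Y k i \<omega>) \<partial>M) = (\<integral>\<omega>. enn2real (min 1 (Y k i \<omega>)) \<partial>M)" for k
    proof -
      have "(\<integral>\<^sup>+\<omega>. min 1 (Y k i \<omega>) \<partial>M) = (\<integral>\<^sup>+\<omega>. ennreal (enn2real (min 1 (Y k i \<omega>))) \<partial>M)"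
        by (intro nn_integral_cong) (auto simp: ennreal_enn2real_if min_def top_unique)
      also have "\<dots> = ennreal (\<integral>\<omega>. enn2real (min 1 (Y k i \<omega>)) \<partial>M)"
        by (intro nn_integral_eq_integral int that) auto
      finally show ?thesis by (simp add: integral_nonneg_AE)
    qed
    ultimately show ?thesis by simp
  qed
  then have "(\<lambda>k. \<Sum>i\<in>J. \<integral>\<omega>. enn2real (min 1 (Y k i \<omega>)) \<partial>M) \<longlonglongrightarrow> (\<Sum>i\<in>J. 0)"
    by (intro tendsto_sum) auto
  then have "(\<lambda>k. \<integral>\<omega>. norm (?u k \<omega>) \<partial>M) \<longlonglongrightarrow> 0"
    using int by (simp add: sum_nonneg abs_of_nonneg)
  then obtain \<rho> :: "nat \<Rightarrow> nat" where \<rho>: "strict_mono \<rho>" "AE \<omega> in M. (\<lambda>k. ?u (\<rho> k) \<omega>) \<longlonglongrightarrow> 0"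
    using tendsto_L1_AE_subseq[of M ?u] int by auto
  from \<rho>(2) have "AE \<omega> in M. \<forall>i\<in>J. (\<lambda>k. Y (\<rho> k) i \<omega>) \<longlonglongrightarrow> 0"
  proof (eventually_elim, intro ballI)
    fix \<omega> i assume u: "(\<lambda>k. ?u (\<rho> k) \<omega>) \<longlonglongrightarrow> 0" and i: "i \<in> J"
    have "(\<lambda>k. enn2real (min 1 (Y (\<rho> k) i \<omega>))) \<longlonglongrightarrow> 0"
      by (rule tendsto_sandwich[OF _ _ tendsto_const u])
         (use i J in \<open>auto intro!: always_eventually member_le_sum\<close>)
    moreover have "ennreal (enn2real (min 1 y)) = min 1 y" for y
      by (rule ennreal_enn2real) (simp add: min_less_iff_disj)
    ultimately have m: "(\<lambda>k. min 1 (Y (\<rho> k) i \<omega>)) \<longlonglongrightarrow> 0"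
      using tendsto_ennrealI[of "\<lambda>k. enn2real (min 1 (Y (\<rho> k) i \<omega>))" 0 sequentially] by simp
    then have "eventually (\<lambda>k. min 1 (Y (\<rho> k) i \<omega>) < 1) sequentially"
      by (rule order_tendstoD) simp
    then have "eventually (\<lambda>k. min 1 (Y (\<rho> k) i \<omega>) = Y (\<rho> k) i \<omega>) sequentially"
      by eventually_elim (auto simp: min_def)
    with m show "(\<lambda>k. Y (\<rho> k) i \<omega>) \<longlonglongrightarrow> 0"
      by (rule Lim_transform_eventually)
  qed
  with \<rho>(1) show ?thesis by blast
qed

end

lemma ennreal_sq_add_le: "ennreal ((a + b)\<^sup>2) \<le> 2 * ennreal (a\<^sup>2) + 2 * ennreal (b\<^sup>2)"
proof -
  have "0 \<le> (a - b)\<^sup>2" by simp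
  then have "(a + b)\<^sup>2 \<le> 2 * a\<^sup>2 + 2 * b\<^sup>2" by (simp add: power2_eq_square algebra_simps)
  then have "ennreal ((a + b)\<^sup>2) \<le> ennreal (2 * a\<^sup>2 + 2 * b\<^sup>2)" by (rule ennreal_leI)
  also have "\<dots> = 2 * ennreal (a\<^sup>2) + 2 * ennreal (b\<^sup>2)"
    by (simp add: ennreal_mult')
  finally show ?thesis .
qed

text \<open>Truncation is subadditive. The doubled level belongs to the factors 2 that arise when a
  square of a sum is split.\<close>

lemma min_add_double_le:
  fixes V d K :: ennreal
  shows "min (2 * V + 2 * d) (2 * K) \<le> 2 * min V K + 2 * min d K"
proof -
  have "min (V + d) K \<le> min V K + min d K"
  proof (cases "V \<le> K \<and> d \<le> K")
    case False
    then have "K \<le> min V K + min d K" by (auto simp: min_def intro: add_increasing add_increasing2)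
    then show ?thesis by (rule order_trans[OF min.cobounded2])
  qed (auto simp: min_def)
  then have "2 * min (V + d) K \<le> 2 * (min V K + min d K)" by (rule mult_left_mono) simp
  moreover have "min (2 * V + 2 * d) (2 * K) \<le> 2 * min (V + d) K"
    by (auto simp: min_def distrib_left)
  ultimately show ?thesis by (simp add: distrib_left)
qed

lemma tendsto_add_cmult_zero_ennreal:
  fixes a c :: ennreal
  assumes "(x \<longlongrightarrow> 0) G" "c < \<top>"
  shows "((\<lambda>k. a + c * x k) \<longlongrightarrow> a) G"
proof -
  have "((\<lambda>k. a + c * x k) \<longlongrightarrow> a + c * 0) G"
    using assms by (intro tendsto_add tendsto_const ennreal_tendsto_cmult)
  then show ?thesis by simp
qed

lemma tendsto_of_ennreal_abs_diff:
  assumes "((\<lambda>k. ennreal \<bar>x k - a\<bar>) \<longlongrightarrow> 0) G"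
  shows "(x \<longlongrightarrow> a) G"
proof -
  have "((\<lambda>k. ennreal \<bar>x k - a\<bar>) \<longlongrightarrow> ennreal 0) G" using assms by simp
  then have "((\<lambda>k. enn2real (ennreal \<bar>x k - a\<bar>)) \<longlongrightarrow> 0) G"
    by (rule tendsto_enn2real) simp
  then have "((\<lambda>k. x k - a) \<longlongrightarrow> 0) G" by (simp add: tendsto_rabs_zero_iff)
  then show ?thesis by (simp add: LIM_zero_iff)
qed

context brownian_motion
begin

text \<open>The constant \<open>8\<close> is twice that for simple processes, because of
  \<open>\<integral>(\<phi>\<^sup>k - c)\<^sup>2 \<le> 2 \<integral>(\<phi> - c)\<^sup>2 + 2 \<integral>(\<phi>\<^sup>k - \<phi>)\<^sup>2\<close>.\<close>

lemma ito_maximal_finite: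
  assumes ito: "is_ito_integral M F B \<phi> I" and r: "0 \<le> r" "r < T"
    and c: "c \<in> borel_measurable (F r)" and Q: "finite Q" "Q \<subseteq> {r..T}" and K: "0 \<le> K"
  defines "V \<equiv> \<lambda>u \<omega>. \<integral>\<^sup>+s\<in>{r..u}. ennreal ((\<phi> s \<omega> - c \<omega>)\<^sup>2) \<partial>lborel"
  shows "(\<integral>\<^sup>+\<omega>. (SUP q\<in>Q. if V q \<omega> < ennreal K
            then ennreal ((I q \<omega> - I r \<omega> - c \<omega> * (B q \<omega> - B r \<omega>))\<^sup>2) else 0) \<partial>M)
     \<le> 8 * (\<integral>\<^sup>+\<omega>. min (V T \<omega>) (ennreal K) \<partial>M)"
proof -
  have "\<exists>n \<tau> \<xi>.
        (\<forall>k::nat. simple_integrand M F (n k) (\<tau> k) (\<xi> k)) \<and>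
        (\<forall>T\<ge>0. \<forall>\<epsilon>>0. (\<lambda>k. measure M {\<omega>\<in>space M.
            ennreal \<epsilon> < (\<integral>\<^sup>+s\<in>{0..T}. ennreal ((simple_process (n k) (\<tau> k) (\<xi> k) s \<omega> - \<phi> s \<omega>)\<^sup>2) \<partial>lborel)})
          \<longlonglongrightarrow> 0) \<and>
        (\<forall>t\<ge>0. \<forall>\<epsilon>>0. (\<lambda>k. measure M {\<omega>\<in>space M.
            \<epsilon> < \<bar>simple_ito_integral B (n k) (\<tau> k) (\<xi> k) t \<omega> - I t \<omega>\<bar>})
          \<longlonglongrightarrow> 0)"
    using ito unfolding is_ito_integral_def by (elim conjE)
  then obtain n \<tau> \<xi> where si': "\<forall>k::nat. simple_integrand M F (n k) (\<tau> k) (\<xi> k)"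
    and conv: "\<forall>T\<ge>0. \<forall>\<epsilon>>0. (\<lambda>k. measure M {\<omega>\<in>space M.
            ennreal \<epsilon> < (\<integral>\<^sup>+s\<in>{0..T}. ennreal ((simple_process (n k) (\<tau> k) (\<xi> k) s \<omega> - \<phi> s \<omega>)\<^sup>2) \<partial>lborel)})
          \<longlonglongrightarrow> 0"
    "\<forall>t\<ge>0. \<forall>\<epsilon>>0. (\<lambda>k. measure M {\<omega>\<in>space M.
            \<epsilon> < \<bar>simple_ito_integral B (n k) (\<tau> k) (\<xi> k) t \<omega> - I t \<omega>\<bar>}) \<longlonglongrightarrow> 0"
    by (elim exE conjE) (rule that)
  note si = si'[rule_format] and conv_\<phi> = conv(1)[rule_format] and conv_I = conv(2)[rule_format]
  have pred: "(\<lambda>(t, \<omega>). \<phi> t \<omega>) \<in> borel_measurable (predictable_algebra M F)"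
    using ito by (simp add: is_ito_integral_def predictable_def)
  have I_m [measurable]: "I t \<in> borel_measurable M" if "0 \<le> t" for t
    using ito that by (simp add: is_ito_integral_def)
  let ?P = "\<lambda>k. simple_process (n k) (\<tau> k) (\<xi> k)"
  let ?I = "\<lambda>k. simple_ito_integral B (n k) (\<tau> k) (\<xi> k)"
  let ?\<phi> = "\<lambda>s \<omega>. indicator {0..} s * \<phi> s \<omega>"
  have [measurable]: "(\<lambda>(s, \<omega>). ?\<phi> s \<omega>) \<in> borel_measurable (borel \<Otimes>\<^sub>M M)"
    using predictable_joint[OF pred] by (simp add: split_beta')
  have [measurable]: "c \<in> borel_measurable M" by (rule measurable_F_imp[OF r(1) c])
  have \<tau>_nonneg: "0 \<le> \<tau> k i" if "i \<le> n k" for k i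
    using that by (induction i) (use si[of k] in \<open>auto simp: simple_integrand_def intro: order_trans\<close>)
  have \<xi>_m [measurable]: "\<xi> k i \<in> borel_measurable M" if "i < n k" for k i
    using si[of k] that \<tau>_nonneg[of i k] measurable_F_imp[of "\<tau> k i" "\<xi> k i" borel]
    by (simp add: simple_integrand_def)
  have P_m [measurable]: "(\<lambda>(s, \<omega>). ?P k s \<omega>) \<in> borel_measurable (borel \<Otimes>\<^sub>M M)" for k
    unfolding simple_process_def split_beta'
  proof (intro borel_measurable_sum)
    fix i assume "i \<in> {..<n k}"
    then have [measurable]: "\<xi> k i \<in> borel_measurable M" by (intro \<xi>_m) simp
    show "(\<lambda>p. \<xi> k i (snd p) * indicator {\<tau> k i<..\<tau> k (Suc i)} (fst p)) \<in> borel_measurable (borel \<Otimes>\<^sub>M M)"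
      by measurable
  qed
  have SI_m: "?I k t \<in> borel_measurable M" if "0 \<le> t" for k t
    unfolding simple_ito_integral_def
  proof (intro borel_measurable_sum borel_measurable_times borel_measurable_diff)
    fix i assume "i \<in> {..<n k}"
    then have "i < n k" "0 \<le> \<tau> k i" "0 \<le> \<tau> k (Suc i)" using \<tau>_nonneg by auto
    then show "\<xi> k i \<in> borel_measurable M" "B (min (\<tau> k (Suc i)) t) \<in> borel_measurable M"
       "B (min (\<tau> k i) t) \<in> borel_measurable M"
      using that by (auto intro!: B_rv \<xi>_m)
  qed
  define \<delta> where "\<delta> k \<omega> = (\<integral>\<^sup>+s\<in>{0..T}. ennreal ((?P k s \<omega> - \<phi> s \<omega>)\<^sup>2) \<partial>lborel)" for k \<omega>
  have \<delta>_m [measurable]: "\<delta> k \<in> borel_measurable M" for k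
  proof -
    have "\<delta> k = (\<lambda>\<omega>. \<integral>\<^sup>+s\<in>{0..T}. ennreal ((?P k s \<omega> - ?\<phi> s \<omega>)\<^sup>2) \<partial>lborel)"
      unfolding \<delta>_def by (intro ext nn_integral_cong) (auto simp: indicator_def)
    also have "\<dots> \<in> borel_measurable M" by measurable
    finally show ?thesis .
  qed
  have V_m [measurable]: "V u \<in> borel_measurable M" for u
  proof -
    have "V u = (\<lambda>\<omega>. \<integral>\<^sup>+s\<in>{r..u}. ennreal ((?\<phi> s \<omega> - c \<omega>)\<^sup>2) \<partial>lborel)"
      unfolding V_def using r by (intro ext nn_integral_cong) (auto simp: indicator_def)
    also have "\<dots> \<in> borel_measurable M" by measurable
    finally show ?thesis .
  qed
  define W where "W k u \<omega> = (\<integral>\<^sup>+s\<in>{r..u}. ennreal ((?P k s \<omega> - c \<omega>)\<^sup>2) \<partial>lborel)" for k u \<omega>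
  have W_m [measurable]: "W k u \<in> borel_measurable M" for k u
    unfolding W_def by measurable
  have W_le: "W k u \<omega> \<le> 2 * V u \<omega> + 2 * \<delta> k \<omega>" if "u \<le> T" "\<omega> \<in> space M" for k u \<omega>
  proof -
    have [measurable]: "(\<lambda>s. ?P k s \<omega>) \<in> borel_measurable borel" "(\<lambda>s. ?\<phi> s \<omega>) \<in> borel_measurable borel"
      using that(2) by measurable
    have "W k u \<omega> \<le> (\<integral>\<^sup>+s. 2 * (ennreal ((?\<phi> s \<omega> - c \<omega>)\<^sup>2) * indicator {r..u} s)
        + 2 * (ennreal ((?P k s \<omega> - ?\<phi> s \<omega>)\<^sup>2) * indicator {0..T} s) \<partial>lborel)"
      unfolding W_def
    proof (intro nn_integral_mono)
      fix s
      show "ennreal ((?P k s \<omega> - c \<omega>)\<^sup>2) * indicator {r..u} s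
        \<le> 2 * (ennreal ((?\<phi> s \<omega> - c \<omega>)\<^sup>2) * indicator {r..u} s)
        + 2 * (ennreal ((?P k s \<omega> - ?\<phi> s \<omega>)\<^sup>2) * indicator {0..T} s)"
        using ennreal_sq_add_le[of "?\<phi> s \<omega> - c \<omega>" "?P k s \<omega> - ?\<phi> s \<omega>"] that(1) r(1)
        by (cases "s \<in> {r..u}") auto
    qed
    also have "\<dots> = 2 * (\<integral>\<^sup>+s. ennreal ((?\<phi> s \<omega> - c \<omega>)\<^sup>2) * indicator {r..u} s \<partial>lborel)
        + 2 * (\<integral>\<^sup>+s. ennreal ((?P k s \<omega> - ?\<phi> s \<omega>)\<^sup>2) * indicator {0..T} s \<partial>lborel)"
      by (simp add: nn_integral_add nn_integral_cmult)
    also have "(\<integral>\<^sup>+s. ennreal ((?\<phi> s \<omega> - c \<omega>)\<^sup>2) * indicator {r..u} s \<partial>lborel) = V u \<omega>"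
      unfolding V_def using r by (intro nn_integral_cong) (auto simp: indicator_def)
    also have "(\<integral>\<^sup>+s. ennreal ((?P k s \<omega> - ?\<phi> s \<omega>)\<^sup>2) * indicator {0..T} s \<partial>lborel) = \<delta> k \<omega>"
      unfolding \<delta>_def by (intro nn_integral_cong) (auto simp: indicator_def)
    finally show ?thesis .
  qed
  \<comment> \<open>The index \<open>None\<close> carries the L2 distance of the integrands,
    \<open>Some q\<close> the distance of the integrals at time \<open>q\<close>, so that one
    subsequence makes all of them converge.\<close>
  let ?Y = "\<lambda>k i \<omega>. case i of None \<Rightarrow> \<delta> k \<omega> | Some q \<Rightarrow> ennreal \<bar>?I k q \<omega> - I q \<omega>\<bar>"
  let ?J = "insert None (Some ` insert r Q)"
  have Q0: "0 \<le> q" if "q \<in> insert r Q" for q using Q r that by auto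
  have "\<exists>\<rho>. strict_mono \<rho> \<and> (AE \<omega> in M. \<forall>i\<in>?J. (\<lambda>k. ?Y (\<rho> k) i \<omega>) \<longlonglongrightarrow> 0)"
  proof (rule AE_subseq_tendsto_0)
    show "finite ?J" using Q by simp
    show "?Y k i \<in> borel_measurable M" if "i \<in> ?J" for k i
      using that Q0 SI_m I_m by auto
    show "(\<lambda>k. measure M {\<omega>\<in>space M. ennreal \<epsilon> < ?Y k i \<omega>}) \<longlonglongrightarrow> 0" if "i \<in> ?J" "0 < \<epsilon>" for i \<epsilon>
    proof (cases i)
      case None
      then show ?thesis using conv_\<phi>[of T \<epsilon>] r that by (simp add: \<delta>_def)
    next
      case (Some q)
      then have "q \<in> insert r Q" using that(1) by auto
      then show ?thesis using conv_I[of q \<epsilon>] Q0[of q] that Some by (simp add: ennreal_less_iff)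
    qed
  qed
  then obtain \<rho> where \<rho>: "strict_mono \<rho>" and AE: "AE \<omega> in M. \<forall>i\<in>?J. (\<lambda>k. ?Y (\<rho> k) i \<omega>) \<longlonglongrightarrow> 0"
    by blast
  let ?Z = "\<lambda>q \<omega>. I q \<omega> - I r \<omega> - c \<omega> * (B q \<omega> - B r \<omega>)"
  let ?Zk = "\<lambda>k q \<omega>. ?I (\<rho> k) q \<omega> - ?I (\<rho> k) r \<omega> - c \<omega> * (B q \<omega> - B r \<omega>)"
  \<comment> \<open>The level is \<open>2 * K\<close> with \<open>\<le>\<close> for the
    approximations and \<open>K\<close> with \<open><\<close> for the limit. If
    \<open>V q \<omega> = v < K\<close>, the variation of the approximation is at most
    \<open>2 * v + 2 * \<delta>\<close>, which is below \<open>2 * K\<close> once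
    \<open>\<delta>\<close> is smaller than the gap \<open>K - v\<close>.\<close>
  let ?f = "\<lambda>k q \<omega>. if W (\<rho> k) q \<omega> \<le> ennreal (2 * K) then ennreal ((?Zk k q \<omega>)\<^sup>2) else 0"
  have f_m: "(\<lambda>\<omega>. SUP q\<in>Q. ?f k q \<omega>) \<in> borel_measurable M" for k
  proof (intro borel_measurable_SUP)
    show "countable Q" using Q by (simp add: countable_finite)
    fix q assume "q \<in> Q"
    then have [measurable]: "?I (\<rho> k) q \<in> borel_measurable M" "?I (\<rho> k) r \<in> borel_measurable M"
        "B q \<in> borel_measurable M" "B r \<in> borel_measurable M"
      using Q0 r by (auto intro!: SI_m B_rv)
    show "?f k q \<in> borel_measurable M" by measurable
  qed
  have "(\<integral>\<^sup>+\<omega>. (SUP q\<in>Q. if V q \<omega> < ennreal K then ennreal ((?Z q \<omega>)\<^sup>2) else 0) \<partial>M)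
    \<le> (\<integral>\<^sup>+\<omega>. liminf (\<lambda>k. SUP q\<in>Q. ?f k q \<omega>) \<partial>M)"
  proof (rule nn_integral_mono_AE)
    from AE show "AE \<omega> in M. (SUP q\<in>Q. if V q \<omega> < ennreal K then ennreal ((?Z q \<omega>)\<^sup>2) else 0)
      \<le> liminf (\<lambda>k. SUP q\<in>Q. ?f k q \<omega>)"
    proof (rule AE_mp, intro AE_I2 impI SUP_least)
      fix \<omega> q assume \<omega>: "\<omega> \<in> space M" and lim: "\<forall>i\<in>?J. (\<lambda>k. ?Y (\<rho> k) i \<omega>) \<longlonglongrightarrow> 0" and q: "q \<in> Q"
      have lim_\<delta>: "(\<lambda>k. \<delta> (\<rho> k) \<omega>) \<longlonglongrightarrow> 0" using lim by simp
      have lim_I: "(\<lambda>k. ?I (\<rho> k) u \<omega>) \<longlonglongrightarrow> I u \<omega>" if "u \<in> insert r Q" for u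
        using lim that by (intro tendsto_of_ennreal_abs_diff) auto
      show "(if V q \<omega> < ennreal K then ennreal ((?Z q \<omega>)\<^sup>2) else 0) \<le> liminf (\<lambda>k. SUP q\<in>Q. ?f k q \<omega>)"
      proof (cases "V q \<omega> < ennreal K")
        case True
        obtain v where v: "V q \<omega> = ennreal v" "0 \<le> v" "v < K"
          using True by (cases "V q \<omega>") (auto simp: ennreal_less_iff)
        have "eventually (\<lambda>k. \<delta> (\<rho> k) \<omega> < ennreal (K - v)) sequentially"
          using v by (intro order_tendstoD(2)[OF lim_\<delta>]) simp
        then have ev: "eventually (\<lambda>k. W (\<rho> k) q \<omega> \<le> ennreal (2 * K)) sequentially"
        proof eventually_elim
          case (elim k)
          have "W (\<rho> k) q \<omega> \<le> 2 * V q \<omega> + 2 * \<delta> (\<rho> k) \<omega>"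
            by (rule W_le) (use q Q \<omega> in auto)
          also have "\<dots> \<le> 2 * ennreal v + 2 * ennreal (K - v)"
            unfolding v(1) using elim by (intro add_left_mono mult_left_mono) auto
          also have "\<dots> = ennreal (2 * v + 2 * (K - v))"
            using v ennreal_mult'[of 2 v] ennreal_mult'[of 2 "K - v"] by (subst ennreal_plus) auto
          finally show ?case by simp
        qed
        have lim_q: "(\<lambda>k. ?I (\<rho> k) q \<omega>) \<longlonglongrightarrow> I q \<omega>" and lim_r: "(\<lambda>k. ?I (\<rho> k) r \<omega>) \<longlonglongrightarrow> I r \<omega>"
          using lim_I q by blast+
        have "(\<lambda>k. ennreal ((?Zk k q \<omega>)\<^sup>2)) \<longlonglongrightarrow> ennreal ((?Z q \<omega>)\<^sup>2)"
          by (rule tendsto_ennrealI[OF tendsto_power[OF tendsto_diff[OF tendsto_diff[OF lim_q lim_r] tendsto_const]]])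
        moreover have "eventually (\<lambda>k. ennreal ((?Zk k q \<omega>)\<^sup>2) = ?f k q \<omega>) sequentially"
          using ev by eventually_elim (simp only: if_True)
        ultimately have "(\<lambda>k. ?f k q \<omega>) \<longlonglongrightarrow> ennreal ((?Z q \<omega>)\<^sup>2)"
          by (rule Lim_transform_eventually)
        then have "ennreal ((?Z q \<omega>)\<^sup>2) = liminf (\<lambda>k. ?f k q \<omega>)"
          by (rule lim_imp_Liminf[OF sequentially_bot, symmetric])
        also have "\<dots> \<le> liminf (\<lambda>k. SUP q\<in>Q. ?f k q \<omega>)"
          by (intro Liminf_mono always_eventually allI SUP_upper q)
        finally show ?thesis using True by simp
      qed simp
    qed
  qed
  also have "\<dots> \<le> liminf (\<lambda>k. \<integral>\<^sup>+\<omega>. (SUP q\<in>Q. ?f k q \<omega>) \<partial>M)"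
    by (rule nn_integral_liminf[OF f_m])
  also have "\<dots> \<le> liminf (\<lambda>k. 8 * (\<integral>\<^sup>+\<omega>. min (V T \<omega>) (ennreal K) \<partial>M) + 8 * (\<integral>\<^sup>+\<omega>. min (\<delta> (\<rho> k) \<omega>) (ennreal K) \<partial>M))"
  proof (intro Liminf_mono always_eventually allI)
    fix k
    have "(\<integral>\<^sup>+\<omega>. (SUP q\<in>Q. ?f k q \<omega>) \<partial>M) \<le> 4 * (\<integral>\<^sup>+\<omega>. min (W (\<rho> k) T \<omega>) (ennreal (2 * K)) \<partial>M)"
      unfolding W_def using K by (intro simple_maximal[OF si r c Q]) simp
    also have "\<dots> \<le> 4 * (\<integral>\<^sup>+\<omega>. 2 * min (V T \<omega>) (ennreal K) + 2 * min (\<delta> (\<rho> k) \<omega>) (ennreal K) \<partial>M)"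
    proof (intro mult_left_mono nn_integral_mono)
      fix \<omega> assume "\<omega> \<in> space M"
      then have "min (W (\<rho> k) T \<omega>) (ennreal (2 * K)) \<le> min (2 * V T \<omega> + 2 * \<delta> (\<rho> k) \<omega>) (2 * ennreal K)"
        using K by (intro min.mono W_le) (auto simp: ennreal_mult')
      then show "min (W (\<rho> k) T \<omega>) (ennreal (2 * K)) \<le> 2 * min (V T \<omega>) (ennreal K) + 2 * min (\<delta> (\<rho> k) \<omega>) (ennreal K)"
        by (rule order_trans[OF _ min_add_double_le])
    qed simp
    also have "\<dots> = 4 * (2 * (\<integral>\<^sup>+\<omega>. min (V T \<omega>) (ennreal K) \<partial>M) + 2 * (\<integral>\<^sup>+\<omega>. min (\<delta> (\<rho> k) \<omega>) (ennreal K) \<partial>M))"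
      by (simp add: nn_integral_add nn_integral_cmult)
    also have "\<dots> = 8 * (\<integral>\<^sup>+\<omega>. min (V T \<omega>) (ennreal K) \<partial>M) + 8 * (\<integral>\<^sup>+\<omega>. min (\<delta> (\<rho> k) \<omega>) (ennreal K) \<partial>M)"
      by (simp add: distrib_left mult.assoc[symmetric])
    finally show "(\<integral>\<^sup>+\<omega>. (SUP q\<in>Q. ?f k q \<omega>) \<partial>M)
      \<le> 8 * (\<integral>\<^sup>+\<omega>. min (V T \<omega>) (ennreal K) \<partial>M) + 8 * (\<integral>\<^sup>+\<omega>. min (\<delta> (\<rho> k) \<omega>) (ennreal K) \<partial>M)" .
  qed
  \<comment> \<open>The integrands converge only in probability, but truncated at \<open>K\<close>
    their distances are dominated by a constant, so the error term vanishes in the limit.\<close>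
  also have "\<dots> = 8 * (\<integral>\<^sup>+\<omega>. min (V T \<omega>) (ennreal K) \<partial>M)"
  proof (rule lim_imp_Liminf[OF sequentially_bot])
    have "(\<lambda>k. \<integral>\<^sup>+\<omega>. min (\<delta> (\<rho> k) \<omega>) (ennreal K) \<partial>M) \<longlonglongrightarrow> (\<integral>\<^sup>+\<omega>. 0 \<partial>M)"
    proof (rule nn_integral_dominated_convergence[where w="\<lambda>_. ennreal K"])
      show "(\<integral>\<^sup>+\<omega>. ennreal K \<partial>M) < \<infinity>" by (simp add: emeasure_space_1)
      from AE show "AE \<omega> in M. (\<lambda>k. min (\<delta> (\<rho> k) \<omega>) (ennreal K)) \<longlonglongrightarrow> 0"
      proof eventually_elim
        case (elim \<omega>)
        then have "(\<lambda>k. \<delta> (\<rho> k) \<omega>) \<longlonglongrightarrow> 0" by simp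
        then have "(\<lambda>k. min (\<delta> (\<rho> k) \<omega>) (ennreal K)) \<longlonglongrightarrow> min 0 (ennreal K)"
          by (intro tendsto_min tendsto_const)
        then show ?case by simp
      qed
    qed auto
    then have "(\<lambda>k. \<integral>\<^sup>+\<omega>. min (\<delta> (\<rho> k) \<omega>) (ennreal K) \<partial>M) \<longlonglongrightarrow> 0"
      by (simp only: nn_integral_const mult_zero_left)
    moreover have "(8::ennreal) < \<top>" by simp
    ultimately show "(\<lambda>k. 8 * (\<integral>\<^sup>+\<omega>. min (V T \<omega>) (ennreal K) \<partial>M) + 8 * (\<integral>\<^sup>+\<omega>. min (\<delta> (\<rho> k) \<omega>) (ennreal K) \<partial>M))
      \<longlonglongrightarrow> 8 * (\<integral>\<^sup>+\<omega>. min (V T \<omega>) (ennreal K) \<partial>M)"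
      by (rule tendsto_add_cmult_zero_ennreal)
  qed
  finally show ?thesis .
qed

end

section \<open>Countable dense times, and stopping at a level of the running integral\<close>

lemma rational_from_below:
  fixes z :: real
  assumes "0 \<le> z" "z \<le> 1"
  obtains w where "\<And>k::nat. w k \<in> \<rat> \<inter> {0..1}" "\<And>k. w k \<le> z" "w \<longlonglongrightarrow> z"
proof -
  define w where "w k = of_int \<lfloor>z * real (Suc k)\<rfloor> / real (Suc k)" for k
  have le: "w k \<le> z" for k
    unfolding w_def by (subst pos_divide_le_eq) auto
  have ge: "z - inverse (real (Suc k)) \<le> w k" for k
  proof -
    have "(z - inverse (real (Suc k))) * real (Suc k) = z * real (Suc k) - 1"
      by (simp add: left_diff_distrib del: of_nat_Suc)
    also have "\<dots> \<le> of_int \<lfloor>z * real (Suc k)\<rfloor>" by linarith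
    finally show ?thesis unfolding w_def by (subst pos_le_divide_eq) auto
  qed
  have nonneg: "0 \<le> w k" for k
    unfolding w_def using assms(1) by (intro divide_nonneg_nonneg) auto
  have mem: "w k \<in> \<rat> \<inter> {0..1}" for k
  proof -
    have "w k \<le> 1" using le[of k] assms(2) by (rule order_trans)
    moreover have "w k \<in> \<rat>" unfolding w_def by simp
    ultimately show ?thesis using nonneg[of k] by simp
  qed
  have "w \<longlonglongrightarrow> z"
  proof (rule tendsto_sandwich)
    show "(\<lambda>k. z - inverse (real (Suc k))) \<longlonglongrightarrow> z"
      using tendsto_diff[OF tendsto_const LIMSEQ_inverse_real_of_nat, of z] by simp
    show "(\<lambda>k. z) \<longlonglongrightarrow> z" by simp
  qed (use le ge in auto)
  from mem le this show ?thesis by (rule that)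
qed

text \<open>An affine image of the rationals in the unit interval, so that the endpoints belong to
  it even when they are irrational.\<close>

definition dense_pts :: "real \<Rightarrow> real \<Rightarrow> real set" where
  "dense_pts r t = (\<lambda>z. r + (t - r) * z) ` (\<rat> \<inter> {0..1})"

lemma countable_dense_pts: "countable (dense_pts r t)"
  unfolding dense_pts_def by (intro countable_image countable_Int1 countable_rat)

lemma dense_pts_subset:
  assumes "r \<le> t"
  shows "dense_pts r t \<subseteq> {r..t}"
proof
  fix u assume "u \<in> dense_pts r t"
  then obtain z where z: "0 \<le> z" "z \<le> 1" "u = r + (t - r) * z" by (auto simp: dense_pts_def)
  have "(t - r) * z \<le> (t - r) * 1" using z assms by (intro mult_left_mono) auto
  moreover have "0 \<le> (t - r) * z" using z assms by (intro mult_nonneg_nonneg) auto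
  ultimately show "u \<in> {r..t}" using z(3) by simp
qed

text \<open>Approximation is from the left because the stopping condition \<open>V u < K\<close> is
  monotone: earlier times inherit it from later ones.\<close>

lemma dense_pts_from_below:
  assumes "r \<le> u" "u \<le> t"
  obtains v where "\<And>k::nat. v k \<in> dense_pts r t" "\<And>k. v k \<le> u" "v \<longlonglongrightarrow> u"
proof (cases "r = t")
  case True
  then have "u = r" using assms by simp
  then show ?thesis using True by (intro that[of "\<lambda>_. u"]) (auto simp: dense_pts_def intro: rev_image_eqI[of 0])
next
  case False
  then have rt: "r < t" using assms by simp
  define z where "z = (u - r) / (t - r)"
  have z: "0 \<le> z" "z \<le> 1" and u: "u = r + (t - r) * z" using assms rt by (auto simp: z_def divide_simps)
  obtain w where w: "\<And>k::nat. w k \<in> \<rat> \<inter> {0..1}" "\<And>k. w k \<le> z" "w \<longlonglongrightarrow> z"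
    using rational_from_below[OF z] by blast
  show ?thesis
  proof (rule that[of "\<lambda>k. r + (t - r) * w k"])
    show "r + (t - r) * w k \<in> dense_pts r t" for k unfolding dense_pts_def using w(1) by blast
    show "r + (t - r) * w k \<le> u" for k unfolding u using rt w(2) by (intro add_left_mono mult_left_mono) auto
    show "(\<lambda>k. r + (t - r) * w k) \<longlonglongrightarrow> u" unfolding u by (intro tendsto_intros w(3))
  qed
qed

text \<open>Continuity reduces an uncountable supremum to a countable one; this is where the
  measurability of the running supremum and of the oscillation comes from.\<close>

lemma SUP_dense_pts:
  fixes g :: "real \<Rightarrow> real"
  assumes g: "continuous_on {r..t} g" and rt: "r \<le> t"
  shows "(SUP u\<in>{r..t}. ennreal (g u)) = (SUP u\<in>dense_pts r t. ennreal (g u))"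
proof (rule antisym)
  show "(SUP u\<in>{r..t}. ennreal (g u)) \<le> (SUP u\<in>dense_pts r t. ennreal (g u))"
  proof (rule SUP_least)
    fix u assume u: "u \<in> {r..t}"
    then obtain v where v: "\<And>k::nat. v k \<in> dense_pts r t" "v \<longlonglongrightarrow> u"
      by (auto intro: dense_pts_from_below[of r u t])
    have "(\<lambda>k. ennreal (g (v k))) \<longlonglongrightarrow> ennreal (g u)"
    proof (intro tendsto_ennrealI continuous_on_tendsto_compose[OF g v(2) u] always_eventually allI)
      show "v k \<in> {r..t}" for k using v(1) dense_pts_subset[OF rt] by blast
    qed
    then show "ennreal (g u) \<le> (SUP u\<in>dense_pts r t. ennreal (g u))"
      by (rule tendsto_upperbound) (auto intro!: always_eventually SUP_upper v(1))
  qed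
  show "(SUP u\<in>dense_pts r t. ennreal (g u)) \<le> (SUP u\<in>{r..t}. ennreal (g u))"
    by (intro SUP_subset_mono dense_pts_subset rt) auto
qed

lemma SUP_ennreal_continuous_finite:
  fixes g :: "real \<Rightarrow> real"
  assumes "continuous_on {r..t} g"
  shows "(SUP u\<in>{r..t}. ennreal (g u)) < \<top>"
proof -
  have "bounded (g ` {r..t})" using assms by (intro compact_imp_bounded compact_continuous_image) auto
  then obtain b where "\<forall>y\<in>g ` {r..t}. norm y \<le> b" unfolding bounded_iff by blast
  then have b: "\<bar>g u\<bar> \<le> b" if "u \<in> {r..t}" for u using that by simp
  have "(SUP u\<in>{r..t}. ennreal (g u)) \<le> ennreal b"
    using b by (intro SUP_least ennreal_leI) (auto dest: abs_le_D1)
  also have "\<dots> < \<top>" by simp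
  finally show ?thesis .
qed

text \<open>The running integral of \<open>f\<close> is continuous, so it reaches the level \<open>K\<close> without jumping over it.\<close>

lemma min_integral_le_stopped:
  fixes f :: "real \<Rightarrow> ennreal"
  assumes f [measurable]: "f \<in> borel_measurable borel" and rt: "r \<le> t" and K: "0 < K"
    and fin: "(\<integral>\<^sup>+s\<in>{r..t}. f s \<partial>lborel) < \<top>"
  shows "min (\<integral>\<^sup>+s\<in>{r..t}. f s \<partial>lborel) K
    \<le> (\<integral>\<^sup>+s\<in>{r..t}. (if (\<integral>\<^sup>+v\<in>{r..s}. f v \<partial>lborel) < K then f s else 0) \<partial>lborel)"
    (is "_ \<le> ?R")
proof -
  let ?F = "\<lambda>s. \<integral>\<^sup>+v\<in>{r..s}. f v \<partial>lborel"
  have mono: "?F s \<le> ?F s'" if "s \<le> s'" for s s'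
    using that by (intro nn_integral_mono) (auto simp: indicator_def)
  show ?thesis
  proof (cases "?F t < K")
    case True
    have "?R = ?F t"
    proof (intro nn_integral_cong)
      fix s
      show "(if ?F s < K then f s else 0) * indicator {r..t} s = f s * indicator {r..t} s"
      proof (cases "s \<in> {r..t}")
        case True
        then have "?F s < K" using \<open>?F t < K\<close> by (intro order.strict_trans1[OF mono[of s t]]) simp_all
        then show ?thesis by (simp only: if_True)
      qed simp
    qed
    then show ?thesis by simp
  next
    case False
    define S where "S = {s \<in> {r..t}. ?F s < K}"
    have "?F r = (\<integral>\<^sup>+v\<in>{r}. f r \<partial>lborel)"
      by (intro nn_integral_cong) (auto simp: indicator_def)
    then have F0: "?F r = 0" by (simp add: nn_integral_cmult)
    then have rS: "r \<in> S" using K rt by (simp add: S_def)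
    have bdd: "bdd_above S" by (rule bdd_aboveI[of _ t]) (auto simp: S_def)
    \<comment> \<open>The last moment at which the running integral can still be below
      \<open>K\<close>; it plays the part of the stopping time, for one fixed path.\<close>
    define \<tau> where "\<tau> = Sup S"
    have \<tau>: "r \<le> \<tau>" "\<tau> \<le> t"
    proof -
      show "r \<le> \<tau>" unfolding \<tau>_def by (rule cSup_upper[OF rS bdd])
      have "S \<noteq> {}" "\<And>x. x \<in> S \<Longrightarrow> x \<le> t" using rS by (auto simp: S_def)
      then show "\<tau> \<le> t" unfolding \<tau>_def by (rule cSup_least)
    qed
    have below: "?F s < K" if s: "r \<le> s" "s < \<tau>" for s
    proof -
      have "S \<noteq> {}" using rS by blast
      then obtain s' where s': "s' \<in> S" "s < s'" using less_cSupD[of S s] s(2) unfolding \<tau>_def by blast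
      then have "?F s' < K" unfolding S_def by blast
      then show ?thesis by (rule order.strict_trans1[OF mono, rotated]) (use s' in simp)
    qed
    \<comment> \<open>If the running integral were below \<open>K\<close> at \<open>\<tau>\<close>,
      times \<open>v k\<close> slightly later would still exist in the interval. There it is at
      least \<open>K\<close>, and dominated convergence carries this bound back to
      \<open>\<tau>\<close>.\<close>
    have F\<tau>: "K \<le> ?F \<tau>"
    proof (rule ccontr)
      assume "\<not> K \<le> ?F \<tau>"
      then have less: "?F \<tau> < K" by simp
      with False have "\<tau> \<noteq> t" by auto
      with \<tau> have \<tau>t: "\<tau> < t" by simp
      define v where "v k = \<tau> + (t - \<tau>) * inverse (real (Suc k))" for k
      have v: "\<tau> < v k" "v k \<le> t" for k
      proof -
        show "\<tau> < v k" using \<tau>t by (simp add: v_def)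
        have "(t - \<tau>) * inverse (real (Suc k)) \<le> (t - \<tau>) * 1"
          using \<tau>t by (intro mult_left_mono) (auto simp: field_simps)
        then show "v k \<le> t" by (simp add: v_def)
      qed
      have v_lim: "v \<longlonglongrightarrow> \<tau>"
        using tendsto_add[OF tendsto_const tendsto_mult[OF tendsto_const LIMSEQ_inverse_real_of_nat], of \<tau> "t - \<tau>"]
        by (simp add: v_def[abs_def])
      have above: "K \<le> ?F (v k)" for k
      proof (rule ccontr)
        assume "\<not> K \<le> ?F (v k)"
        then have "?F (v k) < K" by (rule not_le_imp_less)
        moreover have "v k \<in> {r..t}" using v[of k] \<tau>(1) by simp
        ultimately have "v k \<in> S" unfolding S_def by blast
        from cSup_upper[OF this bdd] v(1)[of k] show False unfolding \<tau>_def by simp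
      qed
      have "(\<lambda>k. ?F (v k)) \<longlonglongrightarrow> ?F \<tau>"
      proof (rule nn_integral_dominated_convergence[where w="\<lambda>s. f s * indicator {r..t} s"])
        show "AE s in lborel. f s * indicator {r..v j} s \<le> f s * indicator {r..t} s" for j
          using v(2)[of j] by (intro AE_I2) (auto simp: indicator_def)
        show "AE s in lborel. (\<lambda>k. f s * indicator {r..v k} s) \<longlonglongrightarrow> f s * indicator {r..\<tau>} s"
        proof (intro AE_I2)
          fix s
          have "eventually (\<lambda>k. f s * indicator {r..\<tau>} s = f s * indicator {r..v k} s) sequentially"
          proof (cases "s \<le> \<tau>")
            case True
            then show ?thesis using v(1) by (intro always_eventually) (auto simp: indicator_def intro: less_imp_le order.strict_trans1)
          next
            case False
            then have "eventually (\<lambda>k. v k < s) sequentially" using order_tendstoD(2)[OF v_lim] by simp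
            then show ?thesis by eventually_elim (use False in \<open>auto simp: indicator_def\<close>)
          qed
          then show "(\<lambda>k. f s * indicator {r..v k} s) \<longlonglongrightarrow> f s * indicator {r..\<tau>} s"
            by (rule Lim_transform_eventually[OF tendsto_const])
        qed
      qed (use fin in auto)
      then have "K \<le> ?F \<tau>" by (rule tendsto_lowerbound) (use above in auto)
      with less show False by simp
    qed
    have "min (?F t) K \<le> K" by simp
    also note F\<tau>
    also have "?F \<tau> \<le> ?R"
    proof (rule nn_integral_mono_AE)
      have "AE s in lborel. s \<noteq> \<tau>" by (rule AE_lborel_singleton)
      then show "AE s in lborel. f s * indicator {r..\<tau>} s
        \<le> (if ?F s < K then f s else 0) * indicator {r..t} s"
      proof eventually_elim
        case (elim s)
        show ?case
        proof (cases "s \<in> {r..\<tau>}")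
          case True
          then have "?F s < K" using elim by (intro below) simp_all
          then have "f s \<le> (if ?F s < K then f s else 0)" by (simp only: if_True)
          then show ?thesis using True \<tau>(2) by simp
        qed simp
      qed
    qed
    finally show ?thesis .
  qed
qed

text \<open>Half of \<open>y\<close> is moved to the other side, which requires \<open>y\<close> to
  be finite: infinite \<open>y\<close> satisfies the first premise as soon as \<open>c\<close> is
  positive.\<close>

lemma ennreal_absorb_half:
  fixes y b c :: ennreal
  assumes "y \<le> b + c * y" "c \<le> ennreal (1/2)" "y < \<top>"
  shows "y \<le> 2 * b"
proof (cases b)
  case (real b')
  obtain y' where y': "y = ennreal y'" "0 \<le> y'" using assms(3) by (cases y) auto
  have "y \<le> b + ennreal (1/2) * y"
    using assms(1) by (rule order_trans) (intro add_left_mono mult_right_mono assms(2), simp)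
  also have "\<dots> = ennreal (b' + 1/2 * y')"
  proof -
    have "ennreal (b' + 1/2 * y') = ennreal b' + ennreal (1/2 * y')" using real y' by (intro ennreal_plus) auto
    also have "ennreal (1/2 * y') = ennreal (1/2) * ennreal y'" by (rule ennreal_mult') simp
    finally show ?thesis unfolding y'(1) real(2) by (rule sym)
  qed
  finally have "ennreal y' \<le> ennreal (b' + 1/2 * y')" unfolding y'(1) .
  then have "y' \<le> b' + 1/2 * y'" by (rule ennreal_le_iff[THEN iffD1, rotated]) (use real y' in auto)
  then have "y' \<le> 2 * b'" by simp
  then have "ennreal y' \<le> ennreal (2 * b')" by (rule ennreal_leI)
  then show ?thesis unfolding y'(1) real(2) by (simp add: ennreal_mult')
qed (simp add: ennreal_mult_top)

lemma nn_integral_set_Cauchy_Schwarz: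
  fixes f :: "real \<Rightarrow> ennreal"
  assumes [measurable]: "(\<lambda>s. f s * indicator {r<..q} s) \<in> borel_measurable borel" and "r \<le> q"
  shows "(\<integral>\<^sup>+s\<in>{r<..q}. f s \<partial>lborel)\<^sup>2 \<le> ennreal (q - r) * (\<integral>\<^sup>+s\<in>{r<..q}. (f s)\<^sup>2 \<partial>lborel)"
proof -
  have "(\<integral>\<^sup>+s\<in>{r<..q}. f s \<partial>lborel)\<^sup>2
     = (\<integral>\<^sup>+s. indicator {r<..q} s * (f s * indicator {r<..q} s) \<partial>lborel)\<^sup>2"
    by (intro arg_cong[where f="\<lambda>x. x\<^sup>2"] nn_integral_cong) (auto simp: indicator_def)
  also have "\<dots> \<le> (\<integral>\<^sup>+s. (indicator {r<..q} s)\<^sup>2 \<partial>lborel) * (\<integral>\<^sup>+s. (f s * indicator {r<..q} s)\<^sup>2 \<partial>lborel)"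
    by (rule Cauchy_Schwarz_nn_integral) auto
  also have "(\<integral>\<^sup>+s. (indicator {r<..q} s)\<^sup>2 \<partial>lborel) = (\<integral>\<^sup>+s. indicator {r<..q} s \<partial>lborel)"
    by (intro nn_integral_cong) (auto simp: indicator_def)
  also have "\<dots> = ennreal (q - r)" using assms(2) by simp
  also have "(\<integral>\<^sup>+s. (f s * indicator {r<..q} s)\<^sup>2 \<partial>lborel) = (\<integral>\<^sup>+s\<in>{r<..q}. (f s)\<^sup>2 \<partial>lborel)"
    by (intro nn_integral_cong) (auto simp: indicator_def)
  finally show ?thesis .
qed

section \<open>The maximal inequality over countable sets of times, and its untruncated
  consequence\<close>

context brownian_motion
begin

lemma ito_measurable:
  assumes "is_ito_integral M F B \<phi> I"
  shows "0 \<le> t \<Longrightarrow> I t \<in> borel_measurable M"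
    and "0 \<le> r \<Longrightarrow> \<phi> r \<in> borel_measurable (F r)"
    and "(\<lambda>(s, \<omega>). indicator {0..} s * \<phi> s \<omega>) \<in> borel_measurable (borel \<Otimes>\<^sub>M M)"
proof -
  have pred: "(\<lambda>(t, \<omega>). \<phi> t \<omega>) \<in> borel_measurable (predictable_algebra M F)"
    using assms by (simp add: is_ito_integral_def predictable_def)
  show "0 \<le> t \<Longrightarrow> I t \<in> borel_measurable M" using assms by (simp add: is_ito_integral_def)
  show "0 \<le> r \<Longrightarrow> \<phi> r \<in> borel_measurable (F r)" using predictable_section[OF pred] by simp
  show "(\<lambda>(s, \<omega>). indicator {0..} s * \<phi> s \<omega>) \<in> borel_measurable (borel \<Otimes>\<^sub>M M)"
    using predictable_joint[OF pred] by simp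
qed

lemma ito_variation_measurable:
  assumes ito: "is_ito_integral M F B \<phi> I" and r: "0 \<le> r" and c: "c \<in> borel_measurable M"
  shows "(\<lambda>\<omega>. \<integral>\<^sup>+s\<in>{r..u}. ennreal ((\<phi> s \<omega> - c \<omega>)\<^sup>2) \<partial>lborel) \<in> borel_measurable M"
proof -
  let ?\<phi> = "\<lambda>s \<omega>. indicator {0..} s * \<phi> s \<omega>"
  note [measurable] = ito_measurable(3)[OF ito] c
  have "(\<lambda>\<omega>. \<integral>\<^sup>+s\<in>{r..u}. ennreal ((\<phi> s \<omega> - c \<omega>)\<^sup>2) \<partial>lborel)
     = (\<lambda>\<omega>. \<integral>\<^sup>+s\<in>{r..u}. ennreal ((?\<phi> s \<omega> - c \<omega>)\<^sup>2) \<partial>lborel)"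
    using r by (intro ext nn_integral_cong) (auto simp: indicator_def)
  also have "\<dots> \<in> borel_measurable M" by measurable
  finally show ?thesis .
qed

text \<open>The bound for finite sets of times does not depend on the set, so monotone convergence
  along an enumeration of \<open>Q\<close> suffices.\<close>

lemma ito_maximal:
  assumes ito: "is_ito_integral M F B \<phi> I" and r: "0 \<le> r" "r < T"
    and c: "c \<in> borel_measurable (F r)" and Q: "countable Q" "Q \<subseteq> {r..T}" and K: "0 \<le> K"
  defines "V \<equiv> \<lambda>u \<omega>. \<integral>\<^sup>+s\<in>{r..u}. ennreal ((\<phi> s \<omega> - c \<omega>)\<^sup>2) \<partial>lborel"
  shows "(\<integral>\<^sup>+\<omega>. (SUP q\<in>Q. if V q \<omega> < ennreal K
            then ennreal ((I q \<omega> - I r \<omega> - c \<omega> * (B q \<omega> - B r \<omega>))\<^sup>2) else 0) \<partial>M)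
     \<le> 8 * (\<integral>\<^sup>+\<omega>. min (V T \<omega>) (ennreal K) \<partial>M)"
proof (cases "Q = {}")
  case True
  then show ?thesis by (simp add: bot_ennreal)
next
  case False
  let ?f = "\<lambda>q \<omega>. if V q \<omega> < ennreal K
            then ennreal ((I q \<omega> - I r \<omega> - c \<omega> * (B q \<omega> - B r \<omega>))\<^sup>2) else 0"
  let ?q = "from_nat_into Q"
  have cM [measurable]: "c \<in> borel_measurable M" by (rule measurable_F_imp[OF r(1) c])
  have [measurable]: "V u \<in> borel_measurable M" for u
    unfolding V_def by (rule ito_variation_measurable[OF ito r(1) cM])
  have f_m: "?f q \<in> borel_measurable M" if "q \<in> Q" for q
  proof -
    have "0 \<le> q" using that Q r by auto
    then have [measurable]: "I q \<in> borel_measurable M" "I r \<in> borel_measurable M"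
      "B q \<in> borel_measurable M" "B r \<in> borel_measurable M"
      using r ito_measurable(1)[OF ito] by (auto intro: B_rv)
    show ?thesis by measurable
  qed
  have Q_eq: "Q = range ?q" using range_from_nat_into[OF False Q(1)] by simp
  have SUP_eq: "(SUP q\<in>Q. ?f q \<omega>) = (SUP l. SUP q\<in>?q ` {..l}. ?f q \<omega>)" for \<omega>
  proof (rule antisym)
    show "(SUP q\<in>Q. ?f q \<omega>) \<le> (SUP l. SUP q\<in>?q ` {..l}. ?f q \<omega>)"
    proof (rule SUP_least)
      fix q assume "q \<in> Q"
      then obtain l where "q = ?q l" using Q_eq by auto
      then show "?f q \<omega> \<le> (SUP l. SUP q\<in>?q ` {..l}. ?f q \<omega>)"
        by (intro SUP_upper2[of l] SUP_upper) auto
    qed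
    show "(SUP l. SUP q\<in>?q ` {..l}. ?f q \<omega>) \<le> (SUP q\<in>Q. ?f q \<omega>)"
      using from_nat_into[OF False] by (intro SUP_least SUP_upper) auto
  qed
  have "(\<integral>\<^sup>+\<omega>. (SUP q\<in>Q. ?f q \<omega>) \<partial>M) = (SUP l. \<integral>\<^sup>+\<omega>. (SUP q\<in>?q ` {..l}. ?f q \<omega>) \<partial>M)"
    unfolding SUP_eq
  proof (rule nn_integral_monotone_convergence_SUP)
    show "incseq (\<lambda>l \<omega>. SUP q\<in>?q ` {..l}. ?f q \<omega>)"
      by (intro incseq_SucI le_funI SUP_subset_mono) auto
    show "(\<lambda>\<omega>. SUP q\<in>?q ` {..l}. ?f q \<omega>) \<in> borel_measurable M" for l
      using from_nat_into[OF False] by (intro borel_measurable_SUP f_m) (auto simp: countable_finite)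
  qed
  also have "\<dots> \<le> 8 * (\<integral>\<^sup>+\<omega>. min (V T \<omega>) (ennreal K) \<partial>M)"
  proof (rule SUP_least)
    fix l
    have "?q ` {..l} \<subseteq> {r..T}" using from_nat_into[OF False] Q(2) by auto
    then show "(\<integral>\<^sup>+\<omega>. (SUP q\<in>?q ` {..l}. ?f q \<omega>) \<partial>M) \<le> 8 * (\<integral>\<^sup>+\<omega>. min (V T \<omega>) (ennreal K) \<partial>M)"
      unfolding V_def by (intro ito_maximal_finite[OF ito r c]) (auto simp: K)
  qed
  finally show ?thesis .
qed

text \<open>The maximal inequality for the single time \<open>t\<close>, with \<open>K\<close>
  tending to infinity. When the right side is finite, the variation is finite on almost every path,
  and the condition \<open>V < K\<close> is eventually satisfied. The constant 8 instead of 1 is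
  immaterial, since only the order in \<open>t - r\<close> counts.\<close>

lemma ito_L2_bound:
  assumes ito: "is_ito_integral M F B \<phi> I" and r: "0 \<le> r" "r < t"
    and c: "c \<in> borel_measurable (F r)"
  shows "(\<integral>\<^sup>+\<omega>. ennreal ((I t \<omega> - I r \<omega> - c \<omega> * (B t \<omega> - B r \<omega>))\<^sup>2) \<partial>M)
     \<le> 8 * (\<integral>\<^sup>+\<omega>. (\<integral>\<^sup>+s\<in>{r..t}. ennreal ((\<phi> s \<omega> - c \<omega>)\<^sup>2) \<partial>lborel) \<partial>M)"
proof -
  let ?V = "\<lambda>\<omega>. \<integral>\<^sup>+s\<in>{r..t}. ennreal ((\<phi> s \<omega> - c \<omega>)\<^sup>2) \<partial>lborel"
  let ?Z = "\<lambda>\<omega>. ennreal ((I t \<omega> - I r \<omega> - c \<omega> * (B t \<omega> - B r \<omega>))\<^sup>2)"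
  have cM [measurable]: "c \<in> borel_measurable M" by (rule measurable_F_imp[OF r(1) c])
  have [measurable]: "?V \<in> borel_measurable M"
    by (rule ito_variation_measurable[OF ito r(1) cM])
  have [measurable]: "I t \<in> borel_measurable M" "I r \<in> borel_measurable M"
      "B t \<in> borel_measurable M" "B r \<in> borel_measurable M"
    using r ito_measurable(1)[OF ito] by (auto intro: B_rv)
  show ?thesis
  proof (cases "(\<integral>\<^sup>+\<omega>. ?V \<omega> \<partial>M) = \<top>")
    case False
    have fin: "AE \<omega> in M. ?V \<omega> \<noteq> \<top>" using False nn_integral_PInf_AE[of ?V M] by (simp add: infinity_ennreal_def)
    let ?g = "\<lambda>K \<omega>. if ?V \<omega> < ennreal (real K) then ?Z \<omega> else 0"
    have "(\<integral>\<^sup>+\<omega>. ?Z \<omega> \<partial>M) \<le> (\<integral>\<^sup>+\<omega>. (SUP K. ?g K \<omega>) \<partial>M)"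
    proof (rule nn_integral_mono_AE)
      from fin show "AE \<omega> in M. ?Z \<omega> \<le> (SUP K. ?g K \<omega>)"
      proof eventually_elim
        case (elim \<omega>)
        then obtain v where v: "?V \<omega> = ennreal v" "0 \<le> v" by (cases "?V \<omega>") auto
        obtain K :: nat where "v < real K" using reals_Archimedean2 by blast
        then have "?V \<omega> < ennreal (real K)" unfolding v(1) using v(2) by (simp add: ennreal_less_iff)
        then show ?case by (intro SUP_upper2[of K]) auto
      qed
    qed
    also have "\<dots> = (SUP K. \<integral>\<^sup>+\<omega>. ?g K \<omega> \<partial>M)"
    proof (rule nn_integral_monotone_convergence_SUP)
      show "incseq (\<lambda>K \<omega>. ?g K \<omega>)"
      proof (intro incseq_SucI le_funI)
        fix K \<omega>
        have "ennreal (real K) \<le> ennreal (real (Suc K))" by (intro ennreal_leI) simp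
        then show "?g K \<omega> \<le> ?g (Suc K) \<omega>" by (auto intro: less_le_trans)
      qed
    qed measurable
    also have "\<dots> \<le> 8 * (\<integral>\<^sup>+\<omega>. ?V \<omega> \<partial>M)"
    proof (rule SUP_least)
      fix K :: nat
      have "(\<integral>\<^sup>+\<omega>. ?g K \<omega> \<partial>M) = (\<integral>\<^sup>+\<omega>. (SUP q\<in>{t}.
          if (\<integral>\<^sup>+s\<in>{r..q}. ennreal ((\<phi> s \<omega> - c \<omega>)\<^sup>2) \<partial>lborel) < ennreal (real K)
          then ennreal ((I q \<omega> - I r \<omega> - c \<omega> * (B q \<omega> - B r \<omega>))\<^sup>2) else 0) \<partial>M)"
        by (intro nn_integral_cong) simp
      also have "\<dots> \<le> 8 * (\<integral>\<^sup>+\<omega>. min (?V \<omega>) (ennreal (real K)) \<partial>M)"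
        using r by (intro ito_maximal[OF ito r c]) auto
      also have "\<dots> \<le> 8 * (\<integral>\<^sup>+\<omega>. ?V \<omega> \<partial>M)" by (intro mult_left_mono nn_integral_mono) auto
      finally show "(\<integral>\<^sup>+\<omega>. ?g K \<omega> \<partial>M) \<le> 8 * (\<integral>\<^sup>+\<omega>. ?V \<omega> \<partial>M)" .
    qed
    finally show ?thesis .
  qed (simp add: ennreal_mult_top)
qed

text \<open>The initial value is not part of \<open>is_ito_integral\<close>. The breakpoints are
  nonnegative, so simple integrals vanish at time 0, and so does their limit in probability.\<close>

lemma ito_integral_zero:
  assumes ito: "is_ito_integral M F B \<phi> I"
  shows "AE \<omega> in M. I 0 \<omega> = 0"
proof -
  have [measurable]: "I 0 \<in> borel_measurable M" using ito_measurable(1)[OF ito] by simp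
  have "\<exists>n \<tau> \<xi>. (\<forall>k::nat. simple_integrand M F (n k) (\<tau> k) (\<xi> k)) \<and>
        (\<forall>t\<ge>0. \<forall>\<epsilon>>0. (\<lambda>k. measure M {\<omega>\<in>space M.
            \<epsilon> < \<bar>simple_ito_integral B (n k) (\<tau> k) (\<xi> k) t \<omega> - I t \<omega>\<bar>}) \<longlonglongrightarrow> 0)"
    using ito unfolding is_ito_integral_def by (elim conjE exE) (intro exI conjI; assumption)
  then obtain n \<tau> \<xi> where si: "\<forall>k::nat. simple_integrand M F (n k) (\<tau> k) (\<xi> k)"
    and conv: "\<forall>t\<ge>0. \<forall>\<epsilon>>0. (\<lambda>k. measure M {\<omega>\<in>space M.
            \<epsilon> < \<bar>simple_ito_integral B (n k) (\<tau> k) (\<xi> k) t \<omega> - I t \<omega>\<bar>}) \<longlonglongrightarrow> 0"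
    by (elim exE conjE) (rule that)
  have nonneg: "0 \<le> \<tau> k i" if "i \<le> n k" for k i
    using that by (induction i) (use si in \<open>auto simp: simple_integrand_def intro: order_trans\<close>)
  have zero: "simple_ito_integral B (n k) (\<tau> k) (\<xi> k) 0 \<omega> = 0" for k \<omega>
    unfolding simple_ito_integral_def
  proof (intro sum.neutral ballI)
    fix i assume "i \<in> {..<n k}"
    then have "min (\<tau> k (Suc i)) 0 = 0" "min (\<tau> k i) 0 = 0" using nonneg[of i k] nonneg[of "Suc i" k] by auto
    then show "\<xi> k i \<omega> * (B (min (\<tau> k (Suc i)) 0) \<omega> - B (min (\<tau> k i) 0) \<omega>) = 0" by simp
  qed
  have "(\<lambda>k::nat. measure M {\<omega>\<in>space M. \<epsilon> < \<bar>I 0 \<omega>\<bar>}) \<longlonglongrightarrow> 0" if "0 < \<epsilon>" for \<epsilon>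
    using conv[rule_format, of 0 \<epsilon>] that by (simp add: zero)
  then have "measure M {\<omega>\<in>space M. \<epsilon> < \<bar>I 0 \<omega>\<bar>} = 0" if "0 < \<epsilon>" for \<epsilon>
    using that LIMSEQ_const_iff by blast
  then have "AE \<omega> in M. \<not> inverse (real (Suc k)) < \<bar>I 0 \<omega>\<bar>" for k
    by (subst AE_iff_measurable[OF _ refl]) (auto simp: emeasure_eq_measure)
  then have "AE \<omega> in M. \<forall>k. \<not> inverse (real (Suc k)) < \<bar>I 0 \<omega>\<bar>" by (simp add: AE_all_countable)
  then show ?thesis
  proof eventually_elim
    case (elim \<omega>)
    then show ?case using reals_Archimedean[of "\<bar>I 0 \<omega>\<bar>"] by (cases "I 0 \<omega> = 0") auto
  qed
qed

end

section \<open>Moment bounds for the equation\<close>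

text \<open>The equation on \<open>[0, T]\<close>, with the coefficients along the solution written as processes \<open>a\<close> and \<open>b\<close>
  and \<open>h\<close> in place of \<open>\<parallel>H\<parallel>\<close>.\<close>

locale linear_growth_equation = brownian_motion M F B
  for M :: "'a measure" and F and B +
  fixes X a b h I :: "real \<Rightarrow> 'a \<Rightarrow> real" and x T C :: real
  assumes X_adapted: "adapted F X"
    and X_continuous: "\<omega> \<in> space M \<Longrightarrow> continuous_on {0..} (\<lambda>t. X t \<omega>)"
    and ito: "is_ito_integral M F B a I"
    and equation: "AE \<omega> in M. \<forall>t\<ge>0. X t \<omega> = x + I t \<omega> + (LINT s:{0..t}|lborel. b s \<omega>)"
    and b_integrable: "AE \<omega> in M. set_integrable lborel {0..T} (\<lambda>s. b s \<omega>)"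
    and growth: "\<omega> \<in> space M \<Longrightarrow> 0 \<le> s \<Longrightarrow> s \<le> T \<Longrightarrow>
      \<bar>a s \<omega>\<bar> + \<bar>b s \<omega>\<bar> \<le> C * (1 + (SUP u\<in>{0..s}. \<bar>X u \<omega>\<bar>) + h s \<omega>)"
    and h_joint: "(\<lambda>(s, \<omega>). indicator {0..} s * h s \<omega>) \<in> borel_measurable (borel \<Otimes>\<^sub>M M)"
    and h_nonneg: "0 \<le> h s \<omega>"
    and h_L2: "0 \<le> s \<Longrightarrow> s \<le> T \<Longrightarrow> (\<integral>\<^sup>+\<omega>. ennreal ((h s \<omega>)\<^sup>2) \<partial>M) \<le> ennreal C"
    and T_pos: "0 < T" and C_ge_1: "1 \<le> C"
begin

text \<open>Values in \<open>ennreal\<close> allow second moments to be written down and compared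
  before they are known to be finite.\<close>

definition sup_sq :: "real \<Rightarrow> 'a \<Rightarrow> ennreal" where
  "sup_sq r \<omega> = (SUP u\<in>{0..r}. ennreal ((X u \<omega>)\<^sup>2))"

definition osc_sq :: "real \<Rightarrow> real \<Rightarrow> 'a \<Rightarrow> ennreal" where
  "osc_sq r t \<omega> = (SUP u\<in>{r..t}. ennreal ((X u \<omega> - X r \<omega>)\<^sup>2))"

definition h_energy :: "real \<Rightarrow> real \<Rightarrow> 'a \<Rightarrow> ennreal" where
  "h_energy r t \<omega> = (\<integral>\<^sup>+s\<in>{r..t}. ennreal ((h s \<omega>)\<^sup>2) \<partial>lborel)"

text \<open>The 4 is from the square of the four summands 1, past supremum, oscillation and
  \<open>h\<close> in the growth bound.\<close>

definition growth_const :: ennreal where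
  "growth_const = ennreal (4 * C\<^sup>2)"

lemma X_measurable [measurable]: "0 \<le> t \<Longrightarrow> X t \<in> borel_measurable M"
  using X_adapted measurable_F_imp by (auto simp: adapted_def)

lemma X_continuous_on: "\<omega> \<in> space M \<Longrightarrow> 0 \<le> r \<Longrightarrow> continuous_on {r..t} (\<lambda>u. X u \<omega>)"
  by (rule continuous_on_subset[OF X_continuous]) auto

lemma sup_sq_measurable [measurable]:
  assumes "0 \<le> r" shows "sup_sq r \<in> borel_measurable M"
proof -
  have "(\<lambda>\<omega>. SUP u\<in>dense_pts 0 r. ennreal ((X u \<omega>)\<^sup>2)) \<in> borel_measurable M"
    using dense_pts_subset[OF assms] by (intro borel_measurable_SUP countable_dense_pts) auto
  moreover have "sup_sq r \<omega> = (SUP u\<in>dense_pts 0 r. ennreal ((X u \<omega>)\<^sup>2))" if "\<omega> \<in> space M" for \<omega>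
    unfolding sup_sq_def using that assms
    by (intro SUP_dense_pts continuous_on_power X_continuous_on) auto
  ultimately show ?thesis by (simp cong: measurable_cong)
qed

lemma osc_sq_dense:
  assumes "0 \<le> r" "r \<le> t" "\<omega> \<in> space M"
  shows "osc_sq r t \<omega> = (SUP u\<in>dense_pts r t. ennreal ((X u \<omega> - X r \<omega>)\<^sup>2))"
  unfolding osc_sq_def using assms
  by (intro SUP_dense_pts continuous_on_power continuous_on_diff continuous_on_const X_continuous_on) auto

lemma osc_sq_measurable [measurable]:
  assumes "0 \<le> r" "r \<le> t" shows "osc_sq r t \<in> borel_measurable M"
proof -
  have "(\<lambda>\<omega>. SUP u\<in>dense_pts r t. ennreal ((X u \<omega> - X r \<omega>)\<^sup>2)) \<in> borel_measurable M"
  proof (intro borel_measurable_SUP countable_dense_pts)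
    fix u assume "u \<in> dense_pts r t"
    then have "0 \<le> u" using dense_pts_subset[OF assms(2)] assms(1) by auto
    then show "(\<lambda>\<omega>. ennreal ((X u \<omega> - X r \<omega>)\<^sup>2)) \<in> borel_measurable M" using assms(1) by measurable
  qed
  then show ?thesis by (simp add: osc_sq_dense[OF assms] cong: measurable_cong)
qed

lemma osc_sq_finite:
  assumes "0 \<le> r" "\<omega> \<in> space M" shows "osc_sq r t \<omega> < \<top>"
  unfolding osc_sq_def using assms
  by (intro SUP_ennreal_continuous_finite continuous_on_power continuous_on_diff continuous_on_const X_continuous_on)

lemma h_energy_measurable [measurable]:
  assumes "0 \<le> r" shows "h_energy r t \<in> borel_measurable M"
proof -
  let ?h = "\<lambda>s \<omega>. indicator {0..} s * h s \<omega>"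
  note [measurable] = h_joint
  have "h_energy r t = (\<lambda>\<omega>. \<integral>\<^sup>+s\<in>{r..t}. ennreal ((?h s \<omega>)\<^sup>2) \<partial>lborel)"
    unfolding h_energy_def using assms by (intro ext nn_integral_cong) (auto simp: indicator_def)
  also have "\<dots> \<in> borel_measurable M" by measurable
  finally show ?thesis .
qed

lemma h_section_measurable:
  assumes "\<omega> \<in> space M" shows "(\<lambda>s. indicator {0..} s * h s \<omega>) \<in> borel_measurable borel"
  using measurable_compose[OF measurable_Pair2'[OF assms] h_joint] by simp

lemma expectation_h_energy:
  assumes "0 \<le> r" "r \<le> t" "t \<le> T"
  shows "(\<integral>\<^sup>+\<omega>. h_energy r t \<omega> \<partial>M) \<le> ennreal (C * (t - r))"
proof -
  let ?h = "\<lambda>s \<omega>. indicator {0..} s * h s \<omega>"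
  interpret P: pair_sigma_finite lborel M ..
  note [measurable] = h_joint
  have "(\<integral>\<^sup>+\<omega>. h_energy r t \<omega> \<partial>M)
     = (\<integral>\<^sup>+\<omega>. (\<integral>\<^sup>+s. ennreal ((?h s \<omega>)\<^sup>2) * indicator {r..t} s \<partial>lborel) \<partial>M)"
    unfolding h_energy_def using assms by (intro nn_integral_cong) (auto simp: indicator_def)
  also have "\<dots> = (\<integral>\<^sup>+s. (\<integral>\<^sup>+\<omega>. ennreal ((?h s \<omega>)\<^sup>2) * indicator {r..t} s \<partial>M) \<partial>lborel)"
    by (rule P.Fubini') measurable
  also have "\<dots> \<le> (\<integral>\<^sup>+s. ennreal C * indicator {r..t} s \<partial>lborel)"
  proof (intro nn_integral_mono)
    fix s
    show "(\<integral>\<^sup>+\<omega>. ennreal ((?h s \<omega>)\<^sup>2) * indicator {r..t} s \<partial>M) \<le> ennreal C * indicator {r..t} s"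
      using h_L2[of s] assms by (cases "s \<in> {r..t}") simp_all
  qed
  also have "\<dots> = ennreal (C * (t - r))"
    using assms C_ge_1 by (simp add: nn_integral_cmult ennreal_mult')
  finally show ?thesis .
qed

text \<open>The path up to \<open>s\<close> is split at \<open>r\<close>: the past is controlled by
  its supremum, the rest by the value at \<open>r\<close> and the oscillation. Only the oscillation
  has to be estimated anew on each interval.\<close>

lemma coefficient_bound_real:
  assumes \<omega>: "\<omega> \<in> space M" and rs: "0 \<le> r" "r \<le> s" "s \<le> T"
    and \<sigma>: "\<And>u. u \<in> {0..r} \<Longrightarrow> (X u \<omega>)\<^sup>2 \<le> \<sigma>" and y: "\<And>u. u \<in> {r..s} \<Longrightarrow> (X u \<omega> - X r \<omega>)\<^sup>2 \<le> y"
  shows "(a s \<omega>)\<^sup>2 \<le> 4 * C\<^sup>2 * (1 + \<sigma> + y + (h s \<omega>)\<^sup>2) \<and> (b s \<omega>)\<^sup>2 \<le> 4 * C\<^sup>2 * (1 + \<sigma> + y + (h s \<omega>)\<^sup>2)"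
proof -
  have nn: "0 \<le> \<sigma>" "0 \<le> y"
    using order_trans[OF zero_le_power2 \<sigma>[of r]] order_trans[OF zero_le_power2 y[of r]] rs by auto
  have "\<bar>X u \<omega>\<bar> \<le> sqrt \<sigma> + sqrt y" if u: "u \<in> {0..s}" for u
  proof (cases "u \<le> r")
    case True
    then have "\<bar>X u \<omega>\<bar> \<le> sqrt \<sigma>" using \<sigma>[of u] u by (intro real_le_rsqrt) auto
    then show ?thesis using nn by (intro add_increasing2) auto
  next
    case False
    have "\<bar>X r \<omega>\<bar> \<le> sqrt \<sigma>" using \<sigma>[of r] rs by (intro real_le_rsqrt) auto
    moreover have "\<bar>X u \<omega> - X r \<omega>\<bar> \<le> sqrt y" using y[of u] u False by (intro real_le_rsqrt) auto
    ultimately show ?thesis by linarith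
  qed
  then have "(SUP u\<in>{0..s}. \<bar>X u \<omega>\<bar>) \<le> sqrt \<sigma> + sqrt y" using rs by (intro cSUP_least) auto
  then have "C * (1 + (SUP u\<in>{0..s}. \<bar>X u \<omega>\<bar>) + h s \<omega>) \<le> C * (1 + (sqrt \<sigma> + sqrt y) + h s \<omega>)"
    using C_ge_1 by (intro mult_left_mono) auto
  then have ab: "\<bar>a s \<omega>\<bar> + \<bar>b s \<omega>\<bar> \<le> C * (1 + sqrt \<sigma> + sqrt y + h s \<omega>)"
    using growth[OF \<omega>, of s] rs by (simp add: add.assoc)
  have sq4: "(p + q + v + w)\<^sup>2 \<le> 4 * (p\<^sup>2 + q\<^sup>2 + v\<^sup>2 + w\<^sup>2)" for p q v w :: real
  proof -
    have "0 \<le> (p - q)\<^sup>2 + (p - v)\<^sup>2 + (p - w)\<^sup>2 + (q - v)\<^sup>2 + (q - w)\<^sup>2 + (v - w)\<^sup>2"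
      by (intro add_nonneg_nonneg) auto
    then show ?thesis by (simp add: power2_eq_square algebra_simps)
  qed
  have "(C * (1 + sqrt \<sigma> + sqrt y + h s \<omega>))\<^sup>2 = C\<^sup>2 * (1 + sqrt \<sigma> + sqrt y + h s \<omega>)\<^sup>2"
    by (rule power_mult_distrib)
  also have "\<dots> \<le> C\<^sup>2 * (4 * (1\<^sup>2 + (sqrt \<sigma>)\<^sup>2 + (sqrt y)\<^sup>2 + (h s \<omega>)\<^sup>2))"
    by (intro mult_left_mono sq4) simp
  also have "\<dots> = 4 * C\<^sup>2 * (1 + \<sigma> + y + (h s \<omega>)\<^sup>2)" using nn by simp
  finally have sq: "(C * (1 + sqrt \<sigma> + sqrt y + h s \<omega>))\<^sup>2 \<le> 4 * C\<^sup>2 * (1 + \<sigma> + y + (h s \<omega>)\<^sup>2)" .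
  have "\<bar>a s \<omega>\<bar>\<^sup>2 \<le> (C * (1 + sqrt \<sigma> + sqrt y + h s \<omega>))\<^sup>2" "\<bar>b s \<omega>\<bar>\<^sup>2 \<le> (C * (1 + sqrt \<sigma> + sqrt y + h s \<omega>))\<^sup>2"
    using ab by (intro power_mono; linarith)+
  then show ?thesis using sq by simp
qed

text \<open>Any bound \<open>y\<close> of the oscillation up to time \<open>s\<close> may be
  inserted, not just \<open>osc_sq\<close>. With stopping, only a supremum over the times before the
  level \<open>K\<close> is at hand.\<close>

lemma coefficient_bound:
  assumes \<omega>: "\<omega> \<in> space M" and rs: "0 \<le> r" "r \<le> s" "s \<le> T"
    and y: "\<And>u. u \<in> {r..s} \<Longrightarrow> ennreal ((X u \<omega> - X r \<omega>)\<^sup>2) \<le> y"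
  shows "ennreal ((a s \<omega>)\<^sup>2) \<le> growth_const * (1 + sup_sq r \<omega> + y + ennreal ((h s \<omega>)\<^sup>2))"
    and "ennreal ((b s \<omega>)\<^sup>2) \<le> growth_const * (1 + sup_sq r \<omega> + y + ennreal ((h s \<omega>)\<^sup>2))"
proof -
  have "ennreal ((a s \<omega>)\<^sup>2) \<le> growth_const * (1 + sup_sq r \<omega> + y + ennreal ((h s \<omega>)\<^sup>2)) \<and>
     ennreal ((b s \<omega>)\<^sup>2) \<le> growth_const * (1 + sup_sq r \<omega> + y + ennreal ((h s \<omega>)\<^sup>2))"
  proof (cases "y = \<top>")
    case True
    have "growth_const \<noteq> 0" using C_ge_1 by (simp add: growth_const_def ennreal_eq_0_iff)
    then have "growth_const * (1 + sup_sq r \<omega> + y + ennreal ((h s \<omega>)\<^sup>2)) = \<top>"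
      unfolding True by (simp add: ennreal_mult_eq_top_iff)
    then show ?thesis by simp
  next
    case False
    then obtain y' where y': "y = ennreal y'" "0 \<le> y'" by (cases y) auto
    have "sup_sq r \<omega> < \<top>" unfolding sup_sq_def using \<omega>
      by (intro SUP_ennreal_continuous_finite continuous_on_power X_continuous_on) auto
    then obtain \<sigma> where \<sigma>: "sup_sq r \<omega> = ennreal \<sigma>" "0 \<le> \<sigma>" by (cases "sup_sq r \<omega>") auto
    have "(X u \<omega>)\<^sup>2 \<le> \<sigma>" if "u \<in> {0..r}" for u
    proof -
      have "ennreal ((X u \<omega>)\<^sup>2) \<le> sup_sq r \<omega>" unfolding sup_sq_def by (rule SUP_upper[OF that])
      then show ?thesis unfolding \<sigma>(1) using \<sigma>(2) by (simp add: ennreal_le_iff)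
    qed
    moreover have "(X u \<omega> - X r \<omega>)\<^sup>2 \<le> y'" if "u \<in> {r..s}" for u
      using y[OF that] unfolding y'(1) using y'(2) by (simp add: ennreal_le_iff)
    ultimately have *: "(a s \<omega>)\<^sup>2 \<le> 4 * C\<^sup>2 * (1 + \<sigma> + y' + (h s \<omega>)\<^sup>2) \<and> (b s \<omega>)\<^sup>2 \<le> 4 * C\<^sup>2 * (1 + \<sigma> + y' + (h s \<omega>)\<^sup>2)"
      by (rule coefficient_bound_real[OF \<omega> rs])
    have "growth_const * (1 + sup_sq r \<omega> + y + ennreal ((h s \<omega>)\<^sup>2)) = ennreal (4 * C\<^sup>2 * (1 + \<sigma> + y' + (h s \<omega>)\<^sup>2))"
      unfolding growth_const_def y'(1) \<sigma>(1) using y'(2) \<sigma>(2)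
      by (subst ennreal_mult) (simp_all add: ennreal_plus[symmetric] ennreal_1[symmetric] del: ennreal_plus ennreal_1)
    then show ?thesis using * by (auto intro: ennreal_leI)
  qed
  then show "ennreal ((a s \<omega>)\<^sup>2) \<le> growth_const * (1 + sup_sq r \<omega> + y + ennreal ((h s \<omega>)\<^sup>2))"
    "ennreal ((b s \<omega>)\<^sup>2) \<le> growth_const * (1 + sup_sq r \<omega> + y + ennreal ((h s \<omega>)\<^sup>2))" by auto
qed

text \<open>The time integral of the growth bound, affine in \<open>y\<close>; the factor of
  \<open>y\<close> is small on a short interval, which makes absorption possible.\<close>

definition growth_integral :: "real \<Rightarrow> real \<Rightarrow> ennreal \<Rightarrow> 'a \<Rightarrow> ennreal" where
  "growth_integral r t y \<omega> = growth_const * (ennreal (t - r) * (1 + sup_sq r \<omega> + y) + h_energy r t \<omega>)"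

lemma integral_growth:
  assumes "0 \<le> r" "r \<le> t" "\<omega> \<in> space M"
  shows "(\<integral>\<^sup>+s\<in>{r..t}. growth_const * (1 + sup_sq r \<omega> + y + ennreal ((h s \<omega>)\<^sup>2)) \<partial>lborel)
     = growth_integral r t y \<omega>"
proof -
  let ?h = "\<lambda>s. indicator {0..} s * h s \<omega>"
  note [measurable] = h_section_measurable[OF assms(3)]
  have "(\<integral>\<^sup>+s\<in>{r..t}. growth_const * (1 + sup_sq r \<omega> + y + ennreal ((h s \<omega>)\<^sup>2)) \<partial>lborel)
     = (\<integral>\<^sup>+s. growth_const * ((1 + sup_sq r \<omega> + y) * indicator {r..t} s + ennreal ((?h s)\<^sup>2) * indicator {r..t} s) \<partial>lborel)"
    using assms(1) by (intro nn_integral_cong) (auto simp: indicator_def)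
  also have "\<dots> = growth_const * ((1 + sup_sq r \<omega> + y) * ennreal (t - r) + (\<integral>\<^sup>+s. ennreal ((?h s)\<^sup>2) * indicator {r..t} s \<partial>lborel))"
    using assms(2) by (simp add: nn_integral_cmult nn_integral_add)
  also have "(\<integral>\<^sup>+s. ennreal ((?h s)\<^sup>2) * indicator {r..t} s \<partial>lborel) = h_energy r t \<omega>"
    unfolding h_energy_def using assms(1) by (intro nn_integral_cong) (auto simp: indicator_def)
  finally show ?thesis unfolding growth_integral_def by (simp add: mult.commute)
qed

text \<open>Cauchy-Schwarz in time gives an extra factor \<open>t - r\<close>, so in L2 the drift is
  half an order smaller than the stochastic integral.\<close>

lemma drift_bound:
  assumes \<omega>: "\<omega> \<in> space M" and rq: "0 \<le> r" "r \<le> q" "q \<le> t" "t \<le> T"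
    and eq: "\<forall>t\<ge>0. X t \<omega> = x + I t \<omega> + (LINT s:{0..t}|lborel. b s \<omega>)"
    and int: "set_integrable lborel {0..T} (\<lambda>s. b s \<omega>)"
    and y: "\<And>u. u \<in> {r..q} \<Longrightarrow> ennreal ((X u \<omega> - X r \<omega>)\<^sup>2) \<le> y"
  shows "ennreal (((X q \<omega> - X r \<omega>) - (I q \<omega> - I r \<omega>))\<^sup>2) \<le> ennreal (t - r) * growth_integral r t y \<omega>"
proof -
  have sub: "set_integrable lborel A (\<lambda>s. b s \<omega>)" if "A \<in> sets borel" "A \<subseteq> {0..T}" for A
    by (rule set_integrable_subset[OF int]) (use that in auto)
  have int_rq: "set_integrable lborel {r<..q} (\<lambda>s. b s \<omega>)"
    by (rule sub) (use rq in auto)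
  have "(LINT s:{0..q}|lborel. b s \<omega>) = (LINT s:{0..r} \<union> {r<..q}|lborel. b s \<omega>)"
    using rq by (simp add: ivl_disj_un)
  also have "\<dots> = (LINT s:{0..r}|lborel. b s \<omega>) + (LINT s:{r<..q}|lborel. b s \<omega>)"
    using rq by (intro set_integral_Un sub) auto
  finally have "(X q \<omega> - X r \<omega>) - (I q \<omega> - I r \<omega>) = (LINT s:{r<..q}|lborel. b s \<omega>)"
    using eq rq by auto
  then have "ennreal (((X q \<omega> - X r \<omega>) - (I q \<omega> - I r \<omega>))\<^sup>2) = (ennreal \<bar>LINT s:{r<..q}|lborel. b s \<omega>\<bar>)\<^sup>2"
    by (simp add: ennreal_power)
  also have "\<dots> \<le> (\<integral>\<^sup>+s\<in>{r<..q}. ennreal \<bar>b s \<omega>\<bar> \<partial>lborel)\<^sup>2"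
  proof (rule power_mono)
    have "ennreal \<bar>LINT s:{r<..q}|lborel. b s \<omega>\<bar> \<le> (\<integral>\<^sup>+s. ennreal (norm (indicator {r<..q} s *\<^sub>R b s \<omega>)) \<partial>lborel)"
      using integral_norm_bound_ennreal[of lborel "\<lambda>s. indicator {r<..q} s *\<^sub>R b s \<omega>"] int_rq
      unfolding set_integrable_def set_lebesgue_integral_def by auto
    also have "\<dots> = (\<integral>\<^sup>+s\<in>{r<..q}. ennreal \<bar>b s \<omega>\<bar> \<partial>lborel)"
      by (intro nn_integral_cong) (auto simp: indicator_def)
    finally show "ennreal \<bar>LINT s:{r<..q}|lborel. b s \<omega>\<bar> \<le> (\<integral>\<^sup>+s\<in>{r<..q}. ennreal \<bar>b s \<omega>\<bar> \<partial>lborel)" .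
  qed simp
  also have "\<dots> \<le> ennreal (q - r) * (\<integral>\<^sup>+s\<in>{r<..q}. (ennreal \<bar>b s \<omega>\<bar>)\<^sup>2 \<partial>lborel)"
  proof (rule nn_integral_set_Cauchy_Schwarz)
    have "(\<lambda>s. indicator {r<..q} s *\<^sub>R b s \<omega>) \<in> borel_measurable borel"
      using int_rq unfolding set_integrable_def by (auto dest: borel_measurable_integrable)
    then have m: "(\<lambda>s. ennreal \<bar>indicator {r<..q} s *\<^sub>R b s \<omega>\<bar>) \<in> borel_measurable borel" by measurable
    have eq: "(\<lambda>s. ennreal \<bar>b s \<omega>\<bar> * indicator {r<..q} s) = (\<lambda>s. ennreal \<bar>indicator {r<..q} s *\<^sub>R b s \<omega>\<bar>)"
      by (auto simp: indicator_def fun_eq_iff)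
    show "(\<lambda>s. ennreal \<bar>b s \<omega>\<bar> * indicator {r<..q} s) \<in> borel_measurable borel"
      unfolding eq by (rule m)
  qed (rule rq)
  also have "\<dots> \<le> ennreal (t - r) * (\<integral>\<^sup>+s\<in>{r..t}. growth_const * (1 + sup_sq r \<omega> + y + ennreal ((h s \<omega>)\<^sup>2)) \<partial>lborel)"
  proof (rule mult_mono)
    show "ennreal (q - r) \<le> ennreal (t - r)" using rq by (intro ennreal_leI) simp
    show "(\<integral>\<^sup>+s\<in>{r<..q}. (ennreal \<bar>b s \<omega>\<bar>)\<^sup>2 \<partial>lborel)
      \<le> (\<integral>\<^sup>+s\<in>{r..t}. growth_const * (1 + sup_sq r \<omega> + y + ennreal ((h s \<omega>)\<^sup>2)) \<partial>lborel)"
    proof (rule nn_integral_mono)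
      fix s
      show "(ennreal \<bar>b s \<omega>\<bar>)\<^sup>2 * indicator {r<..q} s
        \<le> growth_const * (1 + sup_sq r \<omega> + y + ennreal ((h s \<omega>)\<^sup>2)) * indicator {r..t} s"
      proof (cases "s \<in> {r<..q}")
        case True
        then have "ennreal ((b s \<omega>)\<^sup>2) \<le> growth_const * (1 + sup_sq r \<omega> + y + ennreal ((h s \<omega>)\<^sup>2))"
          using rq by (intro coefficient_bound(2)[OF \<omega>] y) auto
        then show ?thesis using True rq by (simp add: ennreal_power)
      qed simp
    qed
  qed simp_all
  finally show ?thesis using integral_growth[OF rq(1) order_trans[OF rq(2,3)] \<omega>] by simp
qed

end

section \<open>Closing the moment estimate on short intervals\<close>

context linear_growth_equation
begin

text \<open>Chosen so that \<open>32 * growth_const * step\<close> is 1/2, the absorption factor in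
  \<open>stopped_oscillation\<close>. There 32 is 8, from the maximal inequality, times 4, from the
  pathwise estimate of the oscillation of \<open>X\<close>.\<close>

definition step :: real where
  "step = 1 / (256 * C\<^sup>2)"

lemma step_bounds: "0 < step" "step \<le> 1" "32 * (4 * C\<^sup>2) * step = 1/2"
proof -
  have "1\<^sup>2 \<le> C\<^sup>2" using C_ge_1 by (intro power_mono) auto
  then have C2: "0 < 256 * C\<^sup>2" "1 \<le> 256 * C\<^sup>2" by auto
  show "0 < step" using C2(1) unfolding step_def by simp
  show "step \<le> 1" using C2 unfolding step_def by (subst divide_le_eq_1_pos) auto
  show "32 * (4 * C\<^sup>2) * step = 1/2" using C2(1) unfolding step_def by simp
qed

lemma growth_const_step:
  assumes "0 \<le> e" "e \<le> step"
  shows "32 * growth_const * ennreal e \<le> ennreal (1/2)"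
proof -
  have "32 * growth_const * ennreal e = ennreal (32 * (4 * C\<^sup>2) * e)"
    unfolding growth_const_def using assms(1) by (simp add: ennreal_mult' ennreal_mult)
  also have "\<dots> \<le> ennreal (32 * (4 * C\<^sup>2) * step)"
    using assms(2) by (intro ennreal_leI mult_left_mono) auto
  finally show ?thesis unfolding step_bounds(3) .
qed

lemma growth_integral_eq:
  "growth_integral r t y \<omega> = growth_integral r t 0 \<omega> + growth_const * ennreal (t - r) * y"
  unfolding growth_integral_def by (simp add: distrib_left mult.assoc add_ac)

lemma growth_integral_measurable [measurable]:
  "0 \<le> r \<Longrightarrow> growth_integral r t y \<in> borel_measurable M"
  unfolding growth_integral_def[abs_def] by measurable

lemma expectation_growth_integral:
  assumes "0 \<le> r" "r \<le> t" "t \<le> T"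
  shows "(\<integral>\<^sup>+\<omega>. growth_integral r t 0 \<omega> \<partial>M)
    \<le> growth_const * ennreal (t - r) * (1 + (\<integral>\<^sup>+\<omega>. sup_sq r \<omega> \<partial>M) + ennreal C)"
proof -
  have "(\<integral>\<^sup>+\<omega>. growth_integral r t 0 \<omega> \<partial>M)
    = growth_const * (ennreal (t - r) * (1 + (\<integral>\<^sup>+\<omega>. sup_sq r \<omega> \<partial>M)) + (\<integral>\<^sup>+\<omega>. h_energy r t \<omega> \<partial>M))"
    unfolding growth_integral_def using assms(1)
    by (simp add: nn_integral_cmult nn_integral_add emeasure_space_1)
  also have "\<dots> \<le> growth_const * (ennreal (t - r) * (1 + (\<integral>\<^sup>+\<omega>. sup_sq r \<omega> \<partial>M)) + ennreal (t - r) * ennreal C)"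
    using expectation_h_energy[OF assms] assms C_ge_1
    by (intro mult_left_mono add_left_mono) (simp_all add: ennreal_mult' mult.commute)
  finally show ?thesis by (simp add: distrib_left mult.assoc)
qed

text \<open>Everything is stopped when \<open>\<integral> a\<^sup>2\<close> reaches \<open>K\<close>: this makes the second moment of the oscillation finite,
  so that its contribution to \<open>\<integral> a\<^sup>2\<close> can be absorbed on a short interval.\<close>

lemma stopped_oscillation:
  assumes r: "0 \<le> r" "r < t" "t \<le> T" "t - r \<le> step" and S: "(\<integral>\<^sup>+\<omega>. sup_sq r \<omega> \<partial>M) < \<top>" and K: "0 < K"
  defines "V \<equiv> \<lambda>q \<omega>. \<integral>\<^sup>+s\<in>{r..q}. ennreal ((a s \<omega>)\<^sup>2) \<partial>lborel"
  shows "(\<integral>\<^sup>+\<omega>. (SUP q\<in>dense_pts r t. if V q \<omega> < ennreal K then ennreal ((X q \<omega> - X r \<omega>)\<^sup>2) else 0) \<partial>M)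
    \<le> 72 * growth_const * ennreal (t - r) * (1 + (\<integral>\<^sup>+\<omega>. sup_sq r \<omega> \<partial>M) + ennreal C)"
proof -
  let ?D = "dense_pts r t" and ?e = "ennreal (t - r)"
  have D: "?D \<subseteq> {r..t}" using r by (intro dense_pts_subset) simp
  have e1: "?e \<le> 1" using r step_bounds(2) by (simp add: ennreal_le_1)
  \<comment> \<open>\<open>Y\<close> and \<open>Z\<close> are the stopped oscillations of
    \<open>X\<close> and of the stochastic integral; each time \<open>q\<close> carries its own
    stopping condition.\<close>
  define Y where "Y \<omega> = (SUP q\<in>?D. if V q \<omega> < ennreal K then ennreal ((X q \<omega> - X r \<omega>)\<^sup>2) else 0)" for \<omega>
  define Z where "Z \<omega> = (SUP q\<in>?D. if V q \<omega> < ennreal K then ennreal ((I q \<omega> - I r \<omega>)\<^sup>2) else 0)" for \<omega>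
  have V_m [measurable]: "V q \<in> borel_measurable M" for q
    using ito_variation_measurable[OF ito r(1), of "\<lambda>_. 0" q] by (simp add: V_def)
  have XI_m: "X q \<in> borel_measurable M" "I q \<in> borel_measurable M" if "q \<in> {r..t}" for q
    using that r(1) ito_measurable(1)[OF ito, of q] by auto
  have [measurable]: "Y \<in> borel_measurable M" "Z \<in> borel_measurable M"
  proof -
    have m: "(\<lambda>\<omega>. if V q \<omega> < ennreal K then ennreal ((X q \<omega> - X r \<omega>)\<^sup>2) else 0) \<in> borel_measurable M"
      "(\<lambda>\<omega>. if V q \<omega> < ennreal K then ennreal ((I q \<omega> - I r \<omega>)\<^sup>2) else 0) \<in> borel_measurable M"
      if "q \<in> ?D" for q
    proof -
      have [measurable]: "X q \<in> borel_measurable M" "X r \<in> borel_measurable M"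
          "I q \<in> borel_measurable M" "I r \<in> borel_measurable M"
        using XI_m[of q] XI_m[of r] that D r by auto
      show "(\<lambda>\<omega>. if V q \<omega> < ennreal K then ennreal ((X q \<omega> - X r \<omega>)\<^sup>2) else 0) \<in> borel_measurable M"
        "(\<lambda>\<omega>. if V q \<omega> < ennreal K then ennreal ((I q \<omega> - I r \<omega>)\<^sup>2) else 0) \<in> borel_measurable M"
        by measurable
    qed
    show "Y \<in> borel_measurable M"
      unfolding Y_def[abs_def] by (rule borel_measurable_SUP[OF countable_dense_pts m(1)])
    show "Z \<in> borel_measurable M"
      unfolding Z_def[abs_def] by (rule borel_measurable_SUP[OF countable_dense_pts m(2)])
  qed
  have EZ: "(\<integral>\<^sup>+\<omega>. Z \<omega> \<partial>M) \<le> 8 * (\<integral>\<^sup>+\<omega>. min (V t \<omega>) (ennreal K) \<partial>M)"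
    using ito_maximal[OF ito r(1,2), of "\<lambda>_. 0" ?D K] countable_dense_pts D K by (simp add: Z_def V_def)
  have V_mono: "V s \<omega> \<le> V s' \<omega>" if "s \<le> s'" for s s' \<omega>
    unfolding V_def using that by (intro nn_integral_mono) (auto simp: indicator_def)
  \<comment> \<open>\<open>Y\<close> involves only countably many times. Dense points approach
    \<open>u\<close> from the left, satisfy the stopping condition because \<open>s\<close> does,
    and pass the bound on by continuity of the path.\<close>
  have Y_upper: "ennreal ((X u \<omega> - X r \<omega>)\<^sup>2) \<le> Y \<omega>"
    if \<omega>: "\<omega> \<in> space M" and s: "s \<le> t" "V s \<omega> < ennreal K" and u: "u \<in> {r..s}" for s u \<omega>
  proof -
    obtain v where v: "\<And>k::nat. v k \<in> ?D" "\<And>k. v k \<le> u" "v \<longlonglongrightarrow> u"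
    proof -
      have "r \<le> u" "u \<le> t" using u s by auto
      then show ?thesis by (rule dense_pts_from_below) (rule that)
    qed
    have "(\<lambda>k. X (v k) \<omega>) \<longlonglongrightarrow> X u \<omega>"
    proof (rule continuous_on_tendsto_compose[OF X_continuous[OF \<omega>] v(3)])
      show "u \<in> {0..}" using u r by auto
      show "eventually (\<lambda>k. v k \<in> {0..}) sequentially"
      proof (intro always_eventually allI)
        fix k show "v k \<in> {0..}" using subsetD[OF D v(1)[of k]] r(1) by simp
      qed
    qed
    then have lim: "(\<lambda>k. ennreal ((X (v k) \<omega> - X r \<omega>)\<^sup>2)) \<longlonglongrightarrow> ennreal ((X u \<omega> - X r \<omega>)\<^sup>2)"
      by (intro tendsto_ennrealI tendsto_power tendsto_diff tendsto_const)
    have le: "ennreal ((X (v k) \<omega> - X r \<omega>)\<^sup>2) \<le> Y \<omega>" for k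
    proof -
      have "V (v k) \<omega> \<le> V s \<omega>" using v(2)[of k] u by (intro V_mono) auto
      then have less: "V (v k) \<omega> < ennreal K" using s(2) by (rule order.strict_trans1)
      show ?thesis unfolding Y_def
        by (rule SUP_upper2[OF v(1)[of k]]) (simp only: if_True less order_refl)
    qed
    show ?thesis by (rule LIMSEQ_le_const2[OF lim]) (use le in blast)
  qed
  \<comment> \<open>Pathwise finiteness comes from continuity on a compact interval and permits the
    first absorption, which is carried out path by path.\<close>
  have Y_fin: "Y \<omega> < \<top>" if "\<omega> \<in> space M" for \<omega>
  proof -
    have "Y \<omega> \<le> osc_sq r t \<omega>" unfolding Y_def osc_sq_def
    proof (rule SUP_least)
      fix q assume "q \<in> ?D"
      then have "ennreal ((X q \<omega> - X r \<omega>)\<^sup>2) \<le> (SUP u\<in>{r..t}. ennreal ((X u \<omega> - X r \<omega>)\<^sup>2))"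
        using D by (intro SUP_upper) auto
      then show "(if V q \<omega> < ennreal K then ennreal ((X q \<omega> - X r \<omega>)\<^sup>2) else 0)
        \<le> (SUP u\<in>{r..t}. ennreal ((X u \<omega> - X r \<omega>)\<^sup>2))" by (cases "V q \<omega> < ennreal K") simp_all
    qed
    also have "\<dots> < \<top>" by (rule osc_sq_finite[OF r(1) that])
    finally show ?thesis .
  qed
  let ?R = "\<lambda>\<omega>. growth_integral r t 0 \<omega>"
  \<comment> \<open>The increment of \<open>X\<close> is that of the integral plus the drift. The
    drift bound contains \<open>Y \<omega>\<close> again, with a factor of at most 1/2 on a short
    interval, and is absorbed at this point.\<close>
  have Y_le: "AE \<omega> in M. Y \<omega> \<le> 4 * Z \<omega> + 4 * ?R \<omega>"
    using equation b_integrable AE_space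
  proof eventually_elim
    case (elim \<omega>)
    let ?G = "growth_integral r t (Y \<omega>) \<omega>"
    have "Y \<omega> \<le> 2 * Z \<omega> + 2 * (?e * ?G)"
      unfolding Y_def
    proof (rule SUP_least)
      fix q assume q: "q \<in> ?D"
      then have rq: "r \<le> q" "q \<le> t" using D by auto
      show "(if V q \<omega> < ennreal K then ennreal ((X q \<omega> - X r \<omega>)\<^sup>2) else 0)
        \<le> 2 * Z \<omega> + 2 * (?e * growth_integral r t (SUP q\<in>?D. if V q \<omega> < ennreal K then ennreal ((X q \<omega> - X r \<omega>)\<^sup>2) else 0) \<omega>)"
        unfolding Y_def[symmetric]
      proof (cases "V q \<omega> < ennreal K")
        case True
        have "ennreal ((I q \<omega> - I r \<omega>)\<^sup>2) \<le> Z \<omega>"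
          unfolding Z_def by (rule SUP_upper2[OF q]) (use True in \<open>simp only: if_True\<close>)
        moreover have "ennreal (((X q \<omega> - X r \<omega>) - (I q \<omega> - I r \<omega>))\<^sup>2) \<le> ?e * ?G"
          by (rule drift_bound[OF elim(3) r(1) rq r(3) elim(1,2) Y_upper[OF elim(3) rq(2) True]])
        ultimately have "2 * ennreal ((I q \<omega> - I r \<omega>)\<^sup>2) + 2 * ennreal (((X q \<omega> - X r \<omega>) - (I q \<omega> - I r \<omega>))\<^sup>2)
            \<le> 2 * Z \<omega> + 2 * (?e * ?G)"
          by (intro add_mono mult_left_mono) simp_all
        moreover have "ennreal ((X q \<omega> - X r \<omega>)\<^sup>2)
          \<le> 2 * ennreal ((I q \<omega> - I r \<omega>)\<^sup>2) + 2 * ennreal (((X q \<omega> - X r \<omega>) - (I q \<omega> - I r \<omega>))\<^sup>2)"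
          using ennreal_sq_add_le[of "I q \<omega> - I r \<omega>" "(X q \<omega> - X r \<omega>) - (I q \<omega> - I r \<omega>)"] by simp
        ultimately have "ennreal ((X q \<omega> - X r \<omega>)\<^sup>2) \<le> 2 * Z \<omega> + 2 * (?e * ?G)"
          by (rule order_trans[rotated])
        then show "(if V q \<omega> < ennreal K then ennreal ((X q \<omega> - X r \<omega>)\<^sup>2) else 0) \<le> 2 * Z \<omega> + 2 * (?e * ?G)"
          using True by (simp only: if_True)
      qed simp
    qed
    also have "?e * ?G \<le> ?R \<omega> + growth_const * ?e * Y \<omega>"
      using mult_right_mono[OF e1, of ?G] by (simp add: growth_integral_eq[of r t "Y \<omega>"])
    finally have "Y \<omega> \<le> (2 * Z \<omega> + 2 * ?R \<omega>) + (2 * growth_const * ?e) * Y \<omega>"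
      by (simp add: distrib_left mult.assoc add_ac mult_left_mono)
    moreover have "2 * growth_const * ?e \<le> ennreal (1/2)"
    proof -
      have "2 * growth_const * ?e \<le> 32 * growth_const * ?e"
        by (intro mult_right_mono) (auto intro: ennreal_leI)
      also have "\<dots> \<le> ennreal (1/2)" using r by (intro growth_const_step) auto
      finally show ?thesis .
    qed
    ultimately have "Y \<omega> \<le> 2 * (2 * Z \<omega> + 2 * ?R \<omega>)"
      using Y_fin[OF elim(3)] by (rule ennreal_absorb_half)
    then show ?case by (simp add: distrib_left mult.assoc[symmetric])
  qed
  have V_fin: "AE \<omega> in M. V t \<omega> < \<top>"
  proof -
    have "AE \<omega> in M. (\<integral>\<^sup>+s\<in>{0..t}. ennreal ((a s \<omega>)\<^sup>2) \<partial>lborel) < \<infinity>"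
      using ito r by (simp add: is_ito_integral_def)
    then show ?thesis
    proof eventually_elim
      case (elim \<omega>)
      have "V t \<omega> \<le> (\<integral>\<^sup>+s\<in>{0..t}. ennreal ((a s \<omega>)\<^sup>2) \<partial>lborel)"
        unfolding V_def using r by (intro nn_integral_mono) (auto simp: indicator_def)
      then show ?case using elim by (simp add: order.strict_trans1)
    qed
  qed
  \<comment> \<open>By \<open>min_integral_le_stopped\<close> it suffices to integrate the square of
    the coefficient over the times before the level is reached, and at those times \<open>Y\<close>
    bounds the oscillation.\<close>
  have V_le: "AE \<omega> in M. min (V t \<omega>) (ennreal K) \<le> ?R \<omega> + growth_const * ?e * Y \<omega>"
    using V_fin AE_space
  proof eventually_elim
    case (elim \<omega>)
    let ?a = "\<lambda>s. indicator {0..} s * a s \<omega>"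
    have [measurable]: "?a \<in> borel_measurable borel"
      using measurable_compose[OF measurable_Pair2'[OF elim(2)] ito_measurable(3)[OF ito]] by simp
    have V_eq: "V q \<omega> = (\<integral>\<^sup>+s\<in>{r..q}. ennreal ((?a s)\<^sup>2) \<partial>lborel)" for q
      unfolding V_def using r(1) by (intro nn_integral_cong) (auto simp: indicator_def)
    have "min (V t \<omega>) (ennreal K) \<le> (\<integral>\<^sup>+s\<in>{r..t}. (if V s \<omega> < ennreal K then ennreal ((?a s)\<^sup>2) else 0) \<partial>lborel)"
      unfolding V_eq using elim(1) r K by (intro min_integral_le_stopped) (simp_all add: V_eq)
    also have "\<dots> \<le> (\<integral>\<^sup>+s\<in>{r..t}. growth_const * (1 + sup_sq r \<omega> + Y \<omega> + ennreal ((h s \<omega>)\<^sup>2)) \<partial>lborel)"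
    proof (intro nn_integral_mono)
      fix s
      show "(if V s \<omega> < ennreal K then ennreal ((?a s)\<^sup>2) else 0) * indicator {r..t} s
        \<le> growth_const * (1 + sup_sq r \<omega> + Y \<omega> + ennreal ((h s \<omega>)\<^sup>2)) * indicator {r..t} s"
      proof (cases "s \<in> {r..t} \<and> V s \<omega> < ennreal K")
        case True
        then have s: "r \<le> s" "s \<le> t" "V s \<omega> < ennreal K" by auto
        have "ennreal ((a s \<omega>)\<^sup>2) \<le> growth_const * (1 + sup_sq r \<omega> + Y \<omega> + ennreal ((h s \<omega>)\<^sup>2))"
          using s r by (intro coefficient_bound(1)[OF elim(2)] Y_upper[OF elim(2) s(2,3)]) auto
        moreover have "?a s = a s \<omega>" using s r by simp
        ultimately show ?thesis using True by (simp only: if_True indicator_simps(1) mult_1_right)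
      qed (auto split: if_split)
    qed
    also have "\<dots> = growth_integral r t (Y \<omega>) \<omega>"
      using r by (intro integral_growth elim) auto
    finally show ?case by (simp only: growth_integral_eq[of r t "Y \<omega>"])
  qed
  define y where "y = (\<integral>\<^sup>+\<omega>. Y \<omega> \<partial>M)"
  define \<rho> where "\<rho> = (\<integral>\<^sup>+\<omega>. ?R \<omega> \<partial>M)"
  have EV: "(\<integral>\<^sup>+\<omega>. min (V t \<omega>) (ennreal K) \<partial>M) \<le> \<rho> + growth_const * ?e * y"
  proof -
    have "(\<integral>\<^sup>+\<omega>. min (V t \<omega>) (ennreal K) \<partial>M) \<le> (\<integral>\<^sup>+\<omega>. ?R \<omega> + growth_const * ?e * Y \<omega> \<partial>M)"
      by (rule nn_integral_mono_AE[OF V_le])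
    also have "\<dots> = \<rho> + growth_const * ?e * y"
      unfolding \<rho>_def y_def using r by (simp add: nn_integral_add nn_integral_cmult)
    finally show ?thesis .
  qed
  have y_le: "y \<le> 32 * (\<integral>\<^sup>+\<omega>. min (V t \<omega>) (ennreal K) \<partial>M) + 4 * \<rho>"
  proof -
    have "y \<le> (\<integral>\<^sup>+\<omega>. 4 * Z \<omega> + 4 * ?R \<omega> \<partial>M)"
      unfolding y_def by (rule nn_integral_mono_AE[OF Y_le])
    also have "\<dots> = 4 * (\<integral>\<^sup>+\<omega>. Z \<omega> \<partial>M) + 4 * \<rho>"
      unfolding \<rho>_def using r by (simp add: nn_integral_add nn_integral_cmult)
    also have "\<dots> \<le> 4 * (8 * (\<integral>\<^sup>+\<omega>. min (V t \<omega>) (ennreal K) \<partial>M)) + 4 * \<rho>"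
      by (intro add_right_mono mult_left_mono EZ) simp
    finally show ?thesis by (simp add: mult.assoc[symmetric])
  qed
  have \<rho>_le: "\<rho> \<le> growth_const * ?e * (1 + (\<integral>\<^sup>+\<omega>. sup_sq r \<omega> \<partial>M) + ennreal C)"
    unfolding \<rho>_def using r by (intro expectation_growth_integral) auto
  have "\<rho> < \<top>"
    by (rule order.strict_trans1[OF \<rho>_le]) (use S in \<open>auto simp: growth_const_def ennreal_mult_less_top\<close>)
  moreover have "(\<integral>\<^sup>+\<omega>. min (V t \<omega>) (ennreal K) \<partial>M) < \<top>"
  proof -
    have "(\<integral>\<^sup>+\<omega>. min (V t \<omega>) (ennreal K) \<partial>M) \<le> (\<integral>\<^sup>+\<omega>. ennreal K \<partial>M)"
      by (intro nn_integral_mono) simp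
    also have "\<dots> < \<top>" by (simp add: emeasure_space_1)
    finally show ?thesis .
  qed
  \<comment> \<open>Truncation at \<open>K\<close> gives finiteness here and so permits the second
    absorption, now for expectations. The resulting constant 72 is twice 32 + 4 and free of
    \<open>K\<close>.\<close>
  ultimately have "y < \<top>"
    by (intro order.strict_trans1[OF y_le]) (simp add: ennreal_mult_less_top)
  moreover have "y \<le> 36 * \<rho> + (32 * growth_const * ?e) * y"
  proof -
    have "y \<le> 32 * (\<rho> + growth_const * ?e * y) + 4 * \<rho>"
      by (rule order_trans[OF y_le]) (intro add_right_mono mult_left_mono EV, simp)
    also have "\<dots> = (32 + 4) * \<rho> + (32 * growth_const * ?e) * y"
      by (simp only: distrib_left distrib_right mult.assoc add_ac)
    finally show ?thesis by simp
  qed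
  moreover have "32 * growth_const * ?e \<le> ennreal (1/2)"
    using r by (intro growth_const_step) auto
  ultimately have "y \<le> 2 * (36 * \<rho>)" by (intro ennreal_absorb_half)
  also have "\<dots> = 72 * \<rho>" by (simp add: mult.assoc[symmetric])
  also have "\<dots> \<le> 72 * (growth_const * ?e * (1 + (\<integral>\<^sup>+\<omega>. sup_sq r \<omega> \<partial>M) + ennreal C))"
    by (intro mult_left_mono \<rho>_le) simp
  finally show ?thesis unfolding y_def Y_def by (simp only: mult.assoc)
qed

text \<open>The stopped estimate is uniform in \<open>K\<close>, and on almost every path the
  integral of the squared coefficient is finite, so that stopping has no effect for large
  \<open>K\<close>. Levels \<open>Suc K\<close> keep the level positive.\<close>

lemma oscillation_bound:
  assumes r: "0 \<le> r" "r < t" "t \<le> T" "t - r \<le> step" and S: "(\<integral>\<^sup>+\<omega>. sup_sq r \<omega> \<partial>M) < \<top>"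
  shows "(\<integral>\<^sup>+\<omega>. osc_sq r t \<omega> \<partial>M)
    \<le> 72 * growth_const * ennreal (t - r) * (1 + (\<integral>\<^sup>+\<omega>. sup_sq r \<omega> \<partial>M) + ennreal C)"
proof -
  let ?D = "dense_pts r t"
  let ?V = "\<lambda>q \<omega>. \<integral>\<^sup>+s\<in>{r..q}. ennreal ((a s \<omega>)\<^sup>2) \<partial>lborel"
  define Y where "Y K \<omega> = (SUP q\<in>?D. if ?V q \<omega> < ennreal (real (Suc K)) then ennreal ((X q \<omega> - X r \<omega>)\<^sup>2) else 0)" for K \<omega>
  have D: "?D \<subseteq> {r..t}" using r by (intro dense_pts_subset) simp
  have [measurable]: "?V q \<in> borel_measurable M" for q
    using ito_variation_measurable[OF ito r(1), of "\<lambda>_. 0" q] by simp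
  have Y_m: "Y K \<in> borel_measurable M" for K
    unfolding Y_def[abs_def]
  proof (intro borel_measurable_SUP countable_dense_pts)
    fix q assume "q \<in> ?D"
    then have [measurable]: "X q \<in> borel_measurable M" "X r \<in> borel_measurable M" using D r by auto
    show "(\<lambda>\<omega>. if ?V q \<omega> < ennreal (real (Suc K)) then ennreal ((X q \<omega> - X r \<omega>)\<^sup>2) else 0) \<in> borel_measurable M"
      by measurable
  qed
  have "(\<integral>\<^sup>+\<omega>. osc_sq r t \<omega> \<partial>M) \<le> (\<integral>\<^sup>+\<omega>. (SUP K. Y K \<omega>) \<partial>M)"
  proof (rule nn_integral_mono_AE)
    have "AE \<omega> in M. (\<integral>\<^sup>+s\<in>{0..t}. ennreal ((a s \<omega>)\<^sup>2) \<partial>lborel) < \<infinity>"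
      using ito r by (simp add: is_ito_integral_def)
    then show "AE \<omega> in M. osc_sq r t \<omega> \<le> (SUP K. Y K \<omega>)"
      using AE_space
    proof eventually_elim
      case (elim \<omega>)
      then obtain v where v: "(\<integral>\<^sup>+s\<in>{0..t}. ennreal ((a s \<omega>)\<^sup>2) \<partial>lborel) = ennreal v" "0 \<le> v"
        by (cases "\<integral>\<^sup>+s\<in>{0..t}. ennreal ((a s \<omega>)\<^sup>2) \<partial>lborel") auto
      obtain K :: nat where K: "v < real K" using reals_Archimedean2 by blast
      have V_less: "?V q \<omega> < ennreal (real (Suc K))" if "q \<in> ?D" for q
      proof -
        have "?V q \<omega> \<le> (\<integral>\<^sup>+s\<in>{0..t}. ennreal ((a s \<omega>)\<^sup>2) \<partial>lborel)"
          using that D r by (intro nn_integral_mono) (fastforce simp: indicator_def)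
        also have "\<dots> < ennreal (real (Suc K))"
          unfolding v(1) using v(2) K by (intro ennreal_lessI) auto
        finally show ?thesis .
      qed
      have "osc_sq r t \<omega> = (SUP u\<in>?D. ennreal ((X u \<omega> - X r \<omega>)\<^sup>2))"
        using r elim by (intro osc_sq_dense) auto
      also have "\<dots> = Y K \<omega>"
        unfolding Y_def by (intro SUP_cong refl) (simp only: V_less if_True)
      also have "\<dots> \<le> (SUP K. Y K \<omega>)" by (rule SUP_upper) simp
      finally show ?case .
    qed
  qed
  also have "\<dots> = (SUP K. \<integral>\<^sup>+\<omega>. Y K \<omega> \<partial>M)"
  proof (rule nn_integral_monotone_convergence_SUP[OF _ Y_m])
    show "incseq Y"
    proof (intro incseq_SucI le_funI)
      fix K \<omega>
      have le: "ennreal (real (Suc K)) \<le> ennreal (real (Suc (Suc K)))" by (intro ennreal_leI) simp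
      show "Y K \<omega> \<le> Y (Suc K) \<omega>"
        unfolding Y_def
      proof (intro SUP_mono bexI)
        fix q assume "q \<in> ?D"
        then show "q \<in> ?D" .
        show "(if ?V q \<omega> < ennreal (real (Suc K)) then ennreal ((X q \<omega> - X r \<omega>)\<^sup>2) else 0)
          \<le> (if ?V q \<omega> < ennreal (real (Suc (Suc K))) then ennreal ((X q \<omega> - X r \<omega>)\<^sup>2) else 0)"
        proof (cases "?V q \<omega> < ennreal (real (Suc K))")
          case True
          then have "?V q \<omega> < ennreal (real (Suc (Suc K)))" by (rule less_le_trans[OF _ le])
          then show ?thesis using True by (simp only: if_True)
        qed simp
      qed
    qed
  qed
  also have "\<dots> \<le> 72 * growth_const * ennreal (t - r) * (1 + (\<integral>\<^sup>+\<omega>. sup_sq r \<omega> \<partial>M) + ennreal C)"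
    unfolding Y_def by (intro SUP_least stopped_oscillation r S) simp
  finally show ?thesis .
qed

lemma sup_sq_mono: "r \<le> t \<Longrightarrow> sup_sq r \<omega> \<le> sup_sq t \<omega>"
  unfolding sup_sq_def by (intro SUP_subset_mono) auto

text \<open>Induction over intervals of length \<open>step\<close> takes the place of Gronwall's
  inequality: a finite second moment at the beginning of an interval yields one at its end, and
  finitely many intervals reach \<open>T\<close>.\<close>

lemma sup_sq_finite: "(\<integral>\<^sup>+\<omega>. sup_sq T \<omega> \<partial>M) < \<top>"
proof -
  have "\<forall>r. 0 \<le> r \<and> r \<le> T \<and> r \<le> real k * step \<longrightarrow> (\<integral>\<^sup>+\<omega>. sup_sq r \<omega> \<partial>M) < \<top>" for k
  proof (induction k)
    case 0
    \<comment> \<open>The start is deterministic: the stochastic integral vanishes at 0, and the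
      drift is integrated over a single point.\<close>
    have "AE \<omega> in M. sup_sq 0 \<omega> = ennreal (x\<^sup>2)"
      using equation ito_integral_zero[OF ito]
    proof eventually_elim
      case (elim \<omega>)
      have "AE s in lborel. s \<noteq> (0::real)" by (rule AE_lborel_singleton)
      then have "AE s in lborel. indicator {0..0} s *\<^sub>R b s \<omega> = 0" by eventually_elim simp
      then have "(LINT s:{0..0}|lborel. b s \<omega>) = 0"
        unfolding set_lebesgue_integral_def by (rule integral_eq_zero_AE)
      then have "X 0 \<omega> = x" using elim by simp
      then show ?case by (simp add: sup_sq_def)
    qed
    then have "(\<integral>\<^sup>+\<omega>. sup_sq 0 \<omega> \<partial>M) = (\<integral>\<^sup>+\<omega>. ennreal (x\<^sup>2) \<partial>M)" by (rule nn_integral_cong_AE)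
    also have "\<dots> < \<top>" by (simp add: emeasure_space_1)
    finally show ?case by (auto simp: order_antisym_conv)
  next
    case (Suc k)
    show ?case
    proof (intro allI impI)
      fix t assume t: "0 \<le> t \<and> t \<le> T \<and> t \<le> real (Suc k) * step"
      show "(\<integral>\<^sup>+\<omega>. sup_sq t \<omega> \<partial>M) < \<top>"
      proof (cases "t \<le> real k * step")
        case True
        then show ?thesis using Suc t by auto
      next
        case False
        define r where "r = real k * step"
        have r: "0 \<le> r" "r < t" "t \<le> T" "t - r \<le> step"
          using False t step_bounds(1) by (auto simp: r_def distrib_right)
        have fin: "(\<integral>\<^sup>+\<omega>. sup_sq r \<omega> \<partial>M) < \<top>" using Suc r by (auto simp: r_def)
        have osc: "(\<integral>\<^sup>+\<omega>. osc_sq r t \<omega> \<partial>M) < \<top>"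
          by (rule order.strict_trans1[OF oscillation_bound[OF r fin]])
            (use fin in \<open>simp add: growth_const_def ennreal_mult_less_top\<close>)
        have "sup_sq t \<omega> \<le> 2 * sup_sq r \<omega> + 2 * osc_sq r t \<omega>" for \<omega>
          unfolding sup_sq_def[of t]
        proof (rule SUP_least)
          fix u assume u: "u \<in> {0..t}"
          show "ennreal ((X u \<omega>)\<^sup>2) \<le> 2 * sup_sq r \<omega> + 2 * osc_sq r t \<omega>"
          proof (cases "u \<le> r")
            case True
            then have "ennreal ((X u \<omega>)\<^sup>2) \<le> sup_sq r \<omega>" unfolding sup_sq_def using u by (intro SUP_upper) auto
            also have "\<dots> \<le> 2 * sup_sq r \<omega> + 2 * osc_sq r t \<omega>"
              by (simp add: mult_2 add_increasing2 add.assoc)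
            finally show ?thesis .
          next
            case False
            have "ennreal ((X u \<omega>)\<^sup>2) \<le> 2 * ennreal ((X r \<omega>)\<^sup>2) + 2 * ennreal ((X u \<omega> - X r \<omega>)\<^sup>2)"
              using ennreal_sq_add_le[of "X r \<omega>" "X u \<omega> - X r \<omega>"] by simp
            also have "\<dots> \<le> 2 * sup_sq r \<omega> + 2 * osc_sq r t \<omega>"
              unfolding sup_sq_def osc_sq_def using r u False
              by (intro add_mono mult_left_mono SUP_upper) auto
            finally show ?thesis .
          qed
        qed
        then have "(\<integral>\<^sup>+\<omega>. sup_sq t \<omega> \<partial>M) \<le> (\<integral>\<^sup>+\<omega>. 2 * sup_sq r \<omega> + 2 * osc_sq r t \<omega> \<partial>M)"
          by (intro nn_integral_mono)
        also have "\<dots> = 2 * (\<integral>\<^sup>+\<omega>. sup_sq r \<omega> \<partial>M) + 2 * (\<integral>\<^sup>+\<omega>. osc_sq r t \<omega> \<partial>M)"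
          using r by (simp add: nn_integral_add nn_integral_cmult)
        also have "\<dots> < \<top>" using fin osc by (simp add: ennreal_mult_less_top)
        finally show ?thesis .
      qed
    qed
  qed
  moreover obtain k :: nat where "T / step < real k" using reals_Archimedean2 by blast
  then have "T \<le> real k * step" using step_bounds(1) by (simp add: pos_divide_less_eq less_imp_le)
  ultimately show ?thesis using T_pos by auto
qed

text \<open>Once the supremum up to \<open>T\<close> has a finite second moment, the constants can
  be chosen independently of \<open>r\<close>. The drift gains a further factor \<open>t - r\<close>
  over the oscillation by \<open>drift_bound\<close>.\<close>

lemma increment_estimates:
  obtains c where "0 < c"
    and "\<And>r t. 0 \<le> r \<Longrightarrow> r < t \<Longrightarrow> t \<le> T \<Longrightarrow> t - r \<le> step \<Longrightarrow>
      (\<integral>\<^sup>+\<omega>. osc_sq r t \<omega> \<partial>M) \<le> ennreal (c * (t - r))"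
    and "\<And>r t. 0 \<le> r \<Longrightarrow> r < t \<Longrightarrow> t \<le> T \<Longrightarrow> t - r \<le> step \<Longrightarrow>
      (\<integral>\<^sup>+\<omega>. ennreal (((X t \<omega> - X r \<omega>) - (I t \<omega> - I r \<omega>))\<^sup>2) \<partial>M) \<le> ennreal (c * (t - r)\<^sup>2)"
proof -
  define m where "m = enn2real (\<integral>\<^sup>+\<omega>. sup_sq T \<omega> \<partial>M)"
  have m: "(\<integral>\<^sup>+\<omega>. sup_sq T \<omega> \<partial>M) = ennreal m" "0 \<le> m"
    using sup_sq_finite by (simp_all add: m_def)
  define c1 where "c1 = 72 * (4 * C\<^sup>2) * (1 + m + C)"
  \<comment> \<open>The summand \<open>c1\<close> stands for the oscillation in the growth bound;
    the interval has length at most 1, so \<open>c1 * (t - r)\<close> is at most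
    \<open>c1\<close>.\<close>
  define c2 where "c2 = 4 * C\<^sup>2 * (1 + m + C + c1)"
  have c: "0 < c1" "0 < c2" using m C_ge_1 by (auto simp: c1_def c2_def intro!: mult_pos_pos add_pos_nonneg)
  have S_le: "(\<integral>\<^sup>+\<omega>. sup_sq r \<omega> \<partial>M) \<le> ennreal m" if "r \<le> T" for r
    unfolding m(1)[symmetric] by (intro nn_integral_mono sup_sq_mono that)
  have S_C: "1 + (\<integral>\<^sup>+\<omega>. sup_sq r \<omega> \<partial>M) + ennreal C \<le> ennreal (1 + m + C)" if "r \<le> T" for r
  proof -
    have "1 + (\<integral>\<^sup>+\<omega>. sup_sq r \<omega> \<partial>M) + ennreal C \<le> 1 + ennreal m + ennreal C"
      by (intro add_right_mono add_left_mono S_le that)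
    also have "\<dots> = ennreal (1 + m + C)" using m C_ge_1 by (simp add: ennreal_1[symmetric] del: ennreal_1)
    finally show ?thesis .
  qed
  have osc: "(\<integral>\<^sup>+\<omega>. osc_sq r t \<omega> \<partial>M) \<le> ennreal (c1 * (t - r))"
    if r: "0 \<le> r" "r < t" "t \<le> T" "t - r \<le> step" for r t
  proof -
    have "(\<integral>\<^sup>+\<omega>. sup_sq r \<omega> \<partial>M) < \<top>" using S_le[of r] r by (auto intro: order.strict_trans1)
    from oscillation_bound[OF r this]
    have "(\<integral>\<^sup>+\<omega>. osc_sq r t \<omega> \<partial>M) \<le> 72 * growth_const * ennreal (t - r) * (1 + (\<integral>\<^sup>+\<omega>. sup_sq r \<omega> \<partial>M) + ennreal C)" .
    also have "\<dots> \<le> 72 * growth_const * ennreal (t - r) * ennreal (1 + m + C)"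
      using r by (intro mult_left_mono S_C) auto
    also have "\<dots> = ennreal (c1 * (t - r))"
    proof -
      have "72 * ennreal k * ennreal e * ennreal p = ennreal (72 * k * p * e)"
        if "0 \<le> k" "0 \<le> e" "0 \<le> p" for k e p
        using that by (simp add: ennreal_mult' ennreal_mult mult_ac)
      then show ?thesis unfolding growth_const_def c1_def using r m C_ge_1 by (simp del: ennreal_plus)
    qed
    finally show ?thesis .
  qed
  have drift: "(\<integral>\<^sup>+\<omega>. ennreal (((X t \<omega> - X r \<omega>) - (I t \<omega> - I r \<omega>))\<^sup>2) \<partial>M) \<le> ennreal (c2 * (t - r)\<^sup>2)"
    if r: "0 \<le> r" "r < t" "t \<le> T" "t - r \<le> step" for r t
  proof -
    let ?e = "ennreal (t - r)"
    have "(\<integral>\<^sup>+\<omega>. ennreal (((X t \<omega> - X r \<omega>) - (I t \<omega> - I r \<omega>))\<^sup>2) \<partial>M)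
      \<le> (\<integral>\<^sup>+\<omega>. ?e * (growth_integral r t 0 \<omega> + growth_const * ?e * osc_sq r t \<omega>) \<partial>M)"
    proof (rule nn_integral_mono_AE)
      show "AE \<omega> in M. ennreal (((X t \<omega> - X r \<omega>) - (I t \<omega> - I r \<omega>))\<^sup>2)
        \<le> ?e * (growth_integral r t 0 \<omega> + growth_const * ?e * osc_sq r t \<omega>)"
        using equation b_integrable AE_space
      proof eventually_elim
        case (elim \<omega>)
        have "ennreal ((X u \<omega> - X r \<omega>)\<^sup>2) \<le> osc_sq r t \<omega>" if "u \<in> {r..t}" for u
          unfolding osc_sq_def by (rule SUP_upper[OF that])
        then show ?case
          unfolding growth_integral_eq[of r t "osc_sq r t \<omega>", symmetric]
          using r by (intro drift_bound[OF elim(3) _ _ _ _ elim(1,2)]) auto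
      qed
    qed
    also have "\<dots> = ?e * ((\<integral>\<^sup>+\<omega>. growth_integral r t 0 \<omega> \<partial>M) + growth_const * ?e * (\<integral>\<^sup>+\<omega>. osc_sq r t \<omega> \<partial>M))"
      using r by (simp add: nn_integral_add nn_integral_cmult)
    also have "\<dots> \<le> ?e * (growth_const * ?e * ennreal (1 + m + C) + growth_const * ?e * ennreal c1)"
    proof (intro mult_left_mono add_mono)
      have "(\<integral>\<^sup>+\<omega>. growth_integral r t 0 \<omega> \<partial>M) \<le> growth_const * ?e * (1 + (\<integral>\<^sup>+\<omega>. sup_sq r \<omega> \<partial>M) + ennreal C)"
        using r by (intro expectation_growth_integral) auto
      also have "\<dots> \<le> growth_const * ?e * ennreal (1 + m + C)" using r by (intro mult_left_mono S_C) auto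
      finally show "(\<integral>\<^sup>+\<omega>. growth_integral r t 0 \<omega> \<partial>M) \<le> growth_const * ?e * ennreal (1 + m + C)" .
      have "c1 * (t - r) \<le> c1 * 1" using c r step_bounds(2) by (intro mult_left_mono) auto
      then show "(\<integral>\<^sup>+\<omega>. osc_sq r t \<omega> \<partial>M) \<le> ennreal c1"
        using osc[OF r] by (auto intro: order_trans ennreal_leI)
    qed simp_all
    also have "\<dots> = growth_const * (ennreal (1 + m + C) + ennreal c1) * (?e * ?e)"
      by (simp only: distrib_left distrib_right mult_ac)
    also have "\<dots> = ennreal (c2 * (t - r)\<^sup>2)"
    proof -
      have "ennreal (1 + m + C) + ennreal c1 = ennreal (1 + m + C + c1)"
        using m C_ge_1 c by (intro ennreal_plus[symmetric]) auto
      then show ?thesis unfolding growth_const_def c2_def power2_eq_square[of "t - r"] using m C_ge_1 c r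
        by (simp add: ennreal_mult' ennreal_mult del: ennreal_plus)
    qed
    finally show ?thesis .
  qed
  show ?thesis
  proof (rule that[of "max c1 c2"])
    fix r t assume r: "0 \<le> r" "r < t" "t \<le> T" "t - r \<le> step"
    show "(\<integral>\<^sup>+\<omega>. osc_sq r t \<omega> \<partial>M) \<le> ennreal (max c1 c2 * (t - r))"
      using r by (intro order_trans[OF osc[OF r]] ennreal_leI mult_right_mono) auto
    show "(\<integral>\<^sup>+\<omega>. ennreal (((X t \<omega> - X r \<omega>) - (I t \<omega> - I r \<omega>))\<^sup>2) \<partial>M) \<le> ennreal (max c1 c2 * (t - r)\<^sup>2)"
      using r by (intro order_trans[OF drift[OF r]] ennreal_leI mult_right_mono) auto
  qed (use c in simp)
qed

end

section \<open>Decay of the characteristic function\<close>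

context brownian_motion
begin

lemma char_increment:
  assumes "0 \<le> s" "s < t"
  shows "char (distr M borel (\<lambda>\<omega>. B t \<omega> - B s \<omega>)) u = complex_of_real (exp (- (u\<^sup>2 * (t - s) / 2)))"
proof -
  let ?D = "\<lambda>\<omega>. B t \<omega> - B s \<omega>" and ?\<sigma> = "sqrt (t - s)"
  have \<sigma>: "0 < ?\<sigma>" using assms by simp
  have [measurable]: "B t \<in> borel_measurable M" "B s \<in> borel_measurable M" using assms by auto
  have std: "distributed M lborel (\<lambda>\<omega>. (?D \<omega> - 0) / ?\<sigma>) std_normal_density"
    using normal_increments[OF assms] normal_standard_normal_convert[OF \<sigma>, of ?D 0] by simp
  have "distr M lborel (\<lambda>\<omega>. (?D \<omega> - 0) / ?\<sigma>) = std_normal_distribution"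
    using std by (simp add: distributed_def)
  then have "char std_normal_distribution (?\<sigma> * u) = char (distr M lborel (\<lambda>\<omega>. ?D \<omega> / ?\<sigma>)) (?\<sigma> * u)" by simp
  also have "\<dots> = (CLINT \<omega>|M. iexp (?\<sigma> * u * (?D \<omega> / ?\<sigma>)))"
    unfolding char_def by (rule integral_distr) measurable
  also have "\<dots> = (CLINT \<omega>|M. iexp (u * ?D \<omega>))"
  proof -
    have "?\<sigma> * u * (?D \<omega> / ?\<sigma>) = u * ?D \<omega>" for \<omega> using \<sigma> by simp
    then show ?thesis by (simp only:)
  qed
  also have "\<dots> = char (distr M borel ?D) u"
    unfolding char_def by (rule integral_distr[symmetric]) measurable
  finally show ?thesis
    using assms by (simp add: char_std_normal_distribution power_mult_distrib mult.commute)
qed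

text \<open>The joint law of the past and the increment is a product, so the increment can be
  integrated out for fixed past; this leaves a Gaussian factor in \<open>\<xi> * A\<close>. Where
  \<open>A\<close> may be small the weight \<open>Y\<close> vanishes, and elsewhere the factor is at
  most the claimed exponential.\<close>

lemma norm_expectation_gaussian_le:
  assumes st: "0 \<le> s" "s < t"
    and Y: "Y \<in> borel_measurable (F s)" and Z: "Z \<in> borel_measurable (F s)" and A: "A \<in> borel_measurable (F s)"
    and Y01: "\<And>\<omega>. \<omega> \<in> space M \<Longrightarrow> 0 \<le> Y \<omega> \<and> Y \<omega> \<le> 1"
    and ell: "\<And>\<omega>. \<omega> \<in> space M \<Longrightarrow> Y \<omega> \<noteq> 0 \<Longrightarrow> d \<le> \<bar>A \<omega>\<bar>" and d: "0 \<le> d"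
  shows "cmod (CLINT \<omega>|M. complex_of_real (Y \<omega>) * iexp (\<xi> * (Z \<omega> + A \<omega> * (B t \<omega> - B s \<omega>))))
    \<le> exp (- (d\<^sup>2 * (t - s) / 2 * \<xi>\<^sup>2))"
proof -
  let ?U = "\<lambda>\<omega>. (Y \<omega>, Z \<omega>, A \<omega>)" and ?D = "\<lambda>\<omega>. B t \<omega> - B s \<omega>"
  let ?N = "borel \<Otimes>\<^sub>M borel \<Otimes>\<^sub>M borel :: (real \<times> real \<times> real) measure"
  \<comment> \<open>The weight is clamped to the unit interval, which makes \<open>?f\<close>
    bounded on the whole space and not only on the range of \<open>Y\<close>.\<close>
  let ?f = "\<lambda>(u::real \<times> real \<times> real) w::real.
    complex_of_real (max 0 (min 1 (fst u))) * iexp (\<xi> * (fst (snd u) + snd (snd u) * w))"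
  \<comment> \<open>Padding with zeros brings the increment into the same type as the triple of past
    quantities.\<close>
  let ?g = "\<lambda>w. (w, 0, 0) :: real \<times> real \<times> real"
  have UF: "?U \<in> measurable (F s) ?N" using Y Z A by measurable
  have [measurable]: "?U \<in> measurable M ?N" by (rule measurable_F_imp[OF st(1) UF])
  have [measurable]: "Y \<in> borel_measurable M" "Z \<in> borel_measurable M" "A \<in> borel_measurable M"
    using measurable_F_imp[OF st(1)] Y Z A by auto
  have [measurable]: "?D \<in> borel_measurable M" using st by simp
  have "?g \<in> measurable borel ?N" by measurable
  from indep_var_increment[OF st UF this]
  have prod: "distr M ?N ?U \<Otimes>\<^sub>M distr M ?N (\<lambda>\<omega>. ?g (?D \<omega>)) = distr M (?N \<Otimes>\<^sub>M ?N) (\<lambda>\<omega>. (?U \<omega>, ?g (?D \<omega>)))"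
    unfolding indep_var_distribution_eq by simp
  interpret U: prob_space "distr M ?N ?U" by (rule prob_space_distr) measurable
  interpret D: prob_space "distr M ?N (\<lambda>\<omega>. ?g (?D \<omega>))" by (rule prob_space_distr) measurable
  interpret UD: pair_prob_space "distr M ?N ?U" "distr M ?N (\<lambda>\<omega>. ?g (?D \<omega>))" ..
  have f_m: "(\<lambda>p. ?f (fst p) (fst (snd p))) \<in> borel_measurable (?N \<Otimes>\<^sub>M ?N)" by measurable
  have f_bd: "cmod (?f u w) \<le> 1" for u w by (simp add: norm_mult)
  have int: "integrable (distr M ?N ?U \<Otimes>\<^sub>M distr M ?N (\<lambda>\<omega>. ?g (?D \<omega>))) (\<lambda>p. ?f (fst p) (fst (snd p)))"
  proof (rule UD.P.integrable_const_bound[where B=1])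
    show "AE p in distr M ?N ?U \<Otimes>\<^sub>M distr M ?N (\<lambda>\<omega>. ?g (?D \<omega>)). cmod (?f (fst p) (fst (snd p))) \<le> 1"
      by (intro AE_I2 f_bd)
    show "(\<lambda>p. ?f (fst p) (fst (snd p))) \<in> borel_measurable (distr M ?N ?U \<Otimes>\<^sub>M distr M ?N (\<lambda>\<omega>. ?g (?D \<omega>)))"
      unfolding prod using f_m by simp
  qed
  have "(CLINT \<omega>|M. complex_of_real (Y \<omega>) * iexp (\<xi> * (Z \<omega> + A \<omega> * ?D \<omega>))) = (CLINT \<omega>|M. ?f (?U \<omega>) (?D \<omega>))"
  proof (intro Bochner_Integration.integral_cong refl)
    fix \<omega> assume "\<omega> \<in> space M"
    then have "max 0 (min 1 (Y \<omega>)) = Y \<omega>" using Y01[of \<omega>] by auto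
    then show "complex_of_real (Y \<omega>) * iexp (\<xi> * (Z \<omega> + A \<omega> * ?D \<omega>)) = ?f (?U \<omega>) (?D \<omega>)" by simp
  qed
  also have "\<dots> = (\<integral>p. ?f (fst p) (fst (snd p)) \<partial>distr M (?N \<Otimes>\<^sub>M ?N) (\<lambda>\<omega>. (?U \<omega>, ?g (?D \<omega>))))"
    by (subst integral_distr[OF _ f_m]) simp_all
  also have "\<dots> = (\<integral>u. (\<integral>w. ?f u (fst w) \<partial>distr M ?N (\<lambda>\<omega>. ?g (?D \<omega>))) \<partial>distr M ?N ?U)"
    unfolding prod[symmetric] using UD.integral_fst'[OF int] by simp
  also have "\<dots> = (\<integral>u. (\<integral>w. ?f u w \<partial>distr M borel ?D) \<partial>distr M ?N ?U)"
  proof (intro Bochner_Integration.integral_cong refl)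
    fix u
    have "(\<integral>w. ?f u (fst w) \<partial>distr M ?N (\<lambda>\<omega>. ?g (?D \<omega>))) = (\<integral>\<omega>. ?f u (?D \<omega>) \<partial>M)"
      by (subst integral_distr) simp_all
    also have "\<dots> = (\<integral>w. ?f u w \<partial>distr M borel ?D)"
      by (rule integral_distr[symmetric]) measurable
    finally show "(\<integral>w. ?f u (fst w) \<partial>distr M ?N (\<lambda>\<omega>. ?g (?D \<omega>))) = (\<integral>w. ?f u w \<partial>distr M borel ?D)" .
  qed
  also have "\<dots> = (\<integral>u. complex_of_real (max 0 (min 1 (fst u))) * iexp (\<xi> * fst (snd u)) *
       complex_of_real (exp (- ((\<xi> * snd (snd u))\<^sup>2 * (t - s) / 2))) \<partial>distr M ?N ?U)"
  proof (intro Bochner_Integration.integral_cong refl)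
    fix u :: "real \<times> real \<times> real"
    have "(\<integral>w. ?f u w \<partial>distr M borel ?D)
      = (\<integral>w. complex_of_real (max 0 (min 1 (fst u))) * iexp (\<xi> * fst (snd u)) * iexp (\<xi> * snd (snd u) * w) \<partial>distr M borel ?D)"
      by (intro Bochner_Integration.integral_cong refl) (simp add: exp_add[symmetric] algebra_simps)
    also have "\<dots> = complex_of_real (max 0 (min 1 (fst u))) * iexp (\<xi> * fst (snd u)) * char (distr M borel ?D) (\<xi> * snd (snd u))"
      unfolding char_def by (rule integral_mult_right_zero)
    finally show "(\<integral>w. ?f u w \<partial>distr M borel ?D) = complex_of_real (max 0 (min 1 (fst u))) * iexp (\<xi> * fst (snd u)) *
       complex_of_real (exp (- ((\<xi> * snd (snd u))\<^sup>2 * (t - s) / 2)))"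
      unfolding char_increment[OF st] .
  qed
  also have "\<dots> = (\<integral>\<omega>. complex_of_real (max 0 (min 1 (Y \<omega>))) * iexp (\<xi> * Z \<omega>) *
       complex_of_real (exp (- ((\<xi> * A \<omega>)\<^sup>2 * (t - s) / 2))) \<partial>M)"
    by (subst integral_distr) simp_all
  finally have eq: "(CLINT \<omega>|M. complex_of_real (Y \<omega>) * iexp (\<xi> * (Z \<omega> + A \<omega> * ?D \<omega>)))
     = (\<integral>\<omega>. complex_of_real (max 0 (min 1 (Y \<omega>))) * iexp (\<xi> * Z \<omega>) *
       complex_of_real (exp (- ((\<xi> * A \<omega>)\<^sup>2 * (t - s) / 2))) \<partial>M)" .
  have "cmod (CLINT \<omega>|M. complex_of_real (Y \<omega>) * iexp (\<xi> * (Z \<omega> + A \<omega> * ?D \<omega>)))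
     \<le> (\<integral>\<omega>. cmod (complex_of_real (max 0 (min 1 (Y \<omega>))) * iexp (\<xi> * Z \<omega>) *
       complex_of_real (exp (- ((\<xi> * A \<omega>)\<^sup>2 * (t - s) / 2)))) \<partial>M)"
    unfolding eq by (rule integral_norm_bound)
  also have "\<dots> \<le> (\<integral>\<omega>. exp (- (d\<^sup>2 * (t - s) / 2 * \<xi>\<^sup>2)) \<partial>M)"
  proof (rule Bochner_Integration.integral_mono)
    show "integrable M (\<lambda>\<omega>. cmod (complex_of_real (max 0 (min 1 (Y \<omega>))) * iexp (\<xi> * Z \<omega>) *
       complex_of_real (exp (- ((\<xi> * A \<omega>)\<^sup>2 * (t - s) / 2)))))"
    proof (intro integrable_norm integrable_const_bound[where B=1])
      have "exp (- ((\<xi> * A \<omega>)\<^sup>2 * (t - s) / 2)) \<le> 1" for \<omega> using st by simp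
      then show "AE \<omega> in M. cmod (complex_of_real (max 0 (min 1 (Y \<omega>))) * iexp (\<xi> * Z \<omega>) *
       complex_of_real (exp (- ((\<xi> * A \<omega>)\<^sup>2 * (t - s) / 2)))) \<le> 1"
        by (intro AE_I2) (simp add: norm_mult mult_le_one)
    qed measurable
    fix \<omega> assume \<omega>: "\<omega> \<in> space M"
    have nrm: "cmod (complex_of_real (max 0 (min 1 (Y \<omega>))) * iexp (\<xi> * Z \<omega>) *
       complex_of_real (exp (- ((\<xi> * A \<omega>)\<^sup>2 * (t - s) / 2)))) = Y \<omega> * exp (- ((\<xi> * A \<omega>)\<^sup>2 * (t - s) / 2))"
      using Y01[OF \<omega>] by (simp add: norm_mult min_def max_def)
    also have "\<dots> \<le> exp (- (d\<^sup>2 * (t - s) / 2 * \<xi>\<^sup>2))"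
    proof (cases "Y \<omega> = 0")
      case False
      then have "d\<^sup>2 \<le> \<bar>A \<omega>\<bar>\<^sup>2" using ell[OF \<omega>] d by (intro power_mono) auto
      then have "d\<^sup>2 * ((t - s) / 2 * \<xi>\<^sup>2) \<le> (A \<omega>)\<^sup>2 * ((t - s) / 2 * \<xi>\<^sup>2)"
        using st by (intro mult_right_mono) auto
      then have "exp (- ((\<xi> * A \<omega>)\<^sup>2 * (t - s) / 2)) \<le> exp (- (d\<^sup>2 * (t - s) / 2 * \<xi>\<^sup>2))"
        by (simp add: power_mult_distrib mult_ac)
      moreover have "Y \<omega> * exp (- ((\<xi> * A \<omega>)\<^sup>2 * (t - s) / 2)) \<le> 1 * exp (- ((\<xi> * A \<omega>)\<^sup>2 * (t - s) / 2))"
        using Y01[OF \<omega>] by (intro mult_right_mono) auto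
      ultimately show ?thesis by linarith
    qed simp
    finally show "cmod (complex_of_real (max 0 (min 1 (Y \<omega>))) * iexp (\<xi> * Z \<omega>) *
       complex_of_real (exp (- ((\<xi> * A \<omega>)\<^sup>2 * (t - s) / 2)))) \<le> exp (- (d\<^sup>2 * (t - s) / 2 * \<xi>\<^sup>2))" .
  qed simp
  also have "\<dots> = exp (- (d\<^sup>2 * (t - s) / 2 * \<xi>\<^sup>2))" by (simp add: prob_space)
  finally show ?thesis .
qed

end

section \<open>The elliptic equation and the error of freezing its coefficient\<close>

lemma abs_powr_eq_sq_powr: "\<bar>x\<bar> powr p = (x\<^sup>2) powr (p / 2)" for x :: real
proof -
  have "(x\<^sup>2) powr (p / 2) = (\<bar>x\<bar> powr 2) powr (p / 2)" by simp
  also have "\<dots> = \<bar>x\<bar> powr p" by (subst powr_powr) simp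
  finally show ?thesis by (rule sym)
qed

lemma norm_iexp_diff_le: "cmod (iexp u - iexp v) \<le> \<bar>u - v\<bar>"
proof -
  have "iexp u - iexp v = iexp v * (iexp (u - v) - 1)"
    by (simp add: right_diff_distrib exp_add[symmetric] algebra_simps)
  then have "cmod (iexp u - iexp v) = cmod (iexp (u - v) - 1)" by (simp only: norm_mult norm_exp_i_times mult_1)
  also have "\<dots> \<le> \<bar>u - v\<bar>" using iexp_approx1[of "u - v" 0] by simp
  finally show ?thesis .
qed

lemma power2_sum3_le: "(x + y + z)\<^sup>2 \<le> 3 * (x\<^sup>2 + y\<^sup>2 + z\<^sup>2)" for x y z :: real
proof -
  have "0 \<le> (x - y)\<^sup>2 + (y - z)\<^sup>2 + (x - z)\<^sup>2" by (intro add_nonneg_nonneg) auto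
  then show ?thesis by (simp add: power2_eq_square algebra_simps)
qed

lemma powr_sq: "(x powr p)\<^sup>2 = x powr (2 * p)" for x :: real
  by (simp add: power2_eq_square powr_add[symmetric])

lemma holder_imp_continuous:
  fixes \<sigma> :: "real \<Rightarrow> real"
  assumes holder: "\<And>y z. \<bar>\<sigma> y - \<sigma> z\<bar> \<le> L * \<bar>y - z\<bar> powr \<alpha>" and \<alpha>: "0 < \<alpha>"
  shows "continuous_on UNIV \<sigma>"
proof -
  have "(\<sigma> \<longlongrightarrow> \<sigma> z) (at z)" for z
  proof -
    have "((\<lambda>y. \<bar>y - z\<bar>) \<longlongrightarrow> \<bar>z - z\<bar>) (at z)" by (intro tendsto_intros)
    then have "((\<lambda>y. \<bar>y - z\<bar> powr \<alpha>) \<longlongrightarrow> \<bar>z - z\<bar> powr \<alpha>) (at z)"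
      using \<alpha> by (intro tendsto_powr') auto
    from tendsto_mult[OF tendsto_const this, of L]
    have "((\<lambda>y. L * \<bar>y - z\<bar> powr \<alpha>) \<longlongrightarrow> 0) (at z)" by simp
    then have "((\<lambda>y. \<sigma> y - \<sigma> z) \<longlongrightarrow> 0) (at z)"
      by (rule Lim_null_comparison[rotated]) (simp add: holder)
    then show ?thesis by (simp add: LIM_zero_iff)
  qed
  then show ?thesis by (simp add: continuous_on_eq_continuous_at continuous_at)
qed

text \<open>\<open>k r s\<close> stands for the norm of the increment of \<open>H\<close>, which
  cannot be expressed through the norms \<open>h\<close>. The lower bound on \<kappa> enters only as
  a comparison of \<open>a\<close> with \<open>\<sigma>\<close> along the solution.\<close>

locale elliptic_equation = linear_growth_equation M F B X a b h I x T C
  for M :: "'a measure" and F B X a b h I x T C +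
  fixes \<sigma> :: "real \<Rightarrow> real" and k :: "real \<Rightarrow> real \<Rightarrow> 'a \<Rightarrow> real"
    and L \<alpha> \<eta> \<theta>\<^sub>1 \<theta>\<^sub>2 \<theta>\<^sub>3 \<kappa>\<^sub>0 :: real
  assumes modulus: "\<omega> \<in> space M \<Longrightarrow> 0 \<le> r \<Longrightarrow> r \<le> s \<Longrightarrow> s \<le> T \<Longrightarrow>
      \<bar>a s \<omega> - a r \<omega>\<bar> \<le> C * ((s - r) powr \<theta>\<^sub>1 + (SUP u\<in>{r..s}. \<bar>X u \<omega> - X r \<omega>\<bar> powr \<theta>\<^sub>2) + k r s \<omega> powr \<theta>\<^sub>3)"
    and k_measurable: "0 \<le> r \<Longrightarrow> r \<le> s \<Longrightarrow> s \<le> T \<Longrightarrow> (\<lambda>\<omega>. (k r s \<omega>)\<^sup>2) \<in> borel_measurable M"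
    and k_nonneg: "0 \<le> k r s \<omega>"
    and k_L2: "0 \<le> r \<Longrightarrow> r \<le> s \<Longrightarrow> s \<le> T \<Longrightarrow>
      (\<integral>\<^sup>+\<omega>. ennreal ((k r s \<omega>)\<^sup>2) \<partial>M) \<le> ennreal (C * (s - r) powr \<eta>)"
    and holder: "\<bar>\<sigma> y - \<sigma> z\<bar> \<le> L * \<bar>y - z\<bar> powr \<alpha>"
    and elliptic: "\<omega> \<in> space M \<Longrightarrow> 0 \<le> s \<Longrightarrow> s \<le> T \<Longrightarrow> \<kappa>\<^sub>0 * \<bar>\<sigma> (X s \<omega>)\<bar> \<le> \<bar>a s \<omega>\<bar>"
    and \<kappa>\<^sub>0: "0 < \<kappa>\<^sub>0" and \<alpha>: "1/2 < \<alpha>" "\<alpha> \<le> 1" and \<eta>: "1/2 < \<eta>"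
    and \<theta>: "1/4 < \<theta>\<^sub>1" "1/2 < \<theta>\<^sub>2" "\<theta>\<^sub>2 \<le> 1" "1 / (2 * \<eta>) < \<theta>\<^sub>3" "\<theta>\<^sub>3 \<le> 1"
begin

text \<open>The exponent of the squared L2 modulus of \<open>a\<close>, that is, twice the \<gamma>
  of the frequency bound. The cap at 1 ensures that the squared drift error, of order 2, is no
  larger than order \<open>1 + rate\<close>.\<close>

definition rate :: real where
  "rate = min (min (2 * \<theta>\<^sub>1) \<theta>\<^sub>2) (min (\<eta> * \<theta>\<^sub>3) 1)"

lemma rate_bounds: "1/2 < rate" "rate \<le> 2 * \<theta>\<^sub>1" "rate \<le> \<theta>\<^sub>2" "rate \<le> \<eta> * \<theta>\<^sub>3" "rate \<le> 1"
proof -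
  have "1/2 < \<eta> * \<theta>\<^sub>3" using \<theta>(4) \<eta> by (simp add: divide_less_eq algebra_simps)
  then show "1/2 < rate" "rate \<le> 2 * \<theta>\<^sub>1" "rate \<le> \<theta>\<^sub>2" "rate \<le> \<eta> * \<theta>\<^sub>3" "rate \<le> 1"
    using \<theta> by (auto simp: rate_def)
qed

lemma L_nonneg: "0 \<le> L"
  using order_trans[OF abs_ge_zero holder[of 1 0]] by simp

lemma \<theta>\<^sub>3_pos: "0 < \<theta>\<^sub>3"
proof -
  have "0 < 1 / (2 * \<eta>)" using \<eta> by simp
  then show ?thesis using \<theta>(4) by linarith
qed

lemma \<sigma>_measurable [measurable]: "\<sigma> \<in> borel_measurable borel"
  using holder \<alpha> by (intro borel_measurable_continuous_onI holder_imp_continuous[of \<sigma> L \<alpha>]) auto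

lemma a_measurable: "0 \<le> s \<Longrightarrow> a s \<in> borel_measurable M"
  using ito_measurable(2)[OF ito] measurable_F_imp by blast

lemma modulus_sq:
  assumes \<omega>: "\<omega> \<in> space M" and rs: "0 \<le> r" "r \<le> s" "s \<le> T"
  shows "(a s \<omega> - a r \<omega>)\<^sup>2 \<le> 3 * C\<^sup>2 * ((s - r) powr (2 * \<theta>\<^sub>1)
     + (enn2real (osc_sq r s \<omega>)) powr \<theta>\<^sub>2 + ((k r s \<omega>)\<^sup>2) powr \<theta>\<^sub>3)"
proof -
  let ?o = "enn2real (osc_sq r s \<omega>)"
  have "\<bar>X u \<omega> - X r \<omega>\<bar> powr \<theta>\<^sub>2 \<le> ?o powr (\<theta>\<^sub>2 / 2)" if u: "u \<in> {r..s}" for u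
  proof -
    have "ennreal ((X u \<omega> - X r \<omega>)\<^sup>2) \<le> osc_sq r s \<omega>"
      unfolding osc_sq_def by (rule SUP_upper[OF u])
    then have "enn2real (ennreal ((X u \<omega> - X r \<omega>)\<^sup>2)) \<le> ?o"
      by (rule enn2real_mono[OF _ osc_sq_finite[OF rs(1) \<omega>]])
    then have "(X u \<omega> - X r \<omega>)\<^sup>2 \<le> ?o" by simp
    then show ?thesis unfolding abs_powr_eq_sq_powr using \<theta> by (intro powr_mono2) auto
  qed
  then have "(SUP u\<in>{r..s}. \<bar>X u \<omega> - X r \<omega>\<bar> powr \<theta>\<^sub>2) \<le> ?o powr (\<theta>\<^sub>2 / 2)"
    using rs by (intro cSUP_least) auto
  then have "C * ((s - r) powr \<theta>\<^sub>1 + (SUP u\<in>{r..s}. \<bar>X u \<omega> - X r \<omega>\<bar> powr \<theta>\<^sub>2) + k r s \<omega> powr \<theta>\<^sub>3)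
     \<le> C * ((s - r) powr \<theta>\<^sub>1 + ?o powr (\<theta>\<^sub>2 / 2) + k r s \<omega> powr \<theta>\<^sub>3)"
    using C_ge_1 by (intro mult_left_mono) auto
  with modulus[OF \<omega> rs] have "\<bar>a s \<omega> - a r \<omega>\<bar>
     \<le> C * ((s - r) powr \<theta>\<^sub>1 + ?o powr (\<theta>\<^sub>2 / 2) + k r s \<omega> powr \<theta>\<^sub>3)" by (rule order_trans)
  then have "\<bar>a s \<omega> - a r \<omega>\<bar>\<^sup>2 \<le> (C * ((s - r) powr \<theta>\<^sub>1 + ?o powr (\<theta>\<^sub>2 / 2) + k r s \<omega> powr \<theta>\<^sub>3))\<^sup>2"
    by (rule power_mono) simp
  also have "\<dots> = C\<^sup>2 * ((s - r) powr \<theta>\<^sub>1 + ?o powr (\<theta>\<^sub>2 / 2) + k r s \<omega> powr \<theta>\<^sub>3)\<^sup>2"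
    by (rule power_mult_distrib)
  also have "\<dots> \<le> C\<^sup>2 * (3 * (((s - r) powr \<theta>\<^sub>1)\<^sup>2 + (?o powr (\<theta>\<^sub>2 / 2))\<^sup>2 + (k r s \<omega> powr \<theta>\<^sub>3)\<^sup>2))"
    by (intro mult_left_mono power2_sum3_le) simp
  also have "(k r s \<omega> powr \<theta>\<^sub>3)\<^sup>2 = ((k r s \<omega>)\<^sup>2) powr \<theta>\<^sub>3"
    using k_nonneg[of r s \<omega>] abs_powr_eq_sq_powr[of "k r s \<omega>" "2 * \<theta>\<^sub>3"] by (simp add: powr_sq)
  finally show ?thesis by (simp add: powr_sq distrib_left mult_ac)
qed

text \<open>A choice turns the constant obtained from \<open>increment_estimates\<close> into a
  named one, so that the constants below can be explicit expressions.\<close>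

definition osc_const :: real where
  "osc_const = (SOME c. 0 < c
    \<and> (\<forall>r t. 0 \<le> r \<and> r < t \<and> t \<le> T \<and> t - r \<le> step \<longrightarrow>
        (\<integral>\<^sup>+\<omega>. osc_sq r t \<omega> \<partial>M) \<le> ennreal (c * (t - r)))
    \<and> (\<forall>r t. 0 \<le> r \<and> r < t \<and> t \<le> T \<and> t - r \<le> step \<longrightarrow>
        (\<integral>\<^sup>+\<omega>. ennreal (((X t \<omega> - X r \<omega>) - (I t \<omega> - I r \<omega>))\<^sup>2) \<partial>M) \<le> ennreal (c * (t - r)\<^sup>2)))"

lemma osc_const:
  shows osc_const_pos: "0 < osc_const"
    and osc_const_osc: "\<lbrakk>0 \<le> r; r < t; t \<le> T; t - r \<le> step\<rbrakk> \<Longrightarrow>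
      (\<integral>\<^sup>+\<omega>. osc_sq r t \<omega> \<partial>M) \<le> ennreal (osc_const * (t - r))"
    and osc_const_drift: "\<lbrakk>0 \<le> r; r < t; t \<le> T; t - r \<le> step\<rbrakk> \<Longrightarrow>
      (\<integral>\<^sup>+\<omega>. ennreal (((X t \<omega> - X r \<omega>) - (I t \<omega> - I r \<omega>))\<^sup>2) \<partial>M) \<le> ennreal (osc_const * (t - r)\<^sup>2)"
proof -
  let ?P = "\<lambda>c. 0 < c
    \<and> (\<forall>r t. 0 \<le> r \<and> r < t \<and> t \<le> T \<and> t - r \<le> step \<longrightarrow>
        (\<integral>\<^sup>+\<omega>. osc_sq r t \<omega> \<partial>M) \<le> ennreal (c * (t - r)))
    \<and> (\<forall>r t. 0 \<le> r \<and> r < t \<and> t \<le> T \<and> t - r \<le> step \<longrightarrow>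
        (\<integral>\<^sup>+\<omega>. ennreal (((X t \<omega> - X r \<omega>) - (I t \<omega> - I r \<omega>))\<^sup>2) \<partial>M) \<le> ennreal (c * (t - r)\<^sup>2))"
  have "\<exists>c. ?P c" by (rule increment_estimates) blast
  then have "?P osc_const" unfolding osc_const_def by (rule someI_ex)
  then show "0 < osc_const"
    and "\<lbrakk>0 \<le> r; r < t; t \<le> T; t - r \<le> step\<rbrakk> \<Longrightarrow>
      (\<integral>\<^sup>+\<omega>. osc_sq r t \<omega> \<partial>M) \<le> ennreal (osc_const * (t - r))"
    and "\<lbrakk>0 \<le> r; r < t; t \<le> T; t - r \<le> step\<rbrakk> \<Longrightarrow>
      (\<integral>\<^sup>+\<omega>. ennreal (((X t \<omega> - X r \<omega>) - (I t \<omega> - I r \<omega>))\<^sup>2) \<partial>M) \<le> ennreal (osc_const * (t - r)\<^sup>2)"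
    by blast+
qed

text \<open>The 3 is from squaring three summands of the modulus, each 2 from the Jensen-type bound
  \<open>nn_integral_powr_le\<close>.\<close>

definition coeff_const :: real where
  "coeff_const = 3 * C\<^sup>2 * (1 + 2 * osc_const powr \<theta>\<^sub>2 + 2 * C powr \<theta>\<^sub>3)"

lemma coeff_const_nonneg: "0 \<le> coeff_const"
  unfolding coeff_const_def by (intro mult_nonneg_nonneg add_nonneg_nonneg) auto

text \<open>The oscillation and the increment of \<open>H\<close> have second moments of orders 1
  and \<eta>; the concave powers turn these into orders \<open>\<theta>\<^sub>2\<close> and
  \<open>\<eta> * \<theta>\<^sub>3\<close>. Since \<open>s - r \<le> 1\<close>, every exponent may
  be lowered to \<open>rate\<close>.\<close>

lemma coefficient_increment:
  assumes rs: "0 \<le> r" "r < s" "s \<le> T" "s - r \<le> step"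
  shows "(\<integral>\<^sup>+\<omega>. ennreal ((a s \<omega> - a r \<omega>)\<^sup>2) \<partial>M) \<le> ennreal (coeff_const * (s - r) powr rate)"
proof -
  let ?e = "s - r" and ?o = "\<lambda>\<omega>. enn2real (osc_sq r s \<omega>)"
  have e: "0 < ?e" "?e \<le> 1" using rs step_bounds(2) by auto
  have [measurable]: "osc_sq r s \<in> borel_measurable M" "(\<lambda>\<omega>. (k r s \<omega>)\<^sup>2) \<in> borel_measurable M"
    using rs by (auto intro: k_measurable)
  have "(\<integral>\<^sup>+\<omega>. ennreal (?o \<omega>) \<partial>M) = (\<integral>\<^sup>+\<omega>. osc_sq r s \<omega> \<partial>M)"
    using osc_sq_finite[OF rs(1)] by (intro nn_integral_cong ennreal_enn2real) auto
  then have o_le: "(\<integral>\<^sup>+\<omega>. ennreal (?o \<omega> powr \<theta>\<^sub>2) \<partial>M) \<le> ennreal (2 * (osc_const * ?e) powr \<theta>\<^sub>2)"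
    using osc_const_osc[OF rs] osc_const_pos e \<theta> by (intro nn_integral_powr_le) auto
  have k_le: "(\<integral>\<^sup>+\<omega>. ennreal (((k r s \<omega>)\<^sup>2) powr \<theta>\<^sub>3) \<partial>M) \<le> ennreal (2 * (C * ?e powr \<eta>) powr \<theta>\<^sub>3)"
    using k_L2[of r s] rs C_ge_1 e \<theta> \<theta>\<^sub>3_pos by (intro nn_integral_powr_le) auto
  have "(\<integral>\<^sup>+\<omega>. ennreal ((a s \<omega> - a r \<omega>)\<^sup>2) \<partial>M)
     \<le> (\<integral>\<^sup>+\<omega>. ennreal (3 * C\<^sup>2) * (ennreal (?e powr (2 * \<theta>\<^sub>1)) + ennreal (?o \<omega> powr \<theta>\<^sub>2) + ennreal (((k r s \<omega>)\<^sup>2) powr \<theta>\<^sub>3)) \<partial>M)"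
  proof (intro nn_integral_mono)
    fix \<omega> assume "\<omega> \<in> space M"
    then have "ennreal ((a s \<omega> - a r \<omega>)\<^sup>2) \<le> ennreal (3 * C\<^sup>2 * (?e powr (2 * \<theta>\<^sub>1) + ?o \<omega> powr \<theta>\<^sub>2 + ((k r s \<omega>)\<^sup>2) powr \<theta>\<^sub>3))"
      using rs by (intro ennreal_leI modulus_sq) auto
    also have "\<dots> = ennreal (3 * C\<^sup>2) * ennreal (?e powr (2 * \<theta>\<^sub>1) + ?o \<omega> powr \<theta>\<^sub>2 + ((k r s \<omega>)\<^sup>2) powr \<theta>\<^sub>3)"
      by (rule ennreal_mult') simp
    finally show "ennreal ((a s \<omega> - a r \<omega>)\<^sup>2)
      \<le> ennreal (3 * C\<^sup>2) * (ennreal (?e powr (2 * \<theta>\<^sub>1)) + ennreal (?o \<omega> powr \<theta>\<^sub>2) + ennreal (((k r s \<omega>)\<^sup>2) powr \<theta>\<^sub>3))"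
      by simp
  qed
  also have "\<dots> = ennreal (3 * C\<^sup>2) * (ennreal (?e powr (2 * \<theta>\<^sub>1)) + (\<integral>\<^sup>+\<omega>. ennreal (?o \<omega> powr \<theta>\<^sub>2) \<partial>M)
      + (\<integral>\<^sup>+\<omega>. ennreal (((k r s \<omega>)\<^sup>2) powr \<theta>\<^sub>3) \<partial>M))"
    by (simp add: nn_integral_cmult nn_integral_add emeasure_space_1)
  also have "\<dots> \<le> ennreal (3 * C\<^sup>2) * (ennreal (?e powr rate) + ennreal (2 * osc_const powr \<theta>\<^sub>2 * ?e powr rate)
      + ennreal (2 * C powr \<theta>\<^sub>3 * ?e powr rate))"
  proof (intro mult_left_mono add_mono)
    have mono: "?e powr p \<le> ?e powr rate" if "rate \<le> p" for p
      using that e by (intro powr_mono') auto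
    show "ennreal (?e powr (2 * \<theta>\<^sub>1)) \<le> ennreal (?e powr rate)"
      by (intro ennreal_leI mono rate_bounds)
    have "2 * (osc_const * ?e) powr \<theta>\<^sub>2 = 2 * osc_const powr \<theta>\<^sub>2 * ?e powr \<theta>\<^sub>2"
      using osc_const_pos e by (simp add: powr_mult)
    also have "\<dots> \<le> 2 * osc_const powr \<theta>\<^sub>2 * ?e powr rate"
      by (intro mult_left_mono mono rate_bounds) simp
    finally show "(\<integral>\<^sup>+\<omega>. ennreal (?o \<omega> powr \<theta>\<^sub>2) \<partial>M) \<le> ennreal (2 * osc_const powr \<theta>\<^sub>2 * ?e powr rate)"
      by (rule order_trans[OF o_le ennreal_leI])
    have "2 * (C * ?e powr \<eta>) powr \<theta>\<^sub>3 = 2 * C powr \<theta>\<^sub>3 * ?e powr (\<eta> * \<theta>\<^sub>3)"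
      using C_ge_1 e by (simp add: powr_mult powr_powr)
    also have "\<dots> \<le> 2 * C powr \<theta>\<^sub>3 * ?e powr rate"
      by (intro mult_left_mono mono rate_bounds) simp
    finally show "(\<integral>\<^sup>+\<omega>. ennreal (((k r s \<omega>)\<^sup>2) powr \<theta>\<^sub>3) \<partial>M) \<le> ennreal (2 * C powr \<theta>\<^sub>3 * ?e powr rate)"
      by (rule order_trans[OF k_le ennreal_leI])
  qed simp
  also have "\<dots> = ennreal (3 * C\<^sup>2) * ennreal (?e powr rate + 2 * osc_const powr \<theta>\<^sub>2 * ?e powr rate + 2 * C powr \<theta>\<^sub>3 * ?e powr rate)"
    by simp
  also have "\<dots> = ennreal (coeff_const * ?e powr rate)"
    by (subst ennreal_mult'[symmetric]) (simp_all add: coeff_const_def algebra_simps)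
  finally show ?thesis .
qed

text \<open>Splitting the squared error costs a factor 2; the martingale part carries in addition
  the 8 of \<open>ito_L2_bound\<close>.\<close>

definition euler_const :: real where
  "euler_const = 16 * coeff_const + 2 * osc_const"

lemma euler_step_error:
  assumes r: "0 \<le> r" "r < t" "t \<le> T" "t - r \<le> step"
  shows "(\<integral>\<^sup>+\<omega>. ennreal ((X t \<omega> - (X r \<omega> + a r \<omega> * (B t \<omega> - B r \<omega>)))\<^sup>2) \<partial>M)
     \<le> ennreal (euler_const * (t - r) powr (1 + rate))"
proof -
  let ?e = "t - r"
  interpret P: pair_sigma_finite lborel M ..
  have e: "0 < ?e" "?e \<le> 1" using r step_bounds(2) by auto
  have ar: "a r \<in> borel_measurable (F r)" by (rule ito_measurable(2)[OF ito r(1)])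
  let ?a = "\<lambda>s \<omega>. indicator {0..} s * a s \<omega>"
  note [measurable] = ito_measurable(3)[OF ito] a_measurable[OF r(1)]
  have [measurable]: "X t \<in> borel_measurable M" "X r \<in> borel_measurable M" "B t \<in> borel_measurable M"
    "B r \<in> borel_measurable M" "I t \<in> borel_measurable M" "I r \<in> borel_measurable M"
    using r ito_measurable(1)[OF ito] by auto
  have "(\<integral>\<^sup>+\<omega>. (\<integral>\<^sup>+s\<in>{r..t}. ennreal ((a s \<omega> - a r \<omega>)\<^sup>2) \<partial>lborel) \<partial>M)
     = (\<integral>\<^sup>+\<omega>. (\<integral>\<^sup>+s. ennreal ((?a s \<omega> - a r \<omega>)\<^sup>2) * indicator {r..t} s \<partial>lborel) \<partial>M)"
    using r by (intro nn_integral_cong) (auto simp: indicator_def)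
  also have "\<dots> = (\<integral>\<^sup>+s. (\<integral>\<^sup>+\<omega>. ennreal ((?a s \<omega> - a r \<omega>)\<^sup>2) * indicator {r..t} s \<partial>M) \<partial>lborel)"
    by (rule P.Fubini') measurable
  also have "\<dots> \<le> (\<integral>\<^sup>+s. ennreal (coeff_const * ?e powr rate) * indicator {r..t} s \<partial>lborel)"
  proof (intro nn_integral_mono)
    fix s
    show "(\<integral>\<^sup>+\<omega>. ennreal ((?a s \<omega> - a r \<omega>)\<^sup>2) * indicator {r..t} s \<partial>M)
      \<le> ennreal (coeff_const * ?e powr rate) * indicator {r..t} s"
    proof (cases "s \<in> {r<..t}")
      case True
      then have s: "r < s" "s \<le> T" "s - r \<le> step" "s - r \<le> ?e" "0 \<le> s" using r by auto
      have "(\<integral>\<^sup>+\<omega>. ennreal ((a s \<omega> - a r \<omega>)\<^sup>2) \<partial>M) \<le> ennreal (coeff_const * (s - r) powr rate)"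
        by (rule coefficient_increment[OF r(1) s(1-3)])
      also have "\<dots> \<le> ennreal (coeff_const * ?e powr rate)"
        using s rate_bounds(1) coeff_const_nonneg by (intro ennreal_leI mult_left_mono powr_mono2) auto
      finally show ?thesis using True s by simp
    next
      case False
      then show ?thesis using r by (cases "s = r") (auto simp: indicator_def)
    qed
  qed
  also have "\<dots> = ennreal (coeff_const * ?e powr rate) * ennreal ?e"
    using r by (simp add: nn_integral_cmult)
  also have "\<dots> = ennreal (coeff_const * ?e powr (1 + rate))"
    using e coeff_const_nonneg by (simp add: ennreal_mult[symmetric] powr_add mult_ac)
  finally have var: "(\<integral>\<^sup>+\<omega>. (\<integral>\<^sup>+s\<in>{r..t}. ennreal ((a s \<omega> - a r \<omega>)\<^sup>2) \<partial>lborel) \<partial>M)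
     \<le> ennreal (coeff_const * ?e powr (1 + rate))" .
  have "(\<integral>\<^sup>+\<omega>. ennreal ((X t \<omega> - (X r \<omega> + a r \<omega> * (B t \<omega> - B r \<omega>)))\<^sup>2) \<partial>M)
     \<le> (\<integral>\<^sup>+\<omega>. 2 * ennreal ((I t \<omega> - I r \<omega> - a r \<omega> * (B t \<omega> - B r \<omega>))\<^sup>2)
        + 2 * ennreal (((X t \<omega> - X r \<omega>) - (I t \<omega> - I r \<omega>))\<^sup>2) \<partial>M)"
  proof (intro nn_integral_mono)
    fix \<omega>
    have "X t \<omega> - (X r \<omega> + a r \<omega> * (B t \<omega> - B r \<omega>))
      = (I t \<omega> - I r \<omega> - a r \<omega> * (B t \<omega> - B r \<omega>)) + ((X t \<omega> - X r \<omega>) - (I t \<omega> - I r \<omega>))" by simp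
    then show "ennreal ((X t \<omega> - (X r \<omega> + a r \<omega> * (B t \<omega> - B r \<omega>)))\<^sup>2)
      \<le> 2 * ennreal ((I t \<omega> - I r \<omega> - a r \<omega> * (B t \<omega> - B r \<omega>))\<^sup>2)
        + 2 * ennreal (((X t \<omega> - X r \<omega>) - (I t \<omega> - I r \<omega>))\<^sup>2)"
      by (simp only: ennreal_sq_add_le)
  qed
  also have "\<dots> = 2 * (\<integral>\<^sup>+\<omega>. ennreal ((I t \<omega> - I r \<omega> - a r \<omega> * (B t \<omega> - B r \<omega>))\<^sup>2) \<partial>M)
        + 2 * (\<integral>\<^sup>+\<omega>. ennreal (((X t \<omega> - X r \<omega>) - (I t \<omega> - I r \<omega>))\<^sup>2) \<partial>M)"
    by (simp add: nn_integral_add nn_integral_cmult)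
  also have "\<dots> \<le> 2 * (8 * ennreal (coeff_const * ?e powr (1 + rate))) + 2 * ennreal (osc_const * ?e\<^sup>2)"
    using ito_L2_bound[OF ito r(1,2) ar] osc_const_drift[OF r]
    by (intro add_mono mult_left_mono order_trans[OF ito_L2_bound[OF ito r(1,2) ar] mult_left_mono[OF var]]) auto
  also have "\<dots> = ennreal (16 * (coeff_const * ?e powr (1 + rate)) + 2 * (osc_const * ?e\<^sup>2))"
    using coeff_const_nonneg osc_const_pos by (simp add: ennreal_mult' mult.assoc[symmetric])
  also have "\<dots> \<le> ennreal (euler_const * ?e powr (1 + rate))"
  proof (intro ennreal_leI)
    have "?e\<^sup>2 = ?e powr 2" using e by simp
    also have "\<dots> \<le> ?e powr (1 + rate)" using e rate_bounds(5) by (intro powr_mono') auto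
    finally have "osc_const * ?e\<^sup>2 \<le> osc_const * ?e powr (1 + rate)"
      using osc_const_pos by (intro mult_left_mono) auto
    then show "16 * (coeff_const * ?e powr (1 + rate)) + 2 * (osc_const * ?e\<^sup>2) \<le> euler_const * ?e powr (1 + rate)"
      by (simp add: euler_const_def algebra_simps)
  qed
  finally show ?thesis .
qed

end

section \<open>From Fourier decay to absolute continuity away from the zeros of \<sigma>\<close>

context elliptic_equation
begin

text \<open>A cutoff of the law of the solution to \<open>{\<bar>\<sigma>\<bar> > d}\<close> that inherits the regularity of \<open>\<sigma>\<close>.\<close>

definition cutoff :: "real \<Rightarrow> real \<Rightarrow> real" where
  "cutoff d y = max 0 (min 1 (\<bar>\<sigma> y\<bar> - d))"

lemma cutoff_range: "0 \<le> cutoff d y" "cutoff d y \<le> 1"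
  by (auto simp: cutoff_def)

lemma cutoff_measurable [measurable]: "cutoff d \<in> borel_measurable borel"
  unfolding cutoff_def[abs_def] by measurable

text \<open>Absolute value and truncation are 1-Lipschitz, so the constant of \<sigma> is inherited
  uniformly in \<open>d\<close>.\<close>

lemma cutoff_holder: "\<bar>cutoff d y - cutoff d z\<bar> \<le> L * \<bar>y - z\<bar> powr \<alpha>"
proof -
  have "\<bar>cutoff d y - cutoff d z\<bar> \<le> \<bar>\<sigma> y - \<sigma> z\<bar>"
    unfolding cutoff_def by (auto simp: max_def min_def)
  then show ?thesis using holder by (rule order_trans)
qed

definition fourier_const\<^sub>1 :: real where
  "fourier_const\<^sub>1 = L * (2 * osc_const powr (\<alpha> / 2))"

definition fourier_const\<^sub>2 :: real where
  "fourier_const\<^sub>2 = 2 * euler_const powr (1/2)"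

text \<open>Freezing the coefficients at time \<open>T - e\<close> makes \<open>X\<^sub>T\<close> conditionally Gaussian.\<close>

lemma fourier_bound:
  assumes e: "0 < e" "e \<le> min step T" and d: "0 < d"
  shows "cmod (CLINT \<omega>|M. complex_of_real (cutoff d (X T \<omega>)) * iexp (\<xi> * X T \<omega>))
    \<le> fourier_const\<^sub>1 * e powr (\<alpha> / 2) + \<bar>\<xi>\<bar> * (fourier_const\<^sub>2 * e powr (1/2 + rate / 2))
      + exp (- ((d * \<kappa>\<^sub>0)\<^sup>2 / 2 * \<xi>\<^sup>2 * e))"
proof -
  define r where "r = T - e"
  have r: "0 \<le> r" "r < T" "T - r \<le> step" "T \<le> T" and Tr: "T - r = e" using e by (auto simp: r_def)
  define Z where "Z \<omega> = X r \<omega> + a r \<omega> * (B T \<omega> - B r \<omega>)" for \<omega>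
  have XF: "X r \<in> borel_measurable (F r)" using X_adapted r(1) by (simp add: adapted_def)
  have aF: "a r \<in> borel_measurable (F r)" by (rule ito_measurable(2)[OF ito r(1)])
  have [measurable]: "X T \<in> borel_measurable M" "X r \<in> borel_measurable M" "B T \<in> borel_measurable M"
    "B r \<in> borel_measurable M" "a r \<in> borel_measurable M"
    using r T_pos a_measurable by auto
  have [measurable]: "Z \<in> borel_measurable M" unfolding Z_def by measurable
  have osc_T: "(\<integral>\<^sup>+\<omega>. ennreal ((X T \<omega> - X r \<omega>)\<^sup>2) \<partial>M) \<le> ennreal (osc_const * e)"
  proof -
    have "(\<integral>\<^sup>+\<omega>. ennreal ((X T \<omega> - X r \<omega>)\<^sup>2) \<partial>M) \<le> (\<integral>\<^sup>+\<omega>. osc_sq r T \<omega> \<partial>M)"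
      unfolding osc_sq_def using r by (intro nn_integral_mono SUP_upper) auto
    also have "\<dots> \<le> ennreal (osc_const * (T - r))" by (rule osc_const_osc[OF r(1,2,4,3)])
    finally show ?thesis unfolding Tr .
  qed
  have W: "(\<integral>\<^sup>+\<omega>. ennreal \<bar>cutoff d (X T \<omega>) - cutoff d (X r \<omega>)\<bar> \<partial>M) \<le> ennreal (fourier_const\<^sub>1 * e powr (\<alpha> / 2))"
  proof -
    have "(\<integral>\<^sup>+\<omega>. ennreal \<bar>cutoff d (X T \<omega>) - cutoff d (X r \<omega>)\<bar> \<partial>M)
      \<le> (\<integral>\<^sup>+\<omega>. ennreal L * ennreal (((X T \<omega> - X r \<omega>)\<^sup>2) powr (\<alpha> / 2)) \<partial>M)"
    proof (intro nn_integral_mono)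
      fix \<omega>
      have "ennreal \<bar>cutoff d (X T \<omega>) - cutoff d (X r \<omega>)\<bar> \<le> ennreal (L * ((X T \<omega> - X r \<omega>)\<^sup>2) powr (\<alpha> / 2))"
        unfolding abs_powr_eq_sq_powr[symmetric] by (rule ennreal_leI[OF cutoff_holder])
      also have "\<dots> = ennreal L * ennreal (((X T \<omega> - X r \<omega>)\<^sup>2) powr (\<alpha> / 2))"
        by (rule ennreal_mult'[OF L_nonneg])
      finally show "ennreal \<bar>cutoff d (X T \<omega>) - cutoff d (X r \<omega>)\<bar> \<le> ennreal L * ennreal (((X T \<omega> - X r \<omega>)\<^sup>2) powr (\<alpha> / 2))" .
    qed
    also have "\<dots> = ennreal L * (\<integral>\<^sup>+\<omega>. ennreal (((X T \<omega> - X r \<omega>)\<^sup>2) powr (\<alpha> / 2)) \<partial>M)"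
      by (rule nn_integral_cmult) measurable
    also have "\<dots> \<le> ennreal L * ennreal (2 * (osc_const * e) powr (\<alpha> / 2))"
      using osc_T osc_const_pos e \<alpha> by (intro mult_left_mono nn_integral_powr_le) auto
    also have "\<dots> = ennreal (L * (2 * (osc_const * e) powr (\<alpha> / 2)))"
      by (rule ennreal_mult'[OF L_nonneg, symmetric])
    also have "(osc_const * e) powr (\<alpha> / 2) = osc_const powr (\<alpha> / 2) * e powr (\<alpha> / 2)"
      by (rule powr_mult)
    finally show ?thesis by (simp add: fourier_const\<^sub>1_def mult.assoc)
  qed
  have euler_pos: "0 < euler_const" using coeff_const_nonneg osc_const_pos by (simp add: euler_const_def)
  have R: "(\<integral>\<^sup>+\<omega>. ennreal \<bar>X T \<omega> - Z \<omega>\<bar> \<partial>M) \<le> ennreal (fourier_const\<^sub>2 * e powr (1/2 + rate / 2))"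
  proof -
    \<comment> \<open>The first absolute moment is the second moment of the Euler error taken to the
      power 1/2 inside the expectation; this halves the exponent \<open>1 + rate\<close>.\<close>
    have "(\<integral>\<^sup>+\<omega>. ennreal \<bar>X T \<omega> - Z \<omega>\<bar> \<partial>M) = (\<integral>\<^sup>+\<omega>. ennreal (((X T \<omega> - Z \<omega>)\<^sup>2) powr (1/2)) \<partial>M)"
      using abs_powr_eq_sq_powr[of _ 1] by simp
    also have "\<dots> \<le> ennreal (2 * (euler_const * e powr (1 + rate)) powr (1/2))"
      using euler_step_error[OF r(1,2,4,3)] euler_pos e unfolding Tr Z_def
      by (intro nn_integral_powr_le) auto
    also have "2 * (euler_const * e powr (1 + rate)) powr (1/2) = fourier_const\<^sub>2 * e powr (1/2 + rate / 2)"
      using euler_pos e by (simp add: fourier_const\<^sub>2_def powr_mult powr_powr add_divide_distrib)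
    finally show ?thesis .
  qed
  let ?E1 = "CLINT \<omega>|M. complex_of_real (cutoff d (X T \<omega>)) * iexp (\<xi> * X T \<omega>)"
  let ?E2 = "CLINT \<omega>|M. complex_of_real (cutoff d (X r \<omega>)) * iexp (\<xi> * Z \<omega>)"
  have int: "integrable M (\<lambda>\<omega>. complex_of_real (cutoff d (X T \<omega>)) * iexp (\<xi> * X T \<omega>))"
    "integrable M (\<lambda>\<omega>. complex_of_real (cutoff d (X r \<omega>)) * iexp (\<xi> * Z \<omega>))"
    using cutoff_range by (intro integrable_const_bound[where B=1]; simp add: norm_mult)+
  have diff: "cmod (?E1 - ?E2) \<le> fourier_const\<^sub>1 * e powr (\<alpha> / 2) + \<bar>\<xi>\<bar> * (fourier_const\<^sub>2 * e powr (1/2 + rate / 2))"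
  proof -
    let ?u = "\<lambda>\<omega>. complex_of_real (cutoff d (X T \<omega>)) * iexp (\<xi> * X T \<omega>) - complex_of_real (cutoff d (X r \<omega>)) * iexp (\<xi> * Z \<omega>)"
    have "ennreal (cmod (?E1 - ?E2)) = ennreal (cmod (CLINT \<omega>|M. ?u \<omega>))"
      using int by (subst Bochner_Integration.integral_diff) auto
    also have "\<dots> \<le> (\<integral>\<^sup>+\<omega>. ennreal (cmod (?u \<omega>)) \<partial>M)"
      by (intro integral_norm_bound_ennreal Bochner_Integration.integrable_diff int)
    also have "\<dots> \<le> (\<integral>\<^sup>+\<omega>. ennreal \<bar>cutoff d (X T \<omega>) - cutoff d (X r \<omega>)\<bar> + ennreal \<bar>\<xi>\<bar> * ennreal \<bar>X T \<omega> - Z \<omega>\<bar> \<partial>M)"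
    proof (intro nn_integral_mono)
      fix \<omega>
      let ?p = "cutoff d (X T \<omega>)" and ?q = "cutoff d (X r \<omega>)"
      \<comment> \<open>The weight is exchanged with the phase of \<open>X T\<close> in place, and
        the phase afterwards with the weight at time \<open>r\<close>. Hence \<open>\<xi>\<close>
        multiplies only the Euler error.\<close>
      have "?u \<omega> = complex_of_real (?p - ?q) * iexp (\<xi> * X T \<omega>) + complex_of_real ?q * (iexp (\<xi> * X T \<omega>) - iexp (\<xi> * Z \<omega>))"
        by (simp add: algebra_simps)
      also have "cmod \<dots> \<le> cmod (complex_of_real (?p - ?q) * iexp (\<xi> * X T \<omega>))
          + cmod (complex_of_real ?q * (iexp (\<xi> * X T \<omega>) - iexp (\<xi> * Z \<omega>)))"
        by (rule norm_triangle_ineq)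
      also have "\<dots> = \<bar>?p - ?q\<bar> + ?q * cmod (iexp (\<xi> * X T \<omega>) - iexp (\<xi> * Z \<omega>))"
        using cutoff_range(1)[of d "X r \<omega>"] by (simp only: norm_mult norm_exp_i_times norm_of_real abs_of_nonneg mult_1_right)
      also have "\<dots> \<le> \<bar>?p - ?q\<bar> + 1 * \<bar>\<xi> * X T \<omega> - \<xi> * Z \<omega>\<bar>"
        using cutoff_range[of d "X r \<omega>"] by (intro add_left_mono mult_mono norm_iexp_diff_le) auto
      also have "\<bar>\<xi> * X T \<omega> - \<xi> * Z \<omega>\<bar> = \<bar>\<xi>\<bar> * \<bar>X T \<omega> - Z \<omega>\<bar>"
        by (simp add: abs_mult[symmetric] right_diff_distrib)
      finally have "cmod (?u \<omega>) \<le> \<bar>?p - ?q\<bar> + \<bar>\<xi>\<bar> * \<bar>X T \<omega> - Z \<omega>\<bar>" by simp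
      then have "ennreal (cmod (?u \<omega>)) \<le> ennreal (\<bar>?p - ?q\<bar> + \<bar>\<xi>\<bar> * \<bar>X T \<omega> - Z \<omega>\<bar>)" by (rule ennreal_leI)
      also have "\<dots> = ennreal \<bar>?p - ?q\<bar> + ennreal \<bar>\<xi>\<bar> * ennreal \<bar>X T \<omega> - Z \<omega>\<bar>"
        by (simp add: ennreal_mult')
      finally show "ennreal (cmod (?u \<omega>)) \<le> ennreal \<bar>?p - ?q\<bar> + ennreal \<bar>\<xi>\<bar> * ennreal \<bar>X T \<omega> - Z \<omega>\<bar>" .
    qed
    also have "\<dots> = (\<integral>\<^sup>+\<omega>. ennreal \<bar>cutoff d (X T \<omega>) - cutoff d (X r \<omega>)\<bar> \<partial>M) + ennreal \<bar>\<xi>\<bar> * (\<integral>\<^sup>+\<omega>. ennreal \<bar>X T \<omega> - Z \<omega>\<bar> \<partial>M)"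
      by (simp add: nn_integral_add nn_integral_cmult)
    also have "\<dots> \<le> ennreal (fourier_const\<^sub>1 * e powr (\<alpha> / 2)) + ennreal \<bar>\<xi>\<bar> * ennreal (fourier_const\<^sub>2 * e powr (1/2 + rate / 2))"
      by (intro add_mono mult_left_mono W R) simp
    also have "\<dots> = ennreal (fourier_const\<^sub>1 * e powr (\<alpha> / 2) + \<bar>\<xi>\<bar> * (fourier_const\<^sub>2 * e powr (1/2 + rate / 2)))"
      using L_nonneg by (subst ennreal_mult'[symmetric], simp, subst ennreal_plus[symmetric])
        (auto simp: fourier_const\<^sub>1_def fourier_const\<^sub>2_def)
    finally show ?thesis
      by (rule ennreal_le_iff[THEN iffD1, rotated])
        (use L_nonneg in \<open>auto simp: fourier_const\<^sub>1_def fourier_const\<^sub>2_def\<close>)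
  qed
  have E2: "cmod ?E2 \<le> exp (- ((d * \<kappa>\<^sub>0)\<^sup>2 * (T - r) / 2 * \<xi>\<^sup>2))"
    unfolding Z_def
  proof (rule norm_expectation_gaussian_le[OF r(1,2) _ XF aF])
    show "(\<lambda>\<omega>. cutoff d (X r \<omega>)) \<in> borel_measurable (F r)"
      by (rule measurable_compose[OF XF cutoff_measurable])
    show "0 \<le> cutoff d (X r \<omega>) \<and> cutoff d (X r \<omega>) \<le> 1" for \<omega> using cutoff_range by blast
    show "0 \<le> d * \<kappa>\<^sub>0" using d \<kappa>\<^sub>0 by simp
    fix \<omega> assume \<omega>: "\<omega> \<in> space M" and nz: "cutoff d (X r \<omega>) \<noteq> 0"
    then have "d \<le> \<bar>\<sigma> (X r \<omega>)\<bar>" by (auto simp: cutoff_def max_def min_def split: if_splits)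
    then have "d * \<kappa>\<^sub>0 \<le> \<kappa>\<^sub>0 * \<bar>\<sigma> (X r \<omega>)\<bar>" using \<kappa>\<^sub>0 by simp
    also have "\<dots> \<le> \<bar>a r \<omega>\<bar>" using r by (intro elliptic \<omega>) auto
    finally show "d * \<kappa>\<^sub>0 \<le> \<bar>a r \<omega>\<bar>" .
  qed
  have "cmod ?E1 \<le> cmod (?E1 - ?E2) + cmod ?E2"
    using norm_triangle_ineq[of "?E1 - ?E2" ?E2] by simp
  also have "\<dots> \<le> (fourier_const\<^sub>1 * e powr (\<alpha> / 2) + \<bar>\<xi>\<bar> * (fourier_const\<^sub>2 * e powr (1/2 + rate / 2)))
      + exp (- ((d * \<kappa>\<^sub>0)\<^sup>2 * (T - r) / 2 * \<xi>\<^sup>2))"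
    by (rule add_mono[OF diff E2])
  finally show ?thesis unfolding Tr by (simp add: mult_ac)
qed

text \<open>The law of \<open>X T\<close> under the measure weighted by the cutoff has the
  expectation of \<open>fourier_bound\<close> as characteristic function, which is square
  integrable. This law therefore ignores Lebesgue null sets, so the weight vanishes almost surely
  where \<open>X T\<close> hits \<open>A\<close>.\<close>

lemma cutoff_null:
  assumes A: "A \<in> null_sets lborel" and d: "0 < d"
  shows "AE \<omega> in M. X T \<omega> \<in> A \<longrightarrow> cutoff d (X T \<omega>) = 0"
proof -
  have [measurable]: "X T \<in> borel_measurable M" using T_pos by simp
  have A_b [measurable]: "A \<in> sets borel" using A by auto
  let ?N = "density M (\<lambda>\<omega>. ennreal (cutoff d (X T \<omega>)))"
  let ?\<nu> = "distr ?N borel (X T)"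
  have char_eq: "char ?\<nu> \<xi> = (CLINT \<omega>|M. complex_of_real (cutoff d (X T \<omega>)) * iexp (\<xi> * X T \<omega>))" for \<xi>
  proof -
    have "char ?\<nu> \<xi> = (CLINT \<omega>|?N. iexp (\<xi> * X T \<omega>))"
      unfolding char_def by (rule integral_distr) measurable
    also have "\<dots> = (\<integral>\<omega>. cutoff d (X T \<omega>) *\<^sub>R iexp (\<xi> * X T \<omega>) \<partial>M)"
      using cutoff_range by (intro integral_density) auto
    finally show ?thesis by (simp add: scaleR_conv_of_real)
  qed
  have fin: "finite_measure ?\<nu>"
  proof (rule finite_measureI)
    have "emeasure ?\<nu> (space ?\<nu>) = (\<integral>\<^sup>+\<omega>. ennreal (cutoff d (X T \<omega>)) \<partial>M)"
      by (simp add: emeasure_distr emeasure_density)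
    also have "\<dots> \<le> (\<integral>\<^sup>+\<omega>. 1 \<partial>M)" using cutoff_range by (intro nn_integral_mono) (simp add: ennreal_le_1)
    finally show "emeasure ?\<nu> (space ?\<nu>) \<noteq> \<infinity>" by (auto simp: emeasure_space_1 top_unique)
  qed
  have int: "integrable M (\<lambda>\<omega>. complex_of_real (cutoff d (X T \<omega>)) * iexp (\<xi> * X T \<omega>))" for \<xi>
    by (rule integrable_const_bound[where B=1]) (simp_all add: norm_mult cutoff_range)
  have "(\<integral>\<^sup>+\<xi>. ennreal ((cmod (char ?\<nu> \<xi>))\<^sup>2) \<partial>lborel) < \<infinity>"
  proof (rule square_integrable_of_bound)
    interpret finite_measure ?\<nu> by (rule fin)
    have "char ?\<nu> \<in> borel_measurable borel" unfolding char_def[abs_def] by measurable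
    then show "(\<lambda>\<xi>. cmod (char ?\<nu> \<xi>)) \<in> borel_measurable borel" by measurable
    show "0 \<le> cmod (char ?\<nu> \<xi>)" for \<xi> by simp
    show "cmod (char ?\<nu> \<xi>) \<le> 1" for \<xi>
    proof -
      have "cmod (char ?\<nu> \<xi>) \<le> (\<integral>\<omega>. cmod (complex_of_real (cutoff d (X T \<omega>)) * iexp (\<xi> * X T \<omega>)) \<partial>M)"
        unfolding char_eq by (rule integral_norm_bound)
      also have "\<dots> \<le> (\<integral>\<omega>. 1 \<partial>M)"
        by (rule Bochner_Integration.integral_mono[OF integrable_norm[OF int[of \<xi>]]])
          (simp_all add: norm_mult cutoff_range)
      finally show ?thesis by (simp add: prob_space)
    qed
    show "cmod (char ?\<nu> \<xi>) \<le> fourier_const\<^sub>1 * e powr (\<alpha> / 2) + \<bar>\<xi>\<bar> * (fourier_const\<^sub>2 * e powr (1/2 + rate / 2))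
      + exp (- ((d * \<kappa>\<^sub>0)\<^sup>2 / 2 * \<xi>\<^sup>2 * e))" if "0 < e" "e \<le> min step T" for \<xi> e
      unfolding char_eq by (rule fourier_bound[OF that d])
    show "0 < min step T" using step_bounds T_pos by simp
    show "0 \<le> fourier_const\<^sub>1" "0 \<le> fourier_const\<^sub>2"
      using L_nonneg by (simp_all add: fourier_const\<^sub>1_def fourier_const\<^sub>2_def)
    show "0 < (d * \<kappa>\<^sub>0)\<^sup>2 / 2" using d \<kappa>\<^sub>0 by simp
    show "1/2 < \<alpha>" by (rule \<alpha>)
    show "1/4 < rate / 2" using rate_bounds(1) by simp
  qed
  then have "emeasure ?\<nu> A = 0" by (intro null_sets_of_char_L2[OF fin _ _ A]) simp_all
  then have "(\<integral>\<^sup>+\<omega>. ennreal (cutoff d (X T \<omega>)) * indicator (X T -` A \<inter> space M) \<omega> \<partial>M) = 0"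
    by (simp add: emeasure_distr emeasure_density)
  then have "AE \<omega> in M. ennreal (cutoff d (X T \<omega>)) * indicator (X T -` A \<inter> space M) \<omega> = 0"
    by (subst (asm) nn_integral_0_iff_AE) auto
  then show ?thesis using AE_space
  proof eventually_elim
    case (elim \<omega>)
    then show ?case using cutoff_range(1)[of d "X T \<omega>"] by (auto simp: indicator_def ennreal_eq_0_iff)
  qed
qed

text \<open>The cutoffs with \<open>d\<close> running through the inverse positive integers are
  together nonzero on all of the set where \<sigma> is nonzero, and countably many null events
  suffice.\<close>

lemma null_set_avoided:
  assumes A: "A \<in> null_sets lborel"
  shows "AE \<omega> in M. X T \<omega> \<in> A \<longrightarrow> \<sigma> (X T \<omega>) = 0"
proof -
  have "AE \<omega> in M. \<forall>n. X T \<omega> \<in> A \<longrightarrow> cutoff (inverse (real (Suc n))) (X T \<omega>) = 0"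
    unfolding AE_all_countable by (intro allI cutoff_null A) simp
  then show ?thesis
  proof eventually_elim
    case (elim \<omega>)
    show ?case
    proof (rule impI, rule ccontr)
      assume "X T \<omega> \<in> A" "\<sigma> (X T \<omega>) \<noteq> 0"
      then obtain n where "inverse (real (Suc n)) < \<bar>\<sigma> (X T \<omega>)\<bar>" using reals_Archimedean[of "\<bar>\<sigma> (X T \<omega>)\<bar>"] by auto
      then have "cutoff (inverse (real (Suc n))) (X T \<omega>) \<noteq> 0" by (simp add: cutoff_def max_def min_def)
      with elim \<open>X T \<omega> \<in> A\<close> show False by blast
    qed
  qed
qed

end

section \<open>Instantiation at the path-dependent equation\<close>

lemma bdd_above_continuous_image:
  fixes f :: "real \<Rightarrow> real"
  assumes "continuous_on {r..t} f"
  shows "bdd_above (f ` {r..t})"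
  by (intro bounded_imp_bdd_above compact_imp_bounded compact_continuous_image assms compact_Icc)

lemma SUP_nonneg_bdd:
  fixes f :: "real \<Rightarrow> real"
  assumes "bdd_above (f ` {r..t})" "r \<le> t" "0 \<le> f r"
  shows "0 \<le> (SUP u\<in>{r..t}. f u)"
  using assms by (intro cSUP_upper2[of _ _ r]) auto

theorem theorem3p1:
  fixes M :: "'a measure" and F :: "real \<Rightarrow> 'a measure"
    and B X :: "real \<Rightarrow> 'a \<Rightarrow> real"
    and H :: "real \<Rightarrow> 'a \<Rightarrow> 's::real_normed_vector"
    and x \<eta> \<theta>\<^sub>1 \<theta>\<^sub>2 \<theta>\<^sub>3 \<alpha> \<kappa>\<^sub>0 :: real
    and \<sigma> :: "real \<Rightarrow> real"
    and \<kappa> b :: "real \<times> (real \<Rightarrow> real) \<times> 's \<Rightarrow> real"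
  assumes "brownian_motion M F B"
    and "predictable M F H"
    and "\<kappa> \<in> borel_measurable coeff_algebra"
    and "b \<in> borel_measurable coeff_algebra"
    and "1/2 < \<eta>"
    and "1/4 < \<theta>\<^sub>1" "\<theta>\<^sub>1 \<le> 1"
    and "1/2 < \<theta>\<^sub>2" "\<theta>\<^sub>2 \<le> 1"
    and "1 / (2 * \<eta>) < \<theta>\<^sub>3" "\<theta>\<^sub>3 \<le> 1"
    and "\<forall>T>0. \<exists>C::real.
      (\<forall>t. 0 \<le> t \<and> t \<le> T \<longrightarrow>
         integrable M (\<lambda>\<omega>. (norm (H t \<omega>))\<^sup>2) \<and>
         (\<integral>\<omega>. (norm (H t \<omega>))\<^sup>2 \<partial>M) \<le> C) \<and>
      (\<forall>s t. 0 \<le> s \<and> s \<le> t \<and> t \<le> T \<longrightarrow>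
         integrable M (\<lambda>\<omega>. (norm (H t \<omega> - H s \<omega>))\<^sup>2) \<and>
         (\<integral>\<omega>. (norm (H t \<omega> - H s \<omega>))\<^sup>2 \<partial>M) \<le> C * (t - s) powr \<eta>) \<and>
      (\<forall>t y h. 0 \<le> t \<and> t \<le> T \<and> continuous_on {0..} y \<longrightarrow>
         \<bar>\<sigma> (y t) * \<kappa> (t, restrict y {0..t}, h)\<bar> + \<bar>b (t, restrict y {0..t}, h)\<bar>
           \<le> C * (1 + (SUP u\<in>{0..t}. \<bar>y u\<bar>) + norm h)) \<and>
      (\<forall>s t y h h'. 0 \<le> s \<and> s \<le> t \<and> t \<le> T \<and> continuous_on {0..} y \<longrightarrow>
         \<bar>\<sigma> (y t) * \<kappa> (t, restrict y {0..t}, h) - \<sigma> (y s) * \<kappa> (s, restrict y {0..s}, h')\<bar>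
           \<le> C * ((t - s) powr \<theta>\<^sub>1 + (SUP u\<in>{s..t}. \<bar>y u - y s\<bar> powr \<theta>\<^sub>2)
                   + norm (h - h') powr \<theta>\<^sub>3))"
    and "1/2 < \<alpha>" "\<alpha> \<le> 1" "holder_continuous \<alpha> \<sigma>"
    and "0 < \<kappa>\<^sub>0" "\<forall>a\<in>coeff_domain. \<kappa>\<^sub>0 \<le> \<kappa> a"
    and "sde_solution M F B H x \<sigma> \<kappa> b X"
  shows "\<forall>t>0. has_density_on (distr M borel (X t)) {y. \<sigma> y \<noteq> 0}"
proof (intro allI impI)
  \<comment> \<open>The time of the claim serves itself as the horizon on which the hypotheses are
    used.\<close>
  fix T :: real assume T: "0 < T"
  interpret brownian_motion M F B by fact
  note sol = \<open>sde_solution M F B H x \<sigma> \<kappa> b X\<close>[unfolded sde_solution_def]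
  have X_cont: "continuous_on {0..} (\<lambda>t. X t \<omega>)" if "\<omega> \<in> space M" for \<omega> using sol that by blast
  let ?a = "\<lambda>s \<omega>. \<sigma> (X s \<omega>) * \<kappa> (s, restrict (\<lambda>u. X u \<omega>) {0..s}, H s \<omega>)"
  let ?b = "\<lambda>s \<omega>. b (s, restrict (\<lambda>u. X u \<omega>) {0..s}, H s \<omega>)"
  obtain I where ito: "is_ito_integral M F B ?a I"
    and eq: "AE \<omega> in M. \<forall>t\<ge>0. X t \<omega> = x + I t \<omega> + (LINT s:{0..t}|lborel. ?b s \<omega>)"
    using sol by blast
  have b_int: "AE \<omega> in M. set_integrable lborel {0..T} (\<lambda>s. ?b s \<omega>)" using sol T by simp
  obtain L where holder: "\<And>y z. \<bar>\<sigma> y - \<sigma> z\<bar> \<le> L * \<bar>y - z\<bar> powr \<alpha>"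
    using \<open>holder_continuous \<alpha> \<sigma>\<close> unfolding holder_continuous_def by blast
  from assms(12)[rule_format, OF T] obtain C where C1': "\<forall>t. 0 \<le> t \<and> t \<le> T \<longrightarrow>
         integrable M (\<lambda>\<omega>. (norm (H t \<omega>))\<^sup>2) \<and> (\<integral>\<omega>. (norm (H t \<omega>))\<^sup>2 \<partial>M) \<le> C"
    and C2': "\<forall>s t. 0 \<le> s \<and> s \<le> t \<and> t \<le> T \<longrightarrow> integrable M (\<lambda>\<omega>. (norm (H t \<omega> - H s \<omega>))\<^sup>2) \<and>
         (\<integral>\<omega>. (norm (H t \<omega> - H s \<omega>))\<^sup>2 \<partial>M) \<le> C * (t - s) powr \<eta>"
    and C3': "\<forall>t y h. 0 \<le> t \<and> t \<le> T \<and> continuous_on {0..} y \<longrightarrow>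
         \<bar>\<sigma> (y t) * \<kappa> (t, restrict y {0..t}, h)\<bar> + \<bar>b (t, restrict y {0..t}, h)\<bar>
           \<le> C * (1 + (SUP u\<in>{0..t}. \<bar>y u\<bar>) + norm h)"
    and C4': "\<forall>s t y h h'. 0 \<le> s \<and> s \<le> t \<and> t \<le> T \<and> continuous_on {0..} y \<longrightarrow>
         \<bar>\<sigma> (y t) * \<kappa> (t, restrict y {0..t}, h) - \<sigma> (y s) * \<kappa> (s, restrict y {0..s}, h')\<bar>
           \<le> C * ((t - s) powr \<theta>\<^sub>1 + (SUP u\<in>{s..t}. \<bar>y u - y s\<bar> powr \<theta>\<^sub>2) + norm (h - h') powr \<theta>\<^sub>3)"
    by (elim exE conjE) (rule that)
  note C1 = C1'[rule_format, OF conjI] and C2 = C2'[rule_format, OF conjI[OF _ conjI]]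
    and C3 = C3'[rule_format, OF conjI[OF _ conjI]]
    and C4 = C4'[rule_format, OF conjI[OF _ conjI[OF _ conjI]]]
  \<comment> \<open>The moment estimates are normalised to a constant of at least 1. Enlarging it
    keeps every bound valid because the factors multiplied by it are nonnegative.\<close>
  let ?C = "max 1 C"
  have C_le: "C * q \<le> ?C * q" if "0 \<le> q" for q by (rule mult_right_mono[OF _ that]) simp
  interpret elliptic_equation M F B X ?a ?b "\<lambda>s \<omega>. norm (H s \<omega>)" I x T ?C \<sigma>
    "\<lambda>r s \<omega>. norm (H s \<omega> - H r \<omega>)" L \<alpha> \<eta> \<theta>\<^sub>1 \<theta>\<^sub>2 \<theta>\<^sub>3 \<kappa>\<^sub>0
  proof unfold_locales
    show "adapted F X" using sol by blast
    show "continuous_on {0..} (\<lambda>t. X t \<omega>)" if "\<omega> \<in> space M" for \<omega> by (rule X_cont[OF that])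
    show "is_ito_integral M F B ?a I" by (rule ito)
    show "AE \<omega> in M. \<forall>t\<ge>0. X t \<omega> = x + I t \<omega> + (LINT s:{0..t}|lborel. ?b s \<omega>)" by (rule eq)
    show "AE \<omega> in M. set_integrable lborel {0..T} (\<lambda>s. ?b s \<omega>)" by (rule b_int)
    show "\<bar>?a s \<omega>\<bar> + \<bar>?b s \<omega>\<bar> \<le> ?C * (1 + (SUP u\<in>{0..s}. \<bar>X u \<omega>\<bar>) + norm (H s \<omega>))"
      if "\<omega> \<in> space M" "0 \<le> s" "s \<le> T" for \<omega> s
    proof (rule order_trans[OF C3[OF that(2,3) X_cont[OF that(1)]] C_le])
      \<comment> \<open>A real supremum is under control only for a bounded set, so its sign is
        derived from continuity on a compact interval.\<close>
      have "continuous_on {0..s} (\<lambda>u. \<bar>X u \<omega>\<bar>)"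
        by (intro continuous_on_rabs continuous_on_subset[OF X_cont[OF that(1)]]) auto
      then have "0 \<le> (SUP u\<in>{0..s}. \<bar>X u \<omega>\<bar>)"
        using that(2) by (intro SUP_nonneg_bdd bdd_above_continuous_image) auto
      then show "0 \<le> 1 + (SUP u\<in>{0..s}. \<bar>X u \<omega>\<bar>) + norm (H s \<omega>)" by simp
    qed
    have "(\<lambda>p. norm (case p of (t, \<omega>) \<Rightarrow> H t \<omega>)) \<in> borel_measurable (predictable_algebra M F)"
      using measurable_compose[OF \<open>predictable M F H\<close>[unfolded predictable_def] borel_measurable_norm] .
    from predictable_joint[OF this]
    show "(\<lambda>(s, \<omega>). indicator {0..} s * norm (H s \<omega>)) \<in> borel_measurable (borel \<Otimes>\<^sub>M M)" by simp
    show "0 \<le> norm (H s \<omega>)" for s \<omega> by simp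
    show "(\<integral>\<^sup>+\<omega>. ennreal ((norm (H s \<omega>))\<^sup>2) \<partial>M) \<le> ennreal ?C" if "0 \<le> s" "s \<le> T" for s
      using C1[OF that] by (subst nn_integral_eq_integral) (auto intro!: ennreal_leI)
    show "0 < T" by (rule T)
    show "1 \<le> ?C" by simp
    show "\<bar>?a s \<omega> - ?a r \<omega>\<bar> \<le> ?C * ((s - r) powr \<theta>\<^sub>1 + (SUP u\<in>{r..s}. \<bar>X u \<omega> - X r \<omega>\<bar> powr \<theta>\<^sub>2)
        + norm (H s \<omega> - H r \<omega>) powr \<theta>\<^sub>3)" if "\<omega> \<in> space M" "0 \<le> r" "r \<le> s" "s \<le> T" for \<omega> r s
    proof (rule order_trans[OF C4[OF that(2-4) X_cont[OF that(1)]] C_le])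
      have "continuous_on {r..s} (\<lambda>u. \<bar>X u \<omega> - X r \<omega>\<bar> powr \<theta>\<^sub>2)"
        using assms(8) that
        by (intro continuous_on_powr' continuous_on_rabs continuous_on_diff continuous_on_const
            continuous_on_subset[OF X_cont[OF that(1)]]) auto
      then have "0 \<le> (SUP u\<in>{r..s}. \<bar>X u \<omega> - X r \<omega>\<bar> powr \<theta>\<^sub>2)"
        using that(3) by (intro SUP_nonneg_bdd bdd_above_continuous_image) auto
      then show "0 \<le> (s - r) powr \<theta>\<^sub>1 + (SUP u\<in>{r..s}. \<bar>X u \<omega> - X r \<omega>\<bar> powr \<theta>\<^sub>2) + norm (H s \<omega> - H r \<omega>) powr \<theta>\<^sub>3"
        by simp
    qed
    \<comment> \<open>Measurability is read off from the integrability in the hypothesis: the space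
      is not assumed separable, and there the difference of two measurable maps can fail to be
      measurable.\<close>
    show "(\<lambda>\<omega>. (norm (H s \<omega> - H r \<omega>))\<^sup>2) \<in> borel_measurable M" if "0 \<le> r" "r \<le> s" "s \<le> T" for r s
      using C2[OF that] by (auto dest: borel_measurable_integrable)
    show "0 \<le> norm (H s \<omega> - H r \<omega>)" for r s \<omega> by simp
    show "(\<integral>\<^sup>+\<omega>. ennreal ((norm (H s \<omega> - H r \<omega>))\<^sup>2) \<partial>M) \<le> ennreal (?C * (s - r) powr \<eta>)"
      if "0 \<le> r" "r \<le> s" "s \<le> T" for r s
    proof -
      have "(\<integral>\<^sup>+\<omega>. ennreal ((norm (H s \<omega> - H r \<omega>))\<^sup>2) \<partial>M) = ennreal (\<integral>\<omega>. (norm (H s \<omega> - H r \<omega>))\<^sup>2 \<partial>M)"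
        using C2[OF that] by (intro nn_integral_eq_integral) auto
      also have "\<dots> \<le> ennreal (?C * (s - r) powr \<eta>)"
        using C2[OF that] C_le[of "(s - r) powr \<eta>"] by (intro ennreal_leI) auto
      finally show ?thesis .
    qed
    show "\<bar>\<sigma> y - \<sigma> z\<bar> \<le> L * \<bar>y - z\<bar> powr \<alpha>" for y z by (rule holder)
    show "\<kappa>\<^sub>0 * \<bar>\<sigma> (X s \<omega>)\<bar> \<le> \<bar>?a s \<omega>\<bar>" if "\<omega> \<in> space M" "0 \<le> s" "s \<le> T" for \<omega> s
    proof -
      have "(s, restrict (\<lambda>u. X u \<omega>) {0..s}, H s \<omega>) \<in> coeff_domain"
        unfolding coeff_domain_def using that(2) X_cont[OF that(1)] by blast
      then have "\<kappa>\<^sub>0 \<le> \<kappa> (s, restrict (\<lambda>u. X u \<omega>) {0..s}, H s \<omega>)" using assms(17) by blast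
      then have "\<kappa>\<^sub>0 \<le> \<bar>\<kappa> (s, restrict (\<lambda>u. X u \<omega>) {0..s}, H s \<omega>)\<bar>" by linarith
      then show ?thesis unfolding abs_mult by (subst mult.commute) (rule mult_left_mono, simp_all)
    qed
  qed (use assms(5-11,13,14,16) in auto)
  let ?D = "{y. \<sigma> y \<noteq> 0}"
  have D: "?D \<in> sets borel" by measurable
  have X_m: "X T \<in> borel_measurable M" using T by simp
  show "has_density_on (distr M borel (X T)) ?D"
    unfolding has_density_on_def absolutely_continuous_def
  proof
    fix A :: "real set" assume A: "A \<in> null_sets lborel"
    then have A_b: "A \<in> sets borel" by auto
    have "AE y in distr M borel (X T). y \<in> A \<longrightarrow> \<sigma> y = 0"
      using null_set_avoided[OF A] A_b by (subst AE_distr_iff[OF X_m]) auto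
    then have "(\<integral>\<^sup>+y. indicator ?D y * indicator A y \<partial>distr M borel (X T)) = (\<integral>\<^sup>+y. 0 \<partial>distr M borel (X T))"
      by (intro nn_integral_cong_AE) (auto simp: indicator_def elim!: eventually_mono)
    then have "emeasure (density (distr M borel (X T)) (indicator ?D)) A = 0"
      using A_b D by (subst emeasure_density) auto
    then show "A \<in> null_sets (density (distr M borel (X T)) (indicator ?D))"
      using A_b by (intro null_setsI) auto
  qed
qed

end
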